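(* Let $\mathbb K$ be an algebraically closed field of characteristic $2$, let $\alpha\in\mathbb K$, $\alpha\neq0,1$, and let $\mathfrak g=\mathfrak{wk}(3;\alpha)=\mathfrak g(A)$ be the Weisfeiler--Kac Lie algebra with Cartan matrix $$A=\begin{pmatrix}0&\alpha&0\\ \alpha&0&1\\0&1&0\end{pmatrix}$$ with the basis $x_1,\dots,x_7,y_1,\dots,y_7,h_1,h_2,h_3,h_4$ described in the context. (1) $H^2(\mathfrak g;\mathfrak g)$ is spanned by the classes of the following cocycles $c_{-6},c_{-4}^1,c_{-4}^2,c_{-2},c_0$ and of the symmetric cocycles $\omega\cdot c_{-6},\ \omega\cdot c_{-4}^1,\ \omega\cdot c_{-4}^2,\ \omega\cdot c_{-2}$ of positive degree: $c_{-6}= \alpha(1+\alpha)y_1\otimes \hat x_3\wedge \hat x_7 +\alpha y_1\otimes \hat x_5\wedge \hat x_6 + \alpha(1+\alpha) y_3\otimes \hat x_1\wedge \hat x_7 +\alpha ^2y_3\otimes \hat x_4\wedge \hat x_6+ \alpha y_4\otimes \hat x_3\wedge \hat x_6 +\alpha y_5\otimes \hat x_1\wedge \hat x_6 +y_6\otimes \hat x_1\wedge \hat x_5 +\alpha y_6\otimes \hat x_3\wedge \hat x_4+y_7\otimes \hat x_1\wedge \hat x_3$; $c_{-4}^1= \alpha (1+\alpha) x_1\otimes \hat x_3\wedge \hat x_7 +\alpha x_1\otimes \hat x_5\wedge \hat x_6 +\alpha y_2\otimes \hat x_3\wedge \hat x_5 +\alpha y_3\otimes \hat x_2\wedge \hat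 x_5+ \alpha (1+\alpha) y_3\otimes \hat x_7\wedge \hat y_1+\alpha y_5\otimes \hat x_2\wedge \hat x_3 +\alpha y_5\otimes \hat x_6\wedge \hat y_1 +y_6\otimes \hat x_5\wedge \hat y_1 + y_7\otimes \hat x_3\wedge \hat y_1$; $c_{-4}^2= \alpha (1+\alpha) x_3\otimes \hat x_1\wedge \hat x_7 +\alpha ^2x_3\otimes \hat x_4\wedge \hat x_6 +\alpha y_1\otimes \hat x_2\wedge \hat x_4 +\alpha (1+\alpha) y_1\otimes \hat x_7\wedge \hat y_3+ \alpha y_2\otimes \hat x_1\wedge \hat x_4 +y_4\otimes \hat x_1\wedge \hat x_2 +\alpha y_4\otimes \hat x_6\wedge \hat y_3 +\alpha y_6\otimes \hat x_4\wedge \hat y_3 +y_7\otimes \hat x_1\wedge \hat y_3$; $c_{-2}= \alpha x_1\otimes \hat x_2\wedge \hat x_4 +\alpha (1+\alpha) x_1\otimes \hat x_7\wedge \hat y_3 +\alpha x_3\otimes \hat x_2\wedge \hat x_5 +\alpha (1+\alpha) x_3\otimes \hat x_7\wedge \hat y_1+ \alpha y_2\otimes \hat x_4\wedge \hat y_1 +\alpha y_2\otimes \hat x_5\wedge \hat y_3 +y_4\otimes \hat x_2\wedge \hat y_1 +\alpha y_5\otimes \hat x_2\wedge \hat y_3 +y_7\otimes \hat y_1\wedge \hat y_3$; $c_{0}= h_1\otimes \hat x_4 \wedge \hat y_4 +h_1\otimes \hat x_6 \wedge \hat y_6 +h_1\otimes \hat x_7 \wedge \hat y_7 +\alpha h_3\otimes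 \hat x_7 \wedge \hat y_7 +h_4\otimes \hat x_2 \wedge \hat y_2+ \alpha h_4\otimes \hat x_4 \wedge \hat y_4 +h_4\otimes \hat x_5 \wedge \hat y_5 +\alpha h_4\otimes \hat x_6 \wedge \hat y_6+x_1\otimes \hat x_4 \wedge \hat y_2 +x_1\otimes \hat x_6 \wedge \hat y_5+ \alpha x_2\otimes \hat x_7 \wedge \hat y_6+x_4\otimes \hat x_7 \wedge \hat y_5 +\alpha x_5\otimes \hat x_7 \wedge \hat y_4 +x_6\otimes \hat x_7 \wedge \hat y_2 +y_1\otimes \hat x_2 \wedge \hat y_4+ y_1\otimes \hat x_5 \wedge \hat y_6 +\alpha y_2\otimes \hat x_6 \wedge \hat y_7+y_4\otimes \hat x_5 \wedge \hat y_7 +\alpha y_5\otimes \hat x_4 \wedge \hat y_7+y_6\otimes \hat x_2 \wedge \hat y_7$. (2) For the derived algebra $\mathfrak g=\mathfrak{wk}^{(1)}(3;\alpha)$, with basis $x_1,\dots,x_7,y_1,\dots,y_7,h_1,h_2,h_3$, the space $H^2(\mathfrak g;\mathfrak g)$ is spanned in the same way by the classes of the cocycles given by the same expressions $c_{-6},c_{-4}^1,c_{-4}^2,c_{-2}$, their symmetric counterparts, and $c_0=(\alpha +1) h_1\otimes \hat x_4\wedge \hat y_4+(\alpha +1) h_1\otimes \hat x_6\wedge \hat y_6+(\alpha +1) h_1\otimes \hat x_7\wedge \hat y_7+h_2\otimes \hat x_2\wedge \hat y_2 +\alpha h_2\otimes \hat x_4\wedge \hat y_4+h_2\otimes \hat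 x_5\wedge \hat y_5 + \alpha h_2\otimes \hat x_6\wedge \hat y_6 +(\alpha ^2+\alpha ) h_3\otimes \hat x_7\wedge \hat y_7 +x_1\otimes \hat h_2\wedge \hat x_1 +(\alpha +1) x_1\otimes \hat x_4\wedge \hat y_2 +(\alpha+1) x_1\otimes \hat x_6\wedge \hat y_5 + (\alpha^2+\alpha ) x_2\otimes \hat x_7\wedge \hat y_6 +x_3\otimes \hat h_2\wedge \hat x_3 +x_4\otimes \hat h_2\wedge \hat x_4 +(\alpha +1) x_4\otimes \hat x_7\wedge \hat y_5 +x_5\otimes \hat h_2\wedge \hat x_5 +(\alpha^2+\alpha ) x_5\otimes \hat x_7\wedge \hat y_4+ (\alpha +1) x_6\otimes \hat x_7\wedge \hat y_2 +y_1\otimes \hat h_2\wedge \hat y_1 +(\alpha +1) y_1\otimes \hat x_2\wedge \hat y_4 +(\alpha+1) y_1\otimes \hat x_5\wedge \hat y_6+(\alpha^2+\alpha ) y_2\otimes \hat x_6\wedge \hat y_7 +y_3\otimes \hat h_2\wedge \hat y_3 + y_4\otimes \hat h_2\wedge \hat y_4 +(\alpha +1) y_4\otimes \hat x_5\wedge \hat y_7 +y_5\otimes \hat h_2\wedge \hat y_5+(\alpha ^2+\alpha ) y_5\otimes \hat x_4\wedge \hat y_7+(\alpha +1) y_6\otimes \hat x_2\wedge \hat y_7$. (3) For $\mathfrak g=\mathfrak{wk}^{(1)}(3;\alpha)/\mathfrak c$, where $\mathfrak c=\mathbb K(h_1+\alpha h_3)$ is the center, with basis (the images of) $x_1,\dots,x_7,y_1,\dots,y_7,h_2,h_3$,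 the space $H^2(\mathfrak g;\mathfrak g)$ is spanned in the same way by the classes of the cocycles given by the same expressions $c_{-6},c_{-4}^1,c_{-4}^2,c_{-2}$, their symmetric counterparts, and $c_0= h_2\otimes \hat x_2\wedge \hat y_2+\alpha h_2\otimes \hat x_4\wedge \hat y_4+h_2\otimes \hat x_5\wedge \hat y_5+\alpha h_2\otimes \hat x_6\wedge \hat y_6+(\alpha ^2+\alpha ) h_3\otimes \hat x_4\wedge \hat y_4 +(\alpha ^2+\alpha ) h_3\otimes \hat x_6\wedge \hat y_6 + x_1\otimes \hat h_2\wedge \hat x_1 +(\alpha +1) x_1\otimes \hat x_4\wedge \hat y_2 +(\alpha +1) x_1\otimes \hat x_6\wedge \hat y_5 +(\alpha ^2+\alpha ) x_2\otimes \hat x_7\wedge \hat y_6+x_3\otimes \hat h_2\wedge \hat x_3+x_4\otimes \hat h_2\wedge \hat x_4+ (\alpha +1) x_4\otimes \hat x_7\wedge \hat y_5 +x_5\otimes \hat h_2\wedge \hat x_5+(\alpha ^2+\alpha ) x_5\otimes \hat x_7\wedge \hat y_4+(\alpha +1) x_6\otimes \hat x_7\wedge \hat y_2+y_1\otimes \hat h_2\wedge \hat y_1 + (\alpha +1) y_1\otimes \hat x_2\wedge \hat y_4+(\alpha +1) y_1\otimes \hat x_5\wedge \hat y_6 +(\alpha ^2+\alpha ) y_2\otimes \hat x_6\wedge \hat y_7 +y_3\otimes \hat h_2\wedge \hat y_3 +y_4\otimes \hat h_2\wedge \hat y_4 +(\alpha +1) y_4\otimes \hat x_5\wedge \hat y_7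 + y_5\otimes \hat h_2\wedge \hat y_5 +(\alpha ^2+\alpha ) y_5\otimes \hat x_4\wedge \hat y_7 +(\alpha +1) y_6\otimes \hat x_2\wedge \hat y_7$.
   Context: For an $n\times n$ matrix $A$ over $\mathbb K$, $\mathfrak g(A)$ is the quotient of the Lie algebra generated by $x_i,y_i$ ($1\le i\le n$) and a commutative subalgebra $\mathfrak h$, subject to $[x_i,y_j]=\delta_{ij}h_i$, $[h_i,x_j]=A_{ij}x_j$, $[h_i,y_j]=-A_{ij}y_j$, by the maximal ideal intersecting $\mathfrak h$ trivially; here $\mathfrak h$ is spanned by linearly independent $h_1,\dots,h_n$ together with $n-\mathrm{rank}(A)$ grading elements acting diagonally on the generators so that the weights of $x_1,\dots,x_n$ with respect to $\mathfrak h$ are linearly independent. For $\mathfrak{wk}(3;\alpha)$ there is one grading element $h_4$, acting by $[h_4,x_i]=\delta_{i1}x_i$, $[h_4,y_i]=\delta_{i1}y_i$ for $i=1,2,3$ (characteristic $2$). Positive basis elements: generators $x_1,x_2,x_3$ and $x_4=[x_1,x_2]$, $x_5=[x_2,x_3]$, $x_6=[x_3,[x_1,x_2]]$, $x_7=[[x_1,x_2],[x_2,x_3]]$. The negative basis elements $y_k$ are given by the same brackets with $x$'s replaced by $y$'s. The degree is that of the principal grading: $\deg x_i=1$, $\deg y_i=-1$ for the generators; the lower index of a cocycle is its degree. $H^2(\mathfrak g;\mathfrak g)$ is Chevalley--Eilenberg cohomology (with alternating cochains) with coefficients in the adjoint module. $\hat v$ denotes the element of the dual basis corresponding to the basis element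 $v$, and $u\otimes\hat v\wedge\hat w$ is the cochain $(X,Y)\mapsto(\hat v(X)\hat w(Y)+\hat v(Y)\hat w(X))u$. $\omega$ is the automorphism interchanging $x_i$ and $y_i$ for the generators and fixing all $h_i$ (it induces automorphisms of the derived algebra and its quotient), and $(\omega\cdot c)(X,Y)=\omega(c(\omega^{-1}X,\omega^{-1}Y))$.
   Formalization: The ideal defining g(A) is taken to be the largest ideal, among those graded by the principal grading, that intersects h trivially; without gradedness no largest such ideal exists in characteristic 2 for this Cartan matrix. *)

theory Defs
  imports "HOL-Analysis.Cartesian_Space" "HOL-Library.Poly_Mapping" "HOL-Library.FuncSet"
    "HOL-Computational_Algebra.Polynomial"
begin

section \<open>Vector spaces and Lie algebras on a carrier set\<close>

text \<open>
  The algebras below depend on the parameter \<open>\<alpha>\<close> and are iterated quotients, so they are sets of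
  cosets, not types. The scalars are taken from a field type.
\<close>

record ('k, 'v) vect =
  vcarrier :: "'v set"
  vzero :: 'v
  vadd :: "'v \<Rightarrow> 'v \<Rightarrow> 'v"
  vscale :: "'k \<Rightarrow> 'v \<Rightarrow> 'v"

record ('k, 'v) lie = "('k, 'v) vect" +
  bracket :: "'v \<Rightarrow> 'v \<Rightarrow> 'v"

definition vsum :: "('k, 'v, 'm) vect_scheme \<Rightarrow> 'v list \<Rightarrow> 'v" where
  "vsum V vs = foldr (vadd V) vs (vzero V)"

definition vneg :: "('k::field, 'v, 'm) vect_scheme \<Rightarrow> 'v \<Rightarrow> 'v" where
  "vneg V v = vscale V (- 1) v"

definition vsubspace :: "('k, 'v, 'm) vect_scheme \<Rightarrow> 'v set \<Rightarrow> bool" where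
  "vsubspace V U \<longleftrightarrow> U \<subseteq> vcarrier V \<and> vzero V \<in> U \<and>
     (\<forall>u\<in>U. \<forall>v\<in>U. vadd V u v \<in> U) \<and> (\<forall>a. \<forall>u\<in>U. vscale V a u \<in> U)"

definition vspan :: "('k, 'v, 'm) vect_scheme \<Rightarrow> 'v set \<Rightarrow> 'v set" where
  "vspan V S = \<Inter>{U. vsubspace V U \<and> S \<subseteq> U}"

definition vbasis :: "('k, 'v, 'm) vect_scheme \<Rightarrow> 'i set \<Rightarrow> ('i \<Rightarrow> 'v) \<Rightarrow> bool" where
  "vbasis V I b \<longleftrightarrow> b ` I \<subseteq> vcarrier V \<and> vspan V (b ` I) = vcarrier V \<and>
     (\<forall>i\<in>I. b i \<notin> vspan V (b ` (I - {i})))"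

definition vlinear :: "('k, 'v, 'm) vect_scheme \<Rightarrow> ('k, 'w, 'n) vect_scheme \<Rightarrow> ('v \<Rightarrow> 'w) \<Rightarrow> bool" where
  "vlinear V W f \<longleftrightarrow> f \<in> vcarrier V \<rightarrow> vcarrier W \<and>
     (\<forall>u\<in>vcarrier V. \<forall>v\<in>vcarrier V. f (vadd V u v) = vadd W (f u) (f v)) \<and>
     (\<forall>a. \<forall>u\<in>vcarrier V. f (vscale V a u) = vscale W a (f u))"

definition scalars :: "('k::field, 'k) vect" where
  "scalars = \<lparr>vcarrier = UNIV, vzero = 0, vadd = (+), vscale = (*)\<rparr>"

definition dual_vec :: "('k::field, 'v, 'm) vect_scheme \<Rightarrow> 'i set \<Rightarrow> ('i \<Rightarrow> 'v) \<Rightarrow> 'i \<Rightarrow> 'v \<Rightarrow> 'k" where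
  "dual_vec V I b i = (THE f. f \<in> extensional (vcarrier V) \<and> vlinear V scalars f \<and>
     (\<forall>j\<in>I. f (b j) = (if j = i then 1 else 0)))"

definition vcoset :: "('k, 'v, 'm) vect_scheme \<Rightarrow> 'v set \<Rightarrow> 'v \<Rightarrow> 'v set" where
  "vcoset V U v = vadd V v ` U"

definition vquot :: "('k, 'v, 'm) vect_scheme \<Rightarrow> 'v set \<Rightarrow> ('k, 'v set) vect" where
  "vquot V U = \<lparr>
     vcarrier = vcoset V U ` vcarrier V,
     vzero = U,
     vadd = (\<lambda>A B. \<Union>x\<in>A. \<Union>y\<in>B. vcoset V U (vadd V x y)),
     vscale = (\<lambda>a A. \<Union>x\<in>A. vcoset V U (vscale V a x))\<rparr>"

text \<open>Two-sided, because it is also used for the non-associative algebra \<open>free_alg\<close> below.\<close>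

definition lie_ideal :: "('k, 'v) lie \<Rightarrow> 'v set \<Rightarrow> bool" where
  "lie_ideal L I \<longleftrightarrow> vsubspace L I \<and>
     (\<forall>x\<in>vcarrier L. \<forall>y\<in>I. bracket L x y \<in> I \<and> bracket L y x \<in> I)"

definition ideal_gen :: "('k, 'v) lie \<Rightarrow> 'v set \<Rightarrow> 'v set" where
  "ideal_gen L S = \<Inter>{I. lie_ideal L I \<and> S \<subseteq> I}"

definition lie_quot :: "('k, 'v) lie \<Rightarrow> 'v set \<Rightarrow> ('k, 'v set) lie" where
  "lie_quot L I = vect.extend (vquot L I)
     (lie.fields (\<lambda>A B. \<Union>x\<in>A. \<Union>y\<in>B. vcoset L I (bracket L x y)))"

definition derived_alg :: "('k, 'v) lie \<Rightarrow> ('k, 'v) lie" where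
  "derived_alg L = L\<lparr>vcarrier :=
     vspan L {bracket L x y | x y. x \<in> vcarrier L \<and> y \<in> vcarrier L}\<rparr>"

definition lie_center :: "('k, 'v) lie \<Rightarrow> 'v set" where
  "lie_center L = {x \<in> vcarrier L. \<forall>y\<in>vcarrier L. bracket L x y = vzero L}"

definition lie_aut :: "('k, 'v) lie \<Rightarrow> ('v \<Rightarrow> 'v) \<Rightarrow> bool" where
  "lie_aut L f \<longleftrightarrow> vlinear L L f \<and> bij_betw f (vcarrier L) (vcarrier L) \<and>
     (\<forall>x\<in>vcarrier L. \<forall>y\<in>vcarrier L. f (bracket L x y) = bracket L (f x) (f y))"

text \<open>
  The grading of \<open>L\<close> determined by prescribed degrees of generators: \<open>homog L G d v\<close> says that \<open>v\<close>
  lies in the component of degree \<open>d\<close>, where \<open>(g, d) \<in> G\<close> gives the generator \<open>g\<close> degree \<open>d\<close>.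
\<close>

inductive homog :: "('k, 'v) lie \<Rightarrow> ('v \<times> int) set \<Rightarrow> int \<Rightarrow> 'v \<Rightarrow> bool"
  for L :: "('k, 'v) lie" and G :: "('v \<times> int) set" where
  gen: "(g, d) \<in> G \<Longrightarrow> homog L G d g"
| zero: "homog L G d (vzero L)"
| add: "homog L G d u \<Longrightarrow> homog L G d v \<Longrightarrow> homog L G d (vadd L u v)"
| scale: "homog L G d u \<Longrightarrow> homog L G d (vscale L a u)"
| bracket: "homog L G d u \<Longrightarrow> homog L G e v \<Longrightarrow> homog L G (d + e) (bracket L u v)"

definition graded_ideal :: "('k, 'v) lie \<Rightarrow> ('v \<times> int) set \<Rightarrow> 'v set \<Rightarrow> bool" where
  "graded_ideal L G I \<longleftrightarrow> lie_ideal L I \<and> I = vspan L {v \<in> I. \<exists>d. homog L G d v}"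


section \<open>The Lie algebra of a Cartan matrix\<close>

datatype 'a word = Gen 'a | Br "'a word" "'a word"

text \<open>The free non-associative algebra with basis the bracketed words.\<close>

definition free_alg :: "('k::field, 'a word \<Rightarrow>\<^sub>0 'k) lie" where
  "free_alg = \<lparr>vcarrier = UNIV, vzero = 0, vadd = (+), vscale = (\<lambda>a. Poly_Mapping.map ((*) a)),
     bracket = (\<lambda>p q. \<Sum>u\<in>Poly_Mapping.keys p. \<Sum>v\<in>Poly_Mapping.keys q.
       Poly_Mapping.single (Br u v) (Poly_Mapping.lookup p u * Poly_Mapping.lookup q v))\<rparr>"

definition lie_laws :: "('a word \<Rightarrow>\<^sub>0 'k::field) set" where
  "lie_laws = (let br = bracket free_alg in
     range (\<lambda>p. br p p) \<union> {br p (br q s) + br q (br s p) + br s (br p q) | p q s. True})"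

definition presentation_ideal :: "('a word \<Rightarrow>\<^sub>0 'k::field) set \<Rightarrow> ('a word \<Rightarrow>\<^sub>0 'k) set" where
  "presentation_ideal R = ideal_gen free_alg (lie_laws \<union> R)"

text \<open>
  Generators \<open>x\<^sub>i\<close>, \<open>y\<^sub>i\<close>, \<open>h\<^sub>i\<close> and the additional grading elements. Row \<open>k\<close> of the matrix \<open>D\<close> below
  contains the weights of \<open>x\<^sub>1, \<dots>, x\<^sub>n\<close> under the \<open>k\<close>-th grading element. In the intended use, \<open>D\<close> has
  \<open>n - rank A\<close> rows, and the columns of \<open>A\<close> extended by \<open>D\<close> are linearly independent.
\<close>

datatype ('n, 'm) gen = GX 'n | GY 'n | GH 'n | GD 'm

definition gen_poly :: "'a \<Rightarrow> ('a word \<Rightarrow>\<^sub>0 'k::field)" where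
  "gen_poly g = Poly_Mapping.single (Gen g) 1"

definition cartan_relations ::
    "'k::field^'n^'n \<Rightarrow> 'k^'n^'m \<Rightarrow> (('n, 'm) gen word \<Rightarrow>\<^sub>0 'k) set" where
  "cartan_relations A D =
     (let br = bracket free_alg; sc = vscale free_alg;
          x = (\<lambda>i. gen_poly (GX i)); y = (\<lambda>i. gen_poly (GY i));
          h = (\<lambda>i. gen_poly (GH i)); d = (\<lambda>k. gen_poly (GD k)) in
      {br (x i) (y j) - (if i = j then h i else 0) | i j. True} \<union>
      {br (h i) (x j) - sc (A $ i $ j) (x j) | i j. True} \<union>
      {br (h i) (y j) + sc (A $ i $ j) (y j) | i j. True} \<union>
      {br (d k) (x j) - sc (D $ k $ j) (x j) | k j. True} \<union>
      {br (d k) (y j) + sc (D $ k $ j) (y j) | k j. True} \<union>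
      {br u v | u v. u \<in> range h \<union> range d \<and> v \<in> range h \<union> range d})"

definition g_tilde ::
    "'k::field^'n^'n \<Rightarrow> 'k^'n^'m \<Rightarrow> ('k, (('n, 'm) gen word \<Rightarrow>\<^sub>0 'k) set) lie" where
  "g_tilde A D = lie_quot free_alg (presentation_ideal (cartan_relations A D))"

definition g_tilde_gen ::
    "'k::field^'n^'n \<Rightarrow> 'k^'n^'m \<Rightarrow> ('n, 'm) gen \<Rightarrow> (('n, 'm) gen word \<Rightarrow>\<^sub>0 'k) set" where
  "g_tilde_gen A D g = vcoset free_alg (presentation_ideal (cartan_relations A D)) (gen_poly g)"

primrec principal_degree :: "('n, 'm) gen \<Rightarrow> int" where
  "principal_degree (GX i) = 1"
| "principal_degree (GY i) = - 1"
| "principal_degree (GH i) = 0"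
| "principal_degree (GD k) = 0"

text \<open>
  The largest ideal of \<open>g_tilde A D\<close> meeting the Cartan subalgebra trivially, taken among the graded
  ideals. In positive characteristic, the ideals that are not graded have to be excluded: the weights
  take values in the field, and without grading there need not be a largest such ideal. For the matrix
  \<open>wk_matrix \<alpha>\<close> below, \<open>u = [x\<^sub>2,[x\<^sub>1,[x\<^sub>1,x\<^sub>2]]]\<close> has weight \<open>0\<close> and is annihilated by all
  \<open>y\<^sub>i\<close>, so that \<open>u\<close> and \<open>h\<^sub>1 + \<alpha> h\<^sub>3 + u\<close> each generate an ideal meeting the Cartan subalgebra
  trivially, but the sum of these ideals contains \<open>h\<^sub>1 + \<alpha> h\<^sub>3\<close>.
\<close>

definition max_ideal ::
    "'k::field^'n^'n \<Rightarrow> 'k^'n^'m \<Rightarrow> (('n, 'm) gen word \<Rightarrow>\<^sub>0 'k) set set" where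
  "max_ideal A D =
     (GREATEST I. graded_ideal (g_tilde A D) (range (\<lambda>g. (g_tilde_gen A D g, principal_degree g))) I \<and>
        I \<inter> vspan (g_tilde A D) (g_tilde_gen A D ` (range GH \<union> range GD)) = {vzero (g_tilde A D)})"

definition g_cartan ::
    "'k::field^'n^'n \<Rightarrow> 'k^'n^'m \<Rightarrow> ('k, (('n, 'm) gen word \<Rightarrow>\<^sub>0 'k) set set) lie" where
  "g_cartan A D = lie_quot (g_tilde A D) (max_ideal A D)"

definition g_cartan_gen ::
    "'k::field^'n^'n \<Rightarrow> 'k^'n^'m \<Rightarrow> ('n, 'm) gen \<Rightarrow> (('n, 'm) gen word \<Rightarrow>\<^sub>0 'k) set set" where
  "g_cartan_gen A D g = vcoset (g_tilde A D) (max_ideal A D) (g_tilde_gen A D g)"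


section \<open>Second cohomology with coefficients in the adjoint module\<close>

text \<open>Cochains are functions on (pairs from) the carrier, extensional in the sense of \<open>FuncSet\<close>.\<close>

definition cochains1 :: "('k, 'v) lie \<Rightarrow> ('v \<Rightarrow> 'v) set" where
  "cochains1 L = {f \<in> extensional (vcarrier L). vlinear L L f}"

definition cochains2 :: "('k, 'v) lie \<Rightarrow> ('k, 'v \<times> 'v \<Rightarrow> 'v) vect" where
  "cochains2 L = (let P = vcarrier L \<times> vcarrier L in \<lparr>
     vcarrier = {c \<in> extensional P.
       (\<forall>x\<in>vcarrier L. vlinear L L (\<lambda>y. c (x, y))) \<and>
       (\<forall>y\<in>vcarrier L. vlinear L L (\<lambda>x. c (x, y))) \<and>
       (\<forall>x\<in>vcarrier L. c (x, x) = vzero L)},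
     vzero = (\<lambda>p\<in>P. vzero L),
     vadd = (\<lambda>c c'. \<lambda>p\<in>P. vadd L (c p) (c' p)),
     vscale = (\<lambda>a c. \<lambda>p\<in>P. vscale L a (c p))\<rparr>)"

definition coboundary1 :: "('k::field, 'v) lie \<Rightarrow> ('v \<Rightarrow> 'v) \<Rightarrow> 'v \<times> 'v \<Rightarrow> 'v" where
  "coboundary1 L f = (\<lambda>(x, y)\<in>vcarrier L \<times> vcarrier L. vsum L
     [bracket L x (f y), vneg L (bracket L y (f x)), vneg L (f (bracket L x y))])"

definition coboundary2 :: "('k::field, 'v) lie \<Rightarrow> ('v \<times> 'v \<Rightarrow> 'v) \<Rightarrow> 'v \<Rightarrow> 'v \<Rightarrow> 'v \<Rightarrow> 'v" where
  "coboundary2 L c x y z = vsum L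
     [bracket L x (c (y, z)), vneg L (bracket L y (c (x, z))), bracket L z (c (x, y)),
      vneg L (c (bracket L x y, z)), c (bracket L x z, y), vneg L (c (bracket L y z, x))]"

definition cocycles2 :: "('k::field, 'v) lie \<Rightarrow> ('k, 'v \<times> 'v \<Rightarrow> 'v) vect" where
  "cocycles2 L = (cochains2 L)\<lparr>vcarrier := {c \<in> vcarrier (cochains2 L).
     \<forall>x\<in>vcarrier L. \<forall>y\<in>vcarrier L. \<forall>z\<in>vcarrier L. coboundary2 L c x y z = vzero L}\<rparr>"

definition coboundaries2 :: "('k::field, 'v) lie \<Rightarrow> ('v \<times> 'v \<Rightarrow> 'v) set" where
  "coboundaries2 L = coboundary1 L ` cochains1 L"

definition H2 :: "('k::field, 'v) lie \<Rightarrow> ('k, ('v \<times> 'v \<Rightarrow> 'v) set) vect" where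
  "H2 L = vquot (cocycles2 L) (coboundaries2 L)"

definition cohomology_class :: "('k::field, 'v) lie \<Rightarrow> ('v \<times> 'v \<Rightarrow> 'v) \<Rightarrow> ('v \<times> 'v \<Rightarrow> 'v) set" where
  "cohomology_class L c = vcoset (cocycles2 L) (coboundaries2 L) c"

definition H2_spanned_by :: "('k::field, 'v) lie \<Rightarrow> ('v \<times> 'v \<Rightarrow> 'v) set \<Rightarrow> bool" where
  "H2_spanned_by L S \<longleftrightarrow> S \<subseteq> vcarrier (cocycles2 L) \<and>
     vspan (H2 L) (cohomology_class L ` S) = vcarrier (H2 L)"

definition has_degree :: "('k, 'v) lie \<Rightarrow> ('v \<times> int) set \<Rightarrow> ('v \<times> 'v \<Rightarrow> 'v) \<Rightarrow> int \<Rightarrow> bool" where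
  "has_degree L G c d \<longleftrightarrow>
     (\<forall>p q s t. homog L G p s \<and> homog L G q t \<longrightarrow> homog L G (p + q + d) (c (s, t)))"

definition aut_action :: "('k, 'v) lie \<Rightarrow> ('v \<Rightarrow> 'v) \<Rightarrow> ('v \<times> 'v \<Rightarrow> 'v) \<Rightarrow> 'v \<times> 'v \<Rightarrow> 'v" where
  "aut_action L \<omega> c = (\<lambda>(s, t)\<in>vcarrier L \<times> vcarrier L.
     \<omega> (c (inv_into (vcarrier L) \<omega> s, inv_into (vcarrier L) \<omega> t)))"


section \<open>The algebra \<open>wk(3;\<alpha>)\<close>, its derived algebra, and the quotient by the center\<close>

definition wk_matrix :: "'k::field \<Rightarrow> 'k^3^3" where
  "wk_matrix \<alpha> = vector [vector [0, \<alpha>, 0], vector [\<alpha>, 0, 1], vector [0, 1, 0]]"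

definition wk_grading :: "'k::field^3^1" where
  "wk_grading = vector [vector [1, 0, 0]]"

type_synonym 'k wk_elem = "((3, 1) gen word \<Rightarrow>\<^sub>0 'k) set set"

definition wk :: "'k::field \<Rightarrow> ('k, 'k wk_elem) lie" where
  "wk \<alpha> = g_cartan (wk_matrix \<alpha>) wk_grading"

datatype label = X nat | Y nat | H nat

definition root_vector :: "('k, 'v) lie \<Rightarrow> 'v \<Rightarrow> 'v \<Rightarrow> 'v \<Rightarrow> nat \<Rightarrow> 'v" where
  "root_vector L e1 e2 e3 k = (let br = bracket L in
     [e1, e2, e3, br e1 e2, br e2 e3, br e3 (br e1 e2), br (br e1 e2) (br e2 e3)] ! (k - 1))"

primrec wk_vec :: "'k::field \<Rightarrow> label \<Rightarrow> 'k wk_elem" where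
  "wk_vec \<alpha> (X k) = (let g = g_cartan_gen (wk_matrix \<alpha>) wk_grading in
     root_vector (wk \<alpha>) (g (GX 1)) (g (GX 2)) (g (GX 3)) k)"
| "wk_vec \<alpha> (Y k) = (let g = g_cartan_gen (wk_matrix \<alpha>) wk_grading in
     root_vector (wk \<alpha>) (g (GY 1)) (g (GY 2)) (g (GY 3)) k)"
| "wk_vec \<alpha> (H k) = (let g = g_cartan_gen (wk_matrix \<alpha>) wk_grading in
     [g (GH 1), g (GH 2), g (GH 3), g (GD 1)] ! (k - 1))"

definition wk1 :: "'k::field \<Rightarrow> ('k, 'k wk_elem) lie" where
  "wk1 \<alpha> = derived_alg (wk \<alpha>)"

definition wk_c :: "'k::field \<Rightarrow> 'k wk_elem set" where
  "wk_c \<alpha> = vspan (wk1 \<alpha>)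
     {vadd (wk1 \<alpha>) (wk_vec \<alpha> (H 1)) (vscale (wk1 \<alpha>) \<alpha> (wk_vec \<alpha> (H 3)))}"

definition wkq :: "'k::field \<Rightarrow> ('k, 'k wk_elem set) lie" where
  "wkq \<alpha> = lie_quot (wk1 \<alpha>) (wk_c \<alpha>)"

definition wkq_vec :: "'k::field \<Rightarrow> label \<Rightarrow> 'k wk_elem set" where
  "wkq_vec \<alpha> l = vcoset (wk1 \<alpha>) (wk_c \<alpha>) (wk_vec \<alpha> l)"

text \<open>The argument lists the indices of the basis elements \<open>h\<^sub>k\<close>.\<close>

definition labels :: "nat set \<Rightarrow> label set" where
  "labels hs = X ` {1..7} \<union> Y ` {1..7} \<union> H ` hs"

definition label_degrees :: "nat set \<Rightarrow> (label \<Rightarrow> 'v) \<Rightarrow> ('v \<times> int) set" where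
  "label_degrees hs b =
     {(b (X i), 1) | i. i \<in> {1..3}} \<union> {(b (Y i), - 1) | i. i \<in> {1..3}} \<union> {(b (H k), 0) | k. k \<in> hs}"

definition is_wk_omega :: "'k::field \<Rightarrow> ('k wk_elem \<Rightarrow> 'k wk_elem) \<Rightarrow> bool" where
  "is_wk_omega \<alpha> \<omega> \<longleftrightarrow> \<omega> \<in> extensional (vcarrier (wk \<alpha>)) \<and> lie_aut (wk \<alpha>) \<omega> \<and>
     (\<forall>i\<in>{1..3}. \<omega> (wk_vec \<alpha> (X i)) = wk_vec \<alpha> (Y i) \<and> \<omega> (wk_vec \<alpha> (Y i)) = wk_vec \<alpha> (X i)) \<and>
     (\<forall>k\<in>{1..4}. \<omega> (wk_vec \<alpha> (H k)) = wk_vec \<alpha> (H k))"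

definition wk_omega :: "'k::field \<Rightarrow> 'k wk_elem \<Rightarrow> 'k wk_elem" where
  "wk_omega \<alpha> = (THE \<omega>. is_wk_omega \<alpha> \<omega>)"


section \<open>The cocycles\<close>

text \<open>An entry \<open>(a, u, v, w)\<close> stands for the summand \<open>a u \<otimes> v\<^sup>* \<and> w\<^sup>*\<close>.\<close>

type_synonym 'k cochain_expr = "('k \<times> label \<times> label \<times> label) list"

text \<open>In characteristic \<open>2\<close> the sign in \<open>v\<^sup>* \<and> w\<^sup>*\<close> is immaterial and is written as a plus.\<close>

definition elementary_cochain ::
    "('k::field, 'v) lie \<Rightarrow> label set \<Rightarrow> (label \<Rightarrow> 'v) \<Rightarrow> label \<Rightarrow> label \<Rightarrow> label \<Rightarrow> 'v \<times> 'v \<Rightarrow> 'v" where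
  "elementary_cochain L I b u v w = (\<lambda>(s, t)\<in>vcarrier L \<times> vcarrier L.
     vscale L (dual_vec L I b v s * dual_vec L I b w t + dual_vec L I b v t * dual_vec L I b w s) (b u))"

definition cochain ::
    "('k::field, 'v) lie \<Rightarrow> label set \<Rightarrow> (label \<Rightarrow> 'v) \<Rightarrow> 'k cochain_expr \<Rightarrow> 'v \<times> 'v \<Rightarrow> 'v" where
  "cochain L I b ts = vsum (cochains2 L)
     (map (\<lambda>(a, u, v, w). vscale (cochains2 L) a (elementary_cochain L I b u v w)) ts)"

definition c_m6 :: "'k::field \<Rightarrow> 'k cochain_expr" where
  "c_m6 \<alpha> = [
     (\<alpha> * (1 + \<alpha>), Y 1, X 3, X 7), (\<alpha>, Y 1, X 5, X 6), (\<alpha> * (1 + \<alpha>), Y 3, X 1, X 7),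
     (\<alpha>^2, Y 3, X 4, X 6), (\<alpha>, Y 4, X 3, X 6), (\<alpha>, Y 5, X 1, X 6),
     (1, Y 6, X 1, X 5), (\<alpha>, Y 6, X 3, X 4), (1, Y 7, X 1, X 3)]"

definition c_m4_1 :: "'k::field \<Rightarrow> 'k cochain_expr" where
  "c_m4_1 \<alpha> = [
     (\<alpha> * (1 + \<alpha>), X 1, X 3, X 7), (\<alpha>, X 1, X 5, X 6), (\<alpha>, Y 2, X 3, X 5),
     (\<alpha>, Y 3, X 2, X 5), (\<alpha> * (1 + \<alpha>), Y 3, X 7, Y 1), (\<alpha>, Y 5, X 2, X 3),
     (\<alpha>, Y 5, X 6, Y 1), (1, Y 6, X 5, Y 1), (1, Y 7, X 3, Y 1)]"

definition c_m4_2 :: "'k::field \<Rightarrow> 'k cochain_expr" where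
  "c_m4_2 \<alpha> = [
     (\<alpha> * (1 + \<alpha>), X 3, X 1, X 7), (\<alpha>^2, X 3, X 4, X 6), (\<alpha>, Y 1, X 2, X 4),
     (\<alpha> * (1 + \<alpha>), Y 1, X 7, Y 3), (\<alpha>, Y 2, X 1, X 4), (1, Y 4, X 1, X 2),
     (\<alpha>, Y 4, X 6, Y 3), (\<alpha>, Y 6, X 4, Y 3), (1, Y 7, X 1, Y 3)]"

definition c_m2 :: "'k::field \<Rightarrow> 'k cochain_expr" where
  "c_m2 \<alpha> = [
     (\<alpha>, X 1, X 2, X 4), (\<alpha> * (1 + \<alpha>), X 1, X 7, Y 3), (\<alpha>, X 3, X 2, X 5),
     (\<alpha> * (1 + \<alpha>), X 3, X 7, Y 1), (\<alpha>, Y 2, X 4, Y 1), (\<alpha>, Y 2, X 5, Y 3),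
     (1, Y 4, X 2, Y 1), (\<alpha>, Y 5, X 2, Y 3), (1, Y 7, Y 1, Y 3)]"

definition c_0 :: "'k::field \<Rightarrow> 'k cochain_expr" where
  "c_0 \<alpha> = [
     (1, H 1, X 4, Y 4), (1, H 1, X 6, Y 6), (1, H 1, X 7, Y 7),
     (\<alpha>, H 3, X 7, Y 7), (1, H 4, X 2, Y 2), (\<alpha>, H 4, X 4, Y 4),
     (1, H 4, X 5, Y 5), (\<alpha>, H 4, X 6, Y 6), (1, X 1, X 4, Y 2),
     (1, X 1, X 6, Y 5), (\<alpha>, X 2, X 7, Y 6), (1, X 4, X 7, Y 5),
     (\<alpha>, X 5, X 7, Y 4), (1, X 6, X 7, Y 2), (1, Y 1, X 2, Y 4),
     (1, Y 1, X 5, Y 6), (\<alpha>, Y 2, X 6, Y 7), (1, Y 4, X 5, Y 7),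
     (\<alpha>, Y 5, X 4, Y 7), (1, Y 6, X 2, Y 7)]"

definition c_0_derived :: "'k::field \<Rightarrow> 'k cochain_expr" where
  "c_0_derived \<alpha> = [
     (\<alpha> + 1, H 1, X 4, Y 4), (\<alpha> + 1, H 1, X 6, Y 6), (\<alpha> + 1, H 1, X 7, Y 7),
     (1, H 2, X 2, Y 2), (\<alpha>, H 2, X 4, Y 4), (1, H 2, X 5, Y 5),
     (\<alpha>, H 2, X 6, Y 6), (\<alpha>^2 + \<alpha>, H 3, X 7, Y 7), (1, X 1, H 2, X 1),
     (\<alpha> + 1, X 1, X 4, Y 2), (\<alpha> + 1, X 1, X 6, Y 5), (\<alpha>^2 + \<alpha>, X 2, X 7, Y 6),
     (1, X 3, H 2, X 3), (1, X 4, H 2, X 4), (\<alpha> + 1, X 4, X 7, Y 5),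
     (1, X 5, H 2, X 5), (\<alpha>^2 + \<alpha>, X 5, X 7, Y 4), (\<alpha> + 1, X 6, X 7, Y 2),
     (1, Y 1, H 2, Y 1), (\<alpha> + 1, Y 1, X 2, Y 4), (\<alpha> + 1, Y 1, X 5, Y 6),
     (\<alpha>^2 + \<alpha>, Y 2, X 6, Y 7), (1, Y 3, H 2, Y 3), (1, Y 4, H 2, Y 4),
     (\<alpha> + 1, Y 4, X 5, Y 7), (1, Y 5, H 2, Y 5), (\<alpha>^2 + \<alpha>, Y 5, X 4, Y 7),
     (\<alpha> + 1, Y 6, X 2, Y 7)]"

definition c_0_quotient :: "'k::field \<Rightarrow> 'k cochain_expr" where
  "c_0_quotient \<alpha> = [
     (1, H 2, X 2, Y 2), (\<alpha>, H 2, X 4, Y 4), (1, H 2, X 5, Y 5),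
     (\<alpha>, H 2, X 6, Y 6), (\<alpha>^2 + \<alpha>, H 3, X 4, Y 4), (\<alpha>^2 + \<alpha>, H 3, X 6, Y 6),
     (1, X 1, H 2, X 1), (\<alpha> + 1, X 1, X 4, Y 2), (\<alpha> + 1, X 1, X 6, Y 5),
     (\<alpha>^2 + \<alpha>, X 2, X 7, Y 6), (1, X 3, H 2, X 3), (1, X 4, H 2, X 4),
     (\<alpha> + 1, X 4, X 7, Y 5), (1, X 5, H 2, X 5), (\<alpha>^2 + \<alpha>, X 5, X 7, Y 4),
     (\<alpha> + 1, X 6, X 7, Y 2), (1, Y 1, H 2, Y 1), (\<alpha> + 1, Y 1, X 2, Y 4),
     (\<alpha> + 1, Y 1, X 5, Y 6), (\<alpha>^2 + \<alpha>, Y 2, X 6, Y 7), (1, Y 3, H 2, Y 3),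
     (1, Y 4, H 2, Y 4), (\<alpha> + 1, Y 4, X 5, Y 7), (1, Y 5, H 2, Y 5),
     (\<alpha>^2 + \<alpha>, Y 5, X 4, Y 7), (\<alpha> + 1, Y 6, X 2, Y 7)]"

definition negative_cocycles :: "'k::field \<Rightarrow> ('k cochain_expr \<times> int) set" where
  "negative_cocycles \<alpha> = {(c_m6 \<alpha>, - 6), (c_m4_1 \<alpha>, - 4), (c_m4_2 \<alpha>, - 4), (c_m2 \<alpha>, - 2)}"

definition all_cocycles ::
    "('k::field, 'v) lie \<Rightarrow> label set \<Rightarrow> (label \<Rightarrow> 'v) \<Rightarrow> ('v \<Rightarrow> 'v) \<Rightarrow> 'k \<Rightarrow> 'k cochain_expr \<Rightarrow>
     (('v \<times> 'v \<Rightarrow> 'v) \<times> int) set" where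
  "all_cocycles L I b \<omega> \<alpha> c0 =
     {(cochain L I b ts, d) | ts d. (ts, d) \<in> negative_cocycles \<alpha>} \<union>
     {(aut_action L \<omega> (cochain L I b ts), - d) | ts d. (ts, d) \<in> negative_cocycles \<alpha>} \<union>
     {(cochain L I b c0, 0)}"

end

theory Submission
  imports Defs
begin

type_synonym poly2 = "bool list"

fun padd :: "poly2 \<Rightarrow> poly2 \<Rightarrow> poly2" where
  "padd [] q = q"
| "padd p [] = p"
| "padd (a # p) (b # q) = (a \<noteq> b) # padd p q"

fun pmul :: "poly2 \<Rightarrow> poly2 \<Rightarrow> poly2" where
  "pmul [] q = []"
| "pmul (a # p) q = (if a then padd q (False # pmul p q) else False # pmul p q)"

definition pnull :: "poly2 \<Rightarrow> bool" where
  "pnull p \<longleftrightarrow> list_all Not p"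

abbreviation "c1 \<equiv> [True]"
abbreviation "c\<alpha> \<equiv> [False, True]"
abbreviation "c\<alpha>\<alpha> \<equiv> [False, False, True]"
abbreviation "c\<beta> \<equiv> [True, True]"
abbreviation "c\<alpha>\<beta> \<equiv> [False, True, True]"

definition punit :: "poly2 \<Rightarrow> bool" where
  "punit p \<longleftrightarrow> list_ex (\<lambda>q. pnull (padd p q)) [c1, c\<alpha>, c\<beta>, c\<alpha>\<beta>, pmul c\<alpha>\<beta> c\<beta>]"

datatype root = R1 | R2 | R3 | R4 | R5 | R6 | R7
datatype torus = T1 | T2 | T3 | T4
datatype idx = Pos root | Neg root | Tor torus

type_synonym comb = "(poly2 \<times> idx) list"
type_synonym table = "idx \<Rightarrow> idx \<Rightarrow> comb"
type_synonym weight = "bool \<times> bool \<times> bool"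

fun root_add :: "root \<Rightarrow> root \<Rightarrow> root option" where
  "root_add R1 R2 = Some R4" | "root_add R2 R1 = Some R4"
| "root_add R2 R3 = Some R5" | "root_add R3 R2 = Some R5"
| "root_add R3 R4 = Some R6" | "root_add R4 R3 = Some R6"
| "root_add R1 R5 = Some R6" | "root_add R5 R1 = Some R6"
| "root_add R4 R5 = Some R7" | "root_add R5 R4 = Some R7"
| "root_add R2 R6 = Some R7" | "root_add R6 R2 = Some R7"
| "root_add _ _ = None"

fun coroot :: "root \<Rightarrow> comb" where
  "coroot R1 = [(c1, Tor T1)]"
| "coroot R2 = [(c1, Tor T2)]"
| "coroot R3 = [(c1, Tor T3)]"
| "coroot R4 = [(c\<alpha>, Tor T1), (c\<alpha>, Tor T2)]"
| "coroot R5 = [(c1, Tor T2), (c1, Tor T3)]"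
| "coroot R6 = [(c\<alpha>, Tor T1), (c\<alpha>, Tor T2), (c\<alpha>, Tor T3)]"
| "coroot R7 = [(c\<alpha>\<beta>, Tor T1), (c\<alpha>\<beta>, Tor T3)]"

fun root_sub :: "root \<Rightarrow> root \<Rightarrow> (poly2 \<times> root) option" where
  "root_sub R4 R1 = Some (c\<alpha>, R2)" | "root_sub R4 R2 = Some (c\<alpha>, R1)"
| "root_sub R5 R2 = Some (c1, R3)" | "root_sub R5 R3 = Some (c1, R2)"
| "root_sub R6 R1 = Some (c\<alpha>, R5)" | "root_sub R6 R3 = Some (c1, R4)"
| "root_sub R6 R4 = Some (c\<alpha>, R3)" | "root_sub R6 R5 = Some (c\<alpha>, R1)"
| "root_sub R7 R2 = Some (c\<beta>, R6)" | "root_sub R7 R4 = Some (c\<alpha>\<beta>, R5)"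
| "root_sub R7 R5 = Some (c\<beta>, R4)" | "root_sub R7 R6 = Some (c\<alpha>\<beta>, R2)"
| "root_sub _ _ = None"

definition pos_neg :: "root \<Rightarrow> root \<Rightarrow> comb" where
  "pos_neg r s = (if r = s then coroot r else
     case root_sub r s of Some (c, t) \<Rightarrow> [(c, Pos t)]
     | None \<Rightarrow> (case root_sub s r of Some (c, t) \<Rightarrow> [(c, Neg t)] | None \<Rightarrow> []))"

fun root_weight :: "root \<Rightarrow> weight" where
  "root_weight R1 = (True, False, False)"
| "root_weight R2 = (False, True, False)"
| "root_weight R3 = (False, False, True)"
| "root_weight R4 = (True, True, False)"
| "root_weight R5 = (False, True, True)"
| "root_weight R6 = (True, True, True)"
| "root_weight R7 = (True, False, True)"

fun wt :: "idx \<Rightarrow> weight" where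
  "wt (Pos r) = root_weight r"
| "wt (Neg r) = root_weight r"
| "wt (Tor t) = (False, False, False)"

fun wadd :: "weight \<Rightarrow> weight \<Rightarrow> weight" where
  "wadd (a, b, c) (a', b', c') = (a \<noteq> a', b \<noteq> b', c \<noteq> c')"

fun tor_value :: "torus \<Rightarrow> weight \<Rightarrow> poly2" where
  "tor_value T1 (a, b, c) = [False, b]"
| "tor_value T2 (a, b, c) = [c, a]"
| "tor_value T3 (a, b, c) = [b]"
| "tor_value T4 (a, b, c) = [a]"

fun br_wk :: table where
  "br_wk (Pos r) (Pos s) = (case root_add r s of None \<Rightarrow> [] | Some t \<Rightarrow> [(c1, Pos t)])"
| "br_wk (Neg r) (Neg s) = (case root_add r s of None \<Rightarrow> [] | Some t \<Rightarrow> [(c1, Neg t)])"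
| "br_wk (Pos r) (Neg s) = pos_neg r s"
| "br_wk (Neg r) (Pos s) = pos_neg s r"
| "br_wk (Tor t) (Pos s) = [(tor_value t (root_weight s), Pos s)]"
| "br_wk (Pos s) (Tor t) = [(tor_value t (root_weight s), Pos s)]"
| "br_wk (Tor t) (Neg s) = [(tor_value t (root_weight s), Neg s)]"
| "br_wk (Neg s) (Tor t) = [(tor_value t (root_weight s), Neg s)]"
| "br_wk (Tor s) (Tor t) = []"

definition br_quot :: table where
  "br_quot i j = map (\<lambda>(a, k). if k = Tor T1 then (pmul c\<alpha> a, Tor T3) else (a, k)) (br_wk i j)"

definition idx_wk :: "idx list" where
  "idx_wk = [Neg R3, Pos R2, Tor T3, Neg R2, Pos R3, Pos R1, Neg R4, Neg R1, Pos R4,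
     Tor T4, Pos R5, Neg R6, Tor T2, Neg R5, Pos R6, Neg R7, Tor T1, Pos R7]"

definition idx_derived :: "idx list" where
  "idx_derived = filter (\<lambda>i. i \<noteq> Tor T4) idx_wk"

definition idx_quot :: "idx list" where
  "idx_quot = filter (\<lambda>i. i \<noteq> Tor T1) idx_derived"

fun pick :: "bool \<Rightarrow> 'a \<Rightarrow> 'a \<Rightarrow> 'a" where
  "pick True a b = a" | "pick False a b = b"

fun coef :: "comb \<Rightarrow> idx \<Rightarrow> poly2" where
  "coef [] u = []"
| "coef ((a, l) # vs) u = padd (pick (l = u) a []) (coef vs u)"

definition comb_null :: "comb \<Rightarrow> bool" where
  "comb_null vs \<longleftrightarrow> list_all (\<lambda>(a, u). pnull (coef vs u)) vs"

fun ad_comb :: "table \<Rightarrow> idx \<Rightarrow> comb \<Rightarrow> comb" where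
  "ad_comb br i [] = []"
| "ad_comb br i ((a, l) # vs) = map (\<lambda>(c, u). (pmul a c, u)) (br i l) @ ad_comb br i vs"

fun all_pairs :: "('a \<Rightarrow> 'a \<Rightarrow> bool) \<Rightarrow> 'a list \<Rightarrow> bool" where
  "all_pairs Q [] \<longleftrightarrow> True"
| "all_pairs Q (x # xs) \<longleftrightarrow> list_all (Q x) xs \<and> all_pairs Q xs"

fun all_triples :: "('a \<Rightarrow> 'a \<Rightarrow> 'a \<Rightarrow> bool) \<Rightarrow> 'a list \<Rightarrow> bool" where
  "all_triples Q [] \<longleftrightarrow> True"
| "all_triples Q (x # xs) \<longleftrightarrow> all_pairs (Q x) xs \<and> all_triples Q xs"

definition jacobi_table :: "table \<Rightarrow> idx list \<Rightarrow> bool" where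
  "jacobi_table br = all_triples (\<lambda>i j k.
     comb_null (ad_comb br i (br j k) @ ad_comb br j (br i k) @ ad_comb br k (br i j)))"

fun root_height :: "root \<Rightarrow> int" where
  "root_height R1 = 1" | "root_height R2 = 1" | "root_height R3 = 1" | "root_height R4 = 2"
| "root_height R5 = 2" | "root_height R6 = 3" | "root_height R7 = 4"

fun of_weight :: "idx list \<Rightarrow> weight \<Rightarrow> idx list" where
  "of_weight I (True, False, False) = [Pos R1, Neg R1]"
| "of_weight I (False, True, False) = [Pos R2, Neg R2]"
| "of_weight I (False, False, True) = [Pos R3, Neg R3]"
| "of_weight I (True, True, False) = [Pos R4, Neg R4]"
| "of_weight I (False, True, True) = [Pos R5, Neg R5]"
| "of_weight I (True, True, True) = [Pos R6, Neg R6]"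
| "of_weight I (True, False, True) = [Pos R7, Neg R7]"
| "of_weight I (False, False, False) = filter (\<lambda>i. wt i = (False, False, False)) I"

definition weights :: "weight list" where
  "weights = List.product [False, True] (List.product [False, True] [False, True])"

fun idx_deg :: "idx \<Rightarrow> int" where
  "idx_deg (Pos r) = root_height r" | "idx_deg (Neg r) = - root_height r" | "idx_deg (Tor t) = 0"

definition table_ok :: "table \<Rightarrow> idx list \<Rightarrow> bool" where
  "table_ok br I \<longleftrightarrow> distinct I \<and> set [Tor T2, Tor T3] \<subseteq> set I \<and>
     list_all (\<lambda>w. distinct (of_weight I w) \<and> list_all (\<lambda>i. i \<in> set I \<and> wt i = w) (of_weight I w)) weights \<and>
     list_all (\<lambda>i. i \<in> set (of_weight I (wt i)) \<and> comb_null (br i i) \<and>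
       list_all (\<lambda>t. comb_null ((tor_value t (wt i), i) # br (Tor t) i)) [T2, T3] \<and>
       list_all (\<lambda>j. comb_null (br i j @ br j i) \<and> list_all (\<lambda>(a, k).
         pnull a \<or> wt k = wadd (wt i) (wt j) \<and> idx_deg k = idx_deg i + idx_deg j) (br i j)) I) I"

type_synonym expr = "(poly2 \<times> idx \<times> idx \<times> idx) list"

fun expr_val :: "expr \<Rightarrow> idx \<Rightarrow> idx \<Rightarrow> comb" where
  "expr_val [] j k = []"
| "expr_val ((a, u, v, w) # ts) j k =
     pick ((v = j \<and> w = k) \<noteq> (v = k \<and> w = j)) [(a, u)] [] @ expr_val ts j k"

fun expr_comb :: "expr \<Rightarrow> comb \<Rightarrow> idx \<Rightarrow> comb" where
  "expr_comb ts [] k = []"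
| "expr_comb ts ((a, l) # vs) k = map (\<lambda>(c, u). (pmul a c, u)) (expr_val ts l k) @ expr_comb ts vs k"

definition cocycle_table :: "table \<Rightarrow> idx list \<Rightarrow> expr \<Rightarrow> bool" where
  "cocycle_table br I ts \<longleftrightarrow> all_triples (\<lambda>i j k. comb_null (
     ad_comb br i (expr_val ts j k) @ ad_comb br j (expr_val ts i k) @ ad_comb br k (expr_val ts i j) @
     expr_comb ts (br i j) k @ expr_comb ts (br i k) j @ expr_comb ts (br j k) i)) I"

fun swap_idx :: "idx \<Rightarrow> idx" where
  "swap_idx (Pos r) = Neg r" | "swap_idx (Neg r) = Pos r" | "swap_idx (Tor t) = Tor t"

definition expr_ok :: "idx list \<Rightarrow> int \<Rightarrow> expr \<Rightarrow> bool" where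
  "expr_ok I d = list_all (\<lambda>(a, u, v, w). u \<in> set I \<and> v \<in> set I \<and> w \<in> set I \<and>
     wt u = wadd (wt v) (wt w) \<and> idx_deg u = idx_deg v + idx_deg w + d)"

definition swap_expr :: "expr \<Rightarrow> expr" where
  "swap_expr = map (\<lambda>(a, u, v, w). (a, swap_idx u, swap_idx v, swap_idx w))"

definition em6 :: expr where
  "em6 = [(c\<alpha>\<beta>, Neg R1, Pos R3, Pos R7), (c\<alpha>, Neg R1, Pos R5, Pos R6), (c\<alpha>\<beta>, Neg R3, Pos R1, Pos R7),
     (c\<alpha>\<alpha>, Neg R3, Pos R4, Pos R6), (c\<alpha>, Neg R4, Pos R3, Pos R6), (c\<alpha>, Neg R5, Pos R1, Pos R6),
     (c1, Neg R6, Pos R1, Pos R5), (c\<alpha>, Neg R6, Pos R3, Pos R4), (c1, Neg R7, Pos R1, Pos R3)]"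

definition em4_1 :: expr where
  "em4_1 = [(c\<alpha>\<beta>, Pos R1, Pos R3, Pos R7), (c\<alpha>, Pos R1, Pos R5, Pos R6), (c\<alpha>, Neg R2, Pos R3, Pos R5),
     (c\<alpha>, Neg R3, Pos R2, Pos R5), (c\<alpha>\<beta>, Neg R3, Pos R7, Neg R1), (c\<alpha>, Neg R5, Pos R2, Pos R3),
     (c\<alpha>, Neg R5, Pos R6, Neg R1), (c1, Neg R6, Pos R5, Neg R1), (c1, Neg R7, Pos R3, Neg R1)]"

definition em4_2 :: expr where
  "em4_2 = [(c\<alpha>\<beta>, Pos R3, Pos R1, Pos R7), (c\<alpha>\<alpha>, Pos R3, Pos R4, Pos R6), (c\<alpha>, Neg R1, Pos R2, Pos R4),
     (c\<alpha>\<beta>, Neg R1, Pos R7, Neg R3), (c\<alpha>, Neg R2, Pos R1, Pos R4), (c1, Neg R4, Pos R1, Pos R2),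
     (c\<alpha>, Neg R4, Pos R6, Neg R3), (c\<alpha>, Neg R6, Pos R4, Neg R3), (c1, Neg R7, Pos R1, Neg R3)]"

definition em2 :: expr where
  "em2 = [(c\<alpha>, Pos R1, Pos R2, Pos R4), (c\<alpha>\<beta>, Pos R1, Pos R7, Neg R3), (c\<alpha>, Pos R3, Pos R2, Pos R5),
     (c\<alpha>\<beta>, Pos R3, Pos R7, Neg R1), (c\<alpha>, Neg R2, Pos R4, Neg R1), (c\<alpha>, Neg R2, Pos R5, Neg R3),
     (c1, Neg R4, Pos R2, Neg R1), (c\<alpha>, Neg R5, Pos R2, Neg R3), (c1, Neg R7, Neg R1, Neg R3)]"

definition e0 :: expr where
  "e0 = [(c1, Tor T1, Pos R4, Neg R4), (c1, Tor T1, Pos R6, Neg R6), (c1, Tor T1, Pos R7, Neg R7),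
     (c\<alpha>, Tor T3, Pos R7, Neg R7), (c1, Tor T4, Pos R2, Neg R2), (c\<alpha>, Tor T4, Pos R4, Neg R4),
     (c1, Tor T4, Pos R5, Neg R5), (c\<alpha>, Tor T4, Pos R6, Neg R6), (c1, Pos R1, Pos R4, Neg R2),
     (c1, Pos R1, Pos R6, Neg R5), (c\<alpha>, Pos R2, Pos R7, Neg R6), (c1, Pos R4, Pos R7, Neg R5),
     (c\<alpha>, Pos R5, Pos R7, Neg R4), (c1, Pos R6, Pos R7, Neg R2), (c1, Neg R1, Pos R2, Neg R4),
     (c1, Neg R1, Pos R5, Neg R6), (c\<alpha>, Neg R2, Pos R6, Neg R7), (c1, Neg R4, Pos R5, Neg R7),
     (c\<alpha>, Neg R5, Pos R4, Neg R7), (c1, Neg R6, Pos R2, Neg R7)]"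

definition e0_derived :: expr where
  "e0_derived = [(c\<beta>, Tor T1, Pos R4, Neg R4), (c\<beta>, Tor T1, Pos R6, Neg R6), (c\<beta>, Tor T1, Pos R7, Neg R7),
     (c1, Tor T2, Pos R2, Neg R2), (c\<alpha>, Tor T2, Pos R4, Neg R4), (c1, Tor T2, Pos R5, Neg R5),
     (c\<alpha>, Tor T2, Pos R6, Neg R6), (c\<alpha>\<beta>, Tor T3, Pos R7, Neg R7), (c1, Pos R1, Tor T2, Pos R1),
     (c\<beta>, Pos R1, Pos R4, Neg R2), (c\<beta>, Pos R1, Pos R6, Neg R5), (c\<alpha>\<beta>, Pos R2, Pos R7, Neg R6),
     (c1, Pos R3, Tor T2, Pos R3), (c1, Pos R4, Tor T2, Pos R4), (c\<beta>, Pos R4, Pos R7, Neg R5),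
     (c1, Pos R5, Tor T2, Pos R5), (c\<alpha>\<beta>, Pos R5, Pos R7, Neg R4), (c\<beta>, Pos R6, Pos R7, Neg R2),
     (c1, Neg R1, Tor T2, Neg R1), (c\<beta>, Neg R1, Pos R2, Neg R4), (c\<beta>, Neg R1, Pos R5, Neg R6),
     (c\<alpha>\<beta>, Neg R2, Pos R6, Neg R7), (c1, Neg R3, Tor T2, Neg R3), (c1, Neg R4, Tor T2, Neg R4),
     (c\<beta>, Neg R4, Pos R5, Neg R7), (c1, Neg R5, Tor T2, Neg R5), (c\<alpha>\<beta>, Neg R5, Pos R4, Neg R7),
     (c\<beta>, Neg R6, Pos R2, Neg R7)]"

definition e0_quotient :: expr where
  "e0_quotient = [(c1, Tor T2, Pos R2, Neg R2), (c\<alpha>, Tor T2, Pos R4, Neg R4), (c1, Tor T2, Pos R5, Neg R5),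
     (c\<alpha>, Tor T2, Pos R6, Neg R6), (c\<alpha>\<beta>, Tor T3, Pos R4, Neg R4), (c\<alpha>\<beta>, Tor T3, Pos R6, Neg R6),
     (c1, Pos R1, Tor T2, Pos R1), (c\<beta>, Pos R1, Pos R4, Neg R2), (c\<beta>, Pos R1, Pos R6, Neg R5),
     (c\<alpha>\<beta>, Pos R2, Pos R7, Neg R6), (c1, Pos R3, Tor T2, Pos R3), (c1, Pos R4, Tor T2, Pos R4),
     (c\<beta>, Pos R4, Pos R7, Neg R5), (c1, Pos R5, Tor T2, Pos R5), (c\<alpha>\<beta>, Pos R5, Pos R7, Neg R4),
     (c\<beta>, Pos R6, Pos R7, Neg R2), (c1, Neg R1, Tor T2, Neg R1), (c\<beta>, Neg R1, Pos R2, Neg R4),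
     (c\<beta>, Neg R1, Pos R5, Neg R6), (c\<alpha>\<beta>, Neg R2, Pos R6, Neg R7), (c1, Neg R3, Tor T2, Neg R3),
     (c1, Neg R4, Tor T2, Neg R4), (c\<beta>, Neg R4, Pos R5, Neg R7), (c1, Neg R5, Tor T2, Neg R5),
     (c\<alpha>\<beta>, Neg R5, Pos R4, Neg R7), (c\<beta>, Neg R6, Pos R2, Neg R7)]"


definition neg_exprs :: "expr list" where
  "neg_exprs = [em6, em4_1, em4_2, em2]"

definition exprs :: "expr \<Rightarrow> expr list" where
  "exprs z = neg_exprs @ map swap_expr neg_exprs @ [z]"

type_synonym key = "idx \<times> idx \<times> idx"
datatype gener = Elem idx idx | Coc expr

fun swap_key :: "key \<Rightarrow> key" where
  "swap_key (o', v, w) = (swap_idx o', swap_idx v, swap_idx w)"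
fun swap_gener :: "gener \<Rightarrow> gener" where
  "swap_gener (Elem u v) = Elem (swap_idx u) (swap_idx v)"
| "swap_gener (Coc ts) = Coc (swap_expr ts)"
fun swap_pivot :: "key \<times> gener \<Rightarrow> key \<times> gener" where
  "swap_pivot (p, g) = (swap_key p, swap_gener g)"

definition neg_pivots :: "(key \<times> gener) list" where
  "neg_pivots = [((Neg R7, Pos R1, Pos R3), Coc em6), ((Neg R7, Pos R3, Neg R1), Coc em4_1),
     ((Neg R7, Pos R1, Neg R3), Coc em4_2), ((Neg R7, Neg R1, Neg R3), Coc em2),
     ((Neg R6, Pos R3, Pos R4), Elem (Neg R6) (Pos R6)), ((Neg R5, Pos R2, Pos R3), Elem (Neg R5) (Pos R5)),
     ((Neg R4, Pos R1, Pos R2), Elem (Neg R4) (Pos R4)), ((Neg R7, Pos R4, Pos R5), Elem (Neg R7) (Pos R7)),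
     ((Pos R2, Pos R1, Pos R4), Elem (Neg R1) (Pos R1)), ((Pos R1, Pos R2, Pos R4), Elem (Neg R2) (Pos R2)),
     ((Pos R2, Pos R3, Pos R5), Elem (Neg R3) (Pos R3))]"

definition root_pivots :: "(key \<times> gener) list" where
  "root_pivots = [((Pos R4, Pos R1, Pos R2), Elem (Pos R4) (Pos R4)), ((Pos R5, Pos R2, Pos R3), Elem (Pos R5) (Pos R5)),
     ((Pos R6, Pos R3, Pos R4), Elem (Pos R6) (Pos R6)), ((Pos R7, Pos R4, Pos R5), Elem (Pos R7) (Pos R7)),
     ((Neg R4, Neg R1, Neg R2), Elem (Neg R4) (Neg R4)), ((Neg R5, Neg R2, Neg R3), Elem (Neg R5) (Neg R5)),
     ((Neg R6, Neg R3, Neg R4), Elem (Neg R6) (Neg R6)), ((Neg R7, Neg R4, Neg R5), Elem (Neg R7) (Neg R7))]"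

definition wk_pivots :: "(key \<times> gener) list" where
  "wk_pivots = neg_pivots @ map swap_pivot neg_pivots @ [((Tor T2, Pos R1, Neg R1), Elem (Tor T2) (Tor T1)), ((Tor T3, Pos R1, Neg R1), Elem (Tor T3) (Tor T1)),
     ((Tor T4, Pos R1, Neg R1), Elem (Tor T4) (Tor T1)), ((Tor T1, Pos R2, Neg R2), Elem (Tor T1) (Tor T2)),
     ((Tor T3, Pos R2, Neg R2), Elem (Tor T3) (Tor T2)), ((Tor T1, Pos R3, Neg R3), Elem (Tor T1) (Tor T3)),
     ((Tor T2, Pos R3, Neg R3), Elem (Tor T2) (Tor T3)), ((Tor T4, Pos R3, Neg R3), Elem (Tor T4) (Tor T3)),
     ((Pos R2, Tor T1, Pos R2), Elem (Tor T1) (Tor T1)), ((Pos R3, Tor T2, Pos R3), Elem (Tor T2) (Tor T2)),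
     ((Pos R1, Tor T2, Pos R1), Elem (Tor T4) (Tor T2)), ((Pos R2, Tor T3, Pos R2), Elem (Tor T3) (Tor T3)),
     ((Pos R3, Tor T4, Pos R3), Elem (Tor T2) (Tor T4)), ((Pos R1, Tor T4, Pos R1), Elem (Tor T4) (Tor T4)),
     ((Pos R2, Tor T4, Pos R2), Elem (Tor T3) (Tor T4)), ((Tor T1, Pos R1, Neg R1), Elem (Neg R1) (Neg R1)),
     ((Tor T2, Pos R2, Neg R2), Elem (Neg R2) (Neg R2)), ((Tor T3, Pos R3, Neg R3), Elem (Neg R3) (Neg R3)),
     ((Tor T4, Pos R2, Neg R2), Coc e0)] @ root_pivots"

definition derived_pivots :: "(key \<times> gener) list" where
  "derived_pivots = neg_pivots @ map swap_pivot neg_pivots @ [((Tor T2, Pos R1, Neg R1), Elem (Tor T2) (Tor T1)), ((Tor T3, Pos R1, Neg R1), Elem (Tor T3) (Tor T1)),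
     ((Tor T1, Pos R2, Neg R2), Elem (Tor T1) (Tor T2)), ((Tor T3, Pos R2, Neg R2), Elem (Tor T3) (Tor T2)),
     ((Tor T1, Pos R3, Neg R3), Elem (Tor T1) (Tor T3)), ((Tor T2, Pos R3, Neg R3), Elem (Tor T2) (Tor T3)),
     ((Pos R2, Tor T1, Pos R2), Elem (Tor T1) (Tor T1)), ((Pos R7, Tor T2, Pos R7), Elem (Tor T2) (Tor T2)),
     ((Pos R2, Tor T3, Pos R2), Elem (Tor T3) (Tor T3)), ((Pos R1, Tor T2, Pos R1), Coc e0_derived),
     ((Tor T1, Pos R1, Neg R1), Elem (Neg R1) (Neg R1)), ((Tor T2, Pos R2, Neg R2), Elem (Neg R2) (Neg R2)),
     ((Tor T3, Pos R3, Neg R3), Elem (Neg R3) (Neg R3))] @ root_pivots"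

definition quotient_pivots :: "(key \<times> gener) list" where
  "quotient_pivots = neg_pivots @ map swap_pivot neg_pivots @ [((Tor T3, Pos R2, Neg R2), Elem (Tor T3) (Tor T2)), ((Tor T2, Pos R3, Neg R3), Elem (Tor T2) (Tor T3)),
     ((Pos R7, Tor T2, Pos R7), Elem (Tor T2) (Tor T2)), ((Pos R2, Tor T3, Pos R2), Elem (Tor T3) (Tor T3)),
     ((Pos R1, Tor T2, Pos R1), Coc e0_quotient), ((Tor T2, Pos R2, Neg R2), Elem (Neg R2) (Neg R2)),
     ((Tor T3, Pos R3, Neg R3), Elem (Neg R3) (Neg R3)), ((Tor T3, Pos R1, Neg R1), Elem (Neg R1) (Neg R1))] @ root_pivots"


fun gener_val :: "table \<Rightarrow> gener \<Rightarrow> key \<Rightarrow> poly2" where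
  "gener_val br (Elem u q) (o', v, w) =
     padd (if w = q then coef (br v u) o' else [])
       (padd (if v = q then coef (br w u) o' else []) (if o' = u then coef (br v w) q else []))"
| "gener_val br (Coc ts) (o', v, w) = coef (expr_val ts v w) o'"

fun key_in :: "idx list \<Rightarrow> key \<Rightarrow> bool" where
  "key_in I (u, v, w) \<longleftrightarrow> u \<in> set I \<and> v \<in> set I \<and> w \<in> set I"

fun gener_ok :: "idx list \<Rightarrow> expr list \<Rightarrow> gener \<Rightarrow> bool" where
  "gener_ok I cs (Elem u q) \<longleftrightarrow> u \<in> set I \<and> q \<in> set I \<and> wt u = wt q"
| "gener_ok I cs (Coc ts) \<longleftrightarrow> ts \<in> set cs"

fun pivots_ok :: "table \<Rightarrow> idx list \<Rightarrow> expr list \<Rightarrow> key list \<Rightarrow> (key \<times> gener) list \<Rightarrow> bool" where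
  "pivots_ok br I cs ps [] \<longleftrightarrow> True"
| "pivots_ok br I cs ps ((p, g) # r) \<longleftrightarrow> key_in I p \<and> gener_ok I cs g \<and> punit (gener_val br g p) \<and>
     list_all (\<lambda>q. pnull (gener_val br g q)) ps \<and> pivots_ok br I cs (p # ps) r"

type_synonym keyset = "(idx \<times> (idx \<times> idx) list) list"

fun outputs :: "keyset \<Rightarrow> idx \<Rightarrow> (idx \<times> idx) list" where
  "outputs [] u = []"
| "outputs ((u', ps) # Z) u = pick (u' = u) ps (outputs Z u)"

fun insert_key :: "key \<Rightarrow> keyset \<Rightarrow> keyset" where
  "insert_key x [] = []"
| "insert_key (u, v, w) ((u', ps) # Z) = (u', pick (u' = u) ((v, w) # ps) ps) # insert_key (u, v, w) Z"

fun pair_mem :: "idx \<Rightarrow> idx \<Rightarrow> (idx \<times> idx) list \<Rightarrow> bool" where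
  "pair_mem v w [] = False"
| "pair_mem v w ((v', w') # ps) \<longleftrightarrow> v' = v \<and> w' = w \<or> v' = w \<and> w' = v \<or> pair_mem v w ps"

fun known :: "keyset \<Rightarrow> key \<Rightarrow> bool" where
  "known Z (u, v, w) \<longleftrightarrow> v = w \<or> pair_mem v w (outputs Z u)"

definition same_key :: "key \<Rightarrow> key \<Rightarrow> bool" where
  "same_key = (\<lambda>(u, v, w) (u', v', w'). u = u' \<and> (v = v' \<and> w = w' \<or> v = w' \<and> w = v'))"

definition cocycle_eqn :: "table \<Rightarrow> idx list \<Rightarrow> idx \<Rightarrow> idx \<Rightarrow> idx \<Rightarrow> idx \<Rightarrow> (poly2 \<times> key) list" where
  "cocycle_eqn br I i j k u =
     map (\<lambda>l. (coef (br i l) u, (l, j, k))) (of_weight I (wadd (wt j) (wt k))) @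
     map (\<lambda>l. (coef (br j l) u, (l, i, k))) (of_weight I (wadd (wt i) (wt k))) @
     map (\<lambda>l. (coef (br k l) u, (l, i, j))) (of_weight I (wadd (wt i) (wt j))) @
     map (\<lambda>(c, l). (c, (u, l, k))) (br i j) @
     map (\<lambda>(c, l). (c, (u, l, j))) (br i k) @
     map (\<lambda>(c, l). (c, (u, l, i))) (br j k)"

fun add_term :: "poly2 \<Rightarrow> key \<Rightarrow> (poly2 \<times> key) list \<Rightarrow> (poly2 \<times> key) list" where
  "add_term a x [] = [(a, x)]"
| "add_term a x ((b, y) # r) = (if same_key x y then (padd a b, y) # r else (b, y) # add_term a x r)"

fun unknown_terms :: "keyset \<Rightarrow> (poly2 \<times> key) list \<Rightarrow> (bool \<times> poly2 \<times> key) list" where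
  "unknown_terms Z [] = []"
| "unknown_terms Z ((a, x) # es) = (\<not> pnull a \<and> \<not> known Z x, a, x) # unknown_terms Z es"

definition solvable :: "(bool \<times> poly2 \<times> key) list \<Rightarrow> key list" where
  "solvable es = (case filter (\<lambda>(a, x). \<not> pnull a) (fold (\<lambda>(b, a, x). add_term a x) (filter fst es) []) of
      [(a, x)] \<Rightarrow> if punit a then [x] else [] | _ \<Rightarrow> [])"

fun insert_keys :: "key list \<Rightarrow> keyset \<Rightarrow> keyset" where
  "insert_keys [] Z = Z"
| "insert_keys (x # xs) Z = insert_keys xs (insert_key x Z)"

definition solve_eqn :: "(poly2 \<times> key) list \<Rightarrow> keyset \<Rightarrow> keyset" where
  "solve_eqn es Z = insert_keys (solvable (unknown_terms Z es)) Z"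

fun solve_eqns :: "table \<Rightarrow> idx list \<Rightarrow> idx \<Rightarrow> idx \<Rightarrow> idx \<Rightarrow> idx list \<Rightarrow> keyset \<Rightarrow> keyset" where
  "solve_eqns br I i j k [] Z = Z"
| "solve_eqns br I i j k (u # us) Z = solve_eqns br I i j k us (solve_eqn (cocycle_eqn br I i j k u) Z)"

fun solve_third :: "table \<Rightarrow> idx list \<Rightarrow> idx \<Rightarrow> idx \<Rightarrow> idx list \<Rightarrow> keyset \<Rightarrow> keyset" where
  "solve_third br I i j [] Z = Z"
| "solve_third br I i j (k # ks) Z = solve_third br I i j ks
     (solve_eqns br I i j k (of_weight I (wadd (wt i) (wadd (wt j) (wt k)))) Z)"

fun solve_second :: "table \<Rightarrow> idx list \<Rightarrow> idx \<Rightarrow> idx list \<Rightarrow> keyset \<Rightarrow> keyset" where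
  "solve_second br I i [] Z = Z"
| "solve_second br I i (j # js) Z = solve_second br I i js (solve_third br I i j js Z)"

fun solve_all :: "table \<Rightarrow> idx list \<Rightarrow> idx list \<Rightarrow> keyset \<Rightarrow> keyset" where
  "solve_all br I [] Z = Z"
| "solve_all br I (i # is) Z = solve_all br I is (solve_second br I i is Z)"

definition all_known :: "idx list \<Rightarrow> keyset \<Rightarrow> bool" where
  "all_known I Z \<longleftrightarrow> all_pairs (\<lambda>v w. list_all (\<lambda>u. known Z (u, v, w)) (of_weight I (wadd (wt v) (wt w)))) I"

definition rigid :: "table \<Rightarrow> idx list \<Rightarrow> expr list \<Rightarrow> (key \<times> gener) list \<Rightarrow> bool" where
  "rigid br I cs pv \<longleftrightarrow> pivots_ok br I cs [] pv \<and>
     all_known I (solve_all br I I (insert_keys (map fst pv) (map (\<lambda>u. (u, [])) I)))"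

section \<open>Vector spaces and algebras on a carrier, and their quotients\<close>

locale vspace =
  fixes V :: "('k::field, 'v, 'm) vect_scheme"
  assumes zero_in [simp]: "vzero V \<in> vcarrier V"
    and add_in [simp]: "\<lbrakk>u \<in> vcarrier V; v \<in> vcarrier V\<rbrakk> \<Longrightarrow> vadd V u v \<in> vcarrier V"
    and scale_in [simp]: "u \<in> vcarrier V \<Longrightarrow> vscale V a u \<in> vcarrier V"
    and add_assoc: "\<lbrakk>u \<in> vcarrier V; v \<in> vcarrier V; w \<in> vcarrier V\<rbrakk> \<Longrightarrow>
      vadd V (vadd V u v) w = vadd V u (vadd V v w)"
    and add_commute: "\<lbrakk>u \<in> vcarrier V; v \<in> vcarrier V\<rbrakk> \<Longrightarrow> vadd V u v = vadd V v u"
    and add_zero [simp]: "v \<in> vcarrier V \<Longrightarrow> vadd V v (vzero V) = v"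
    and scale_add: "\<lbrakk>u \<in> vcarrier V; v \<in> vcarrier V\<rbrakk> \<Longrightarrow>
      vscale V a (vadd V u v) = vadd V (vscale V a u) (vscale V a v)"
    and add_scale: "u \<in> vcarrier V \<Longrightarrow> vscale V (a + b) u = vadd V (vscale V a u) (vscale V b u)"
    and scale_scale: "u \<in> vcarrier V \<Longrightarrow> vscale V a (vscale V b u) = vscale V (a * b) u"
    and scale_one [simp]: "u \<in> vcarrier V \<Longrightarrow> vscale V 1 u = u"
    and scale_zero [simp]: "u \<in> vcarrier V \<Longrightarrow> vscale V 0 u = vzero V"
begin

abbreviation "vsub u v \<equiv> vadd V u (vscale V (- 1) v)"

lemma zero_add [simp]: "v \<in> vcarrier V \<Longrightarrow> vadd V (vzero V) v = v"
  using add_commute[of v "vzero V"] by simp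

lemma scale_vzero [simp]: "vscale V a (vzero V) = vzero V"
  using scale_scale[of "vzero V" a 0] by simp

lemma add_neg [simp]: "v \<in> vcarrier V \<Longrightarrow> vsub v v = vzero V"
  using add_scale[of v 1 "- 1"] by simp

lemma add_left_commute:
  "\<lbrakk>u \<in> vcarrier V; v \<in> vcarrier V; w \<in> vcarrier V\<rbrakk> \<Longrightarrow> vadd V u (vadd V v w) = vadd V v (vadd V u w)"
  by (metis add_assoc add_commute)

lemma add_sub_cancel:
  assumes "u \<in> vcarrier V" "v \<in> vcarrier V" shows "vadd V v (vsub u v) = u"
proof -
  have "vadd V v (vsub u v) = vadd V u (vsub v v)"
    using assms by (intro add_left_commute) auto
  then show ?thesis using assms by simp
qed

lemma sub_add_cancel:
  assumes "u \<in> vcarrier V" "v \<in> vcarrier V" shows "vsub (vadd V v u) v = u"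
proof -
  have "vsub (vadd V v u) v = vsub (vadd V u v) v" using assms by (simp add: add_commute)
  also have "\<dots> = vadd V u (vsub v v)" using assms by (intro add_assoc) auto
  finally show ?thesis using assms by simp
qed

lemma sub_self_add:
  assumes "u \<in> vcarrier V" "v \<in> vcarrier V" "w \<in> vcarrier V" "x \<in> vcarrier V"
  shows "vadd V (vsub u v) (vsub w x) = vsub (vadd V u w) (vadd V v x)"
proof -
  have "vadd V (vsub u v) (vsub w x) = vadd V u (vadd V (vscale V (- 1) v) (vsub w x))"
    using assms by (intro add_assoc) auto
  also have "vadd V (vscale V (- 1) v) (vsub w x) = vadd V w (vadd V (vscale V (- 1) v) (vscale V (- 1) x))"
    using assms by (intro add_left_commute) auto
  also have "vadd V u \<dots> = vadd V (vadd V u w) (vadd V (vscale V (- 1) v) (vscale V (- 1) x))"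
    using assms by (intro add_assoc[symmetric]) auto
  finally show ?thesis using assms by (simp add: scale_add)
qed

lemma carrier_subspace: "vsubspace V (vcarrier V)"
  by (auto simp: vsubspace_def)

lemma vspan_subspace: "S \<subseteq> vcarrier V \<Longrightarrow> vsubspace V (vspan V S)"
  using carrier_subspace unfolding vspan_def vsubspace_def by blast

lemma vspan_carrier: "S \<subseteq> vcarrier V \<Longrightarrow> vspan V S \<subseteq> vcarrier V"
  using vspan_subspace by (auto simp: vsubspace_def)

end

lemma vspan_superset: "S \<subseteq> vspan V S"
  by (auto simp: vspan_def)

lemma vspan_least: "vsubspace V U \<Longrightarrow> S \<subseteq> U \<Longrightarrow> vspan V S \<subseteq> U"
  by (auto simp: vspan_def)

lemma vsubspaceD:
  assumes "vsubspace V U"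
  shows "U \<subseteq> vcarrier V" "vzero V \<in> U" "\<And>u v. u \<in> U \<Longrightarrow> v \<in> U \<Longrightarrow> vadd V u v \<in> U"
    "\<And>a u. u \<in> U \<Longrightarrow> vscale V a u \<in> U"
  using assms by (auto simp: vsubspace_def)

lemma vspan_mono: "S \<subseteq> T \<Longrightarrow> vspan V S \<subseteq> vspan V T"
  by (auto simp: vspan_def)

context vspace
begin

lemma mem_vcoset_iff:
  assumes U: "vsubspace V U" and v: "v \<in> vcarrier V"
  shows "w \<in> vcoset V U v \<longleftrightarrow> w \<in> vcarrier V \<and> vsub w v \<in> U"
proof
  assume "w \<in> vcoset V U v"
  then obtain u where "u \<in> U" "w = vadd V v u" by (auto simp: vcoset_def)
  then show "w \<in> vcarrier V \<and> vsub w v \<in> U"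
    using vsubspaceD(1)[OF U] v by (auto simp: sub_add_cancel subset_iff)
next
  assume "w \<in> vcarrier V \<and> vsub w v \<in> U"
  then show "w \<in> vcoset V U v"
    unfolding vcoset_def using add_sub_cancel[of w v] v by (metis imageI)
qed

lemma vcoset_self: "vsubspace V U \<Longrightarrow> v \<in> vcarrier V \<Longrightarrow> v \<in> vcoset V U v"
  by (auto simp: mem_vcoset_iff vsubspaceD)

lemma vcoset_eq:
  assumes U: "vsubspace V U" and v: "v \<in> vcarrier V" and w: "w \<in> vcoset V U v"
  shows "vcoset V U w = vcoset V U v"
proof -
  have wc: "w \<in> vcarrier V" and d: "vsub w v \<in> U"
    using mem_vcoset_iff[OF U v] w by auto
  have d': "vsub v w \<in> U"
  proof -
    have "vscale V (- 1) (vsub w v) = vadd V (vscale V (- 1) w) v"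
      using v wc by (simp add: scale_add scale_scale)
    then show ?thesis
      using vsubspaceD(4)[OF U d, of "- 1"] v wc by (simp add: add_commute)
  qed
  have tr: "vsub x b \<in> U" if "x \<in> vcarrier V" "a \<in> vcarrier V" "b \<in> vcarrier V" "vsub x a \<in> U" "vsub a b \<in> U"
    for x a b
  proof -
    have "vadd V (vsub x a) (vsub a b) = vsub (vadd V x a) (vadd V a b)"
      using that by (intro sub_self_add) auto
    also have "\<dots> = vsub (vadd V a x) (vadd V a b)" using that by (simp add: add_commute)
    also have "\<dots> = vadd V (vsub a a) (vsub x b)" using that by (intro sub_self_add[symmetric]) auto
    also have "\<dots> = vsub x b" using that by simp
    finally show ?thesis using vsubspaceD(3)[OF U that(4,5)] by simp
  qed
  show ?thesis
    unfolding set_eq_iff mem_vcoset_iff[OF U wc] mem_vcoset_iff[OF U v]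
    using tr[OF _ wc v _ d] tr[OF _ v wc _ d'] by blast
qed

lemma vcoset_eq_iff:
  assumes "vsubspace V U" "v \<in> vcarrier V" "w \<in> vcarrier V"
  shows "vcoset V U w = vcoset V U v \<longleftrightarrow> vsub w v \<in> U"
  using assms vcoset_eq[OF assms(1,2), of w] vcoset_self[OF assms(1,3)]
  by (auto simp: mem_vcoset_iff)

lemma vcoset_zero: "vsubspace V U \<Longrightarrow> vcoset V U (vzero V) = U"
  using mem_vcoset_iff[of U "vzero V"] vsubspaceD(1)[of V U] by auto

lemma vcoset_eq_zero_iff:
  assumes "vsubspace V U" "v \<in> vcarrier V"
  shows "vcoset V U v = U \<longleftrightarrow> v \<in> U"
  using vcoset_eq_iff[of U "vzero V" v] vcoset_zero[of U] assms by simp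

lemma vquot_add:
  assumes U: "vsubspace V U" and v: "v \<in> vcarrier V" and w: "w \<in> vcarrier V"
  shows "vadd (vquot V U) (vcoset V U v) (vcoset V U w) = vcoset V U (vadd V v w)"
proof -
  have "vcoset V U (vadd V x y) = vcoset V U (vadd V v w)"
    if "x \<in> vcoset V U v" "y \<in> vcoset V U w" for x y
  proof -
    have *: "x \<in> vcarrier V" "y \<in> vcarrier V" "vsub x v \<in> U" "vsub y w \<in> U"
      using that by (auto simp: mem_vcoset_iff[OF U v] mem_vcoset_iff[OF U w])
    show ?thesis using * v w vsubspaceD(3)[OF U *(3,4)] by (simp add: vcoset_eq_iff[OF U] sub_self_add)
  qed
  then have "(\<Union>x\<in>vcoset V U v. \<Union>y\<in>vcoset V U w. vcoset V U (vadd V x y)) = vcoset V U (vadd V v w)"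
    using vcoset_self[OF U v] vcoset_self[OF U w] by (intro UN_constant_eq) blast+
  then show ?thesis by (simp add: vquot_def)
qed

lemma vquot_scale:
  assumes U: "vsubspace V U" and v: "v \<in> vcarrier V"
  shows "vscale (vquot V U) a (vcoset V U v) = vcoset V U (vscale V a v)"
proof -
  have "vcoset V U (vscale V a x) = vcoset V U (vscale V a v)" if "x \<in> vcoset V U v" for x
  proof -
    have *: "x \<in> vcarrier V" "vsub x v \<in> U"
      using that by (auto simp: mem_vcoset_iff[OF U v])
    have "vscale V a (vsub x v) = vsub (vscale V a x) (vscale V a v)"
      using * v by (simp add: scale_add scale_scale mult.commute)
    then show ?thesis using * v vsubspaceD(4)[OF U *(2), of a] by (simp add: vcoset_eq_iff[OF U])
  qed
  then have "(\<Union>x\<in>vcoset V U v. vcoset V U (vscale V a x)) = vcoset V U (vscale V a v)"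
    using vcoset_self[OF U v] by (intro UN_constant_eq) blast+
  then show ?thesis by (simp add: vquot_def)
qed

lemma vquot_carrier: "vcarrier (vquot V U) = vcoset V U ` vcarrier V"
  and vquot_zero: "vzero (vquot V U) = U"
  by (simp_all add: vquot_def)

lemma vspace_vquot:
  assumes U: "vsubspace V U" shows "vspace (vquot V U)"
proof -
  note q = vquot_add[OF U] vquot_scale[OF U] vquot_carrier
  have z: "vzero (vquot V U) = vcoset V U (vzero V)" using vcoset_zero[OF U] by (simp add: vquot_zero)
  show ?thesis
    by unfold_locales
      (auto simp: q z add_assoc scale_add add_scale scale_scale add_commute add_left_commute)
qed

end

lemma lie_quot_simps [simp]:
  "vcarrier (lie_quot L I) = vcarrier (vquot L I)" "vzero (lie_quot L I) = vzero (vquot L I)"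
  "vadd (lie_quot L I) = vadd (vquot L I)" "vscale (lie_quot L I) = vscale (vquot L I)"
  by (simp_all add: lie_quot_def vect.extend_def lie.fields_def)

locale algebra = vspace L for L :: "('k::field, 'v) lie" +
  assumes bracket_in [simp]: "\<lbrakk>u \<in> vcarrier L; v \<in> vcarrier L\<rbrakk> \<Longrightarrow> bracket L u v \<in> vcarrier L"
    and bracket_add_left: "\<lbrakk>u \<in> vcarrier L; v \<in> vcarrier L; w \<in> vcarrier L\<rbrakk> \<Longrightarrow>
      bracket L (vadd L u v) w = vadd L (bracket L u w) (bracket L v w)"
    and bracket_add_right: "\<lbrakk>u \<in> vcarrier L; v \<in> vcarrier L; w \<in> vcarrier L\<rbrakk> \<Longrightarrow>
      bracket L w (vadd L u v) = vadd L (bracket L w u) (bracket L w v)"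
    and bracket_scale_left: "\<lbrakk>u \<in> vcarrier L; v \<in> vcarrier L\<rbrakk> \<Longrightarrow>
      bracket L (vscale L a u) v = vscale L a (bracket L u v)"
    and bracket_scale_right: "\<lbrakk>u \<in> vcarrier L; v \<in> vcarrier L\<rbrakk> \<Longrightarrow>
      bracket L u (vscale L a v) = vscale L a (bracket L u v)"
begin

lemma bracket_zero_left [simp]: "v \<in> vcarrier L \<Longrightarrow> bracket L (vzero L) v = vzero L"
  using bracket_scale_left[of "vzero L" v 0] by simp

lemma bracket_zero_right [simp]: "v \<in> vcarrier L \<Longrightarrow> bracket L v (vzero L) = vzero L"
  using bracket_scale_right[of v "vzero L" 0] by simp

lemma lie_quot_bracket:
  assumes I: "lie_ideal L I" and x: "x \<in> vcarrier L" and y: "y \<in> vcarrier L"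
  shows "bracket (lie_quot L I) (vcoset L I x) (vcoset L I y) = vcoset L I (bracket L x y)"
proof -
  have U: "vsubspace L I" using I by (simp add: lie_ideal_def)
  have IL: "bracket L u v \<in> I" "bracket L v u \<in> I" if "u \<in> vcarrier L" "v \<in> I" for u v
    using I that by (auto simp: lie_ideal_def)
  have "vcoset L I (bracket L x' y') = vcoset L I (bracket L x y)"
    if "x' \<in> vcoset L I x" "y' \<in> vcoset L I y" for x' y'
  proof -
    have *: "x' \<in> vcarrier L" "y' \<in> vcarrier L" "vsub x' x \<in> I" "vsub y' y \<in> I"
      using that by (auto simp: mem_vcoset_iff[OF U x] mem_vcoset_iff[OF U y])
    have "vsub (bracket L x' y') (bracket L x y') \<in> I"
      using IL(2)[OF *(2,3)] * x by (simp add: bracket_add_left bracket_scale_left)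
    then have "vcoset L I (bracket L x' y') = vcoset L I (bracket L x y')"
      using * x by (simp add: vcoset_eq_iff[OF U])
    moreover have "vsub (bracket L x y') (bracket L x y) \<in> I"
      using IL(1)[OF x *(4)] * x y by (simp add: bracket_add_right bracket_scale_right)
    then have "vcoset L I (bracket L x y') = vcoset L I (bracket L x y)"
      using * x y by (simp add: vcoset_eq_iff[OF U])
    ultimately show ?thesis by simp
  qed
  then have "(\<Union>a\<in>vcoset L I x. \<Union>b\<in>vcoset L I y. vcoset L I (bracket L a b)) = vcoset L I (bracket L x y)"
    using vcoset_self[OF U x] vcoset_self[OF U y] by (intro UN_constant_eq) blast+
  then show ?thesis by (simp add: lie_quot_def vect.extend_def lie.fields_def)
qed

lemma algebra_lie_quot:
  assumes I: "lie_ideal L I" shows "algebra (lie_quot L I)"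
proof -
  have U: "vsubspace L I" using I by (simp add: lie_ideal_def)
  have "vspace (lie_quot L I)"
    using vspace_vquot[OF U] unfolding vspace_def lie_quot_simps .
  moreover have "algebra_axioms (lie_quot L I)"
    by unfold_locales
      (auto simp: vquot_carrier vquot_add[OF U] vquot_scale[OF U] lie_quot_bracket[OF I]
        bracket_add_left bracket_add_right bracket_scale_left bracket_scale_right)
  ultimately show ?thesis by (rule algebra.intro)
qed

end

locale lie_algebra = algebra +
  assumes alternating [simp]: "x \<in> vcarrier L \<Longrightarrow> bracket L x x = vzero L"
    and jacobi: "\<lbrakk>x \<in> vcarrier L; y \<in> vcarrier L; z \<in> vcarrier L\<rbrakk> \<Longrightarrow>
      vadd L (vadd L (bracket L x (bracket L y z)) (bracket L y (bracket L z x))) (bracket L z (bracket L x y)) = vzero L"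
begin

lemma bracket_skew:
  assumes "x \<in> vcarrier L" "y \<in> vcarrier L"
  shows "bracket L y x = vscale L (- 1) (bracket L x y)"
proof -
  have "vzero L = bracket L (vadd L x y) (vadd L x y)" using assms by simp
  also have "\<dots> = vadd L (bracket L y x) (bracket L x y)"
    using assms by (simp add: bracket_add_left bracket_add_right del: alternating) simp
  finally have e: "vadd L (bracket L y x) (bracket L x y) = vzero L" by simp
  have "bracket L y x = vsub (vadd L (bracket L x y) (bracket L y x)) (bracket L x y)"
    using assms by (simp add: sub_add_cancel)
  also have "\<dots> = vscale L (- 1) (bracket L x y)"
    using e assms by (simp add: add_commute)
  finally show ?thesis .
qed

end

section \<open>Lie algebras presented by generators and relations\<close>

lemma free_alg_simps [simp]:
  "vcarrier free_alg = UNIV" "vzero free_alg = 0" "vadd free_alg = (+)"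
  by (simp_all add: free_alg_def)

lemma lookup_free_scale [simp]:
  "Poly_Mapping.lookup (vscale free_alg a p) w = a * Poly_Mapping.lookup p w"
  by (simp add: free_alg_def Poly_Mapping.map.rep_eq when_def)

lemma free_bracket: "bracket free_alg p q = (\<Sum>u\<in>Poly_Mapping.keys p. \<Sum>v\<in>Poly_Mapping.keys q.
       Poly_Mapping.single (Br u v) (Poly_Mapping.lookup p u * Poly_Mapping.lookup q v))"
  by (simp add: free_alg_def)

lemma lookup_free_bracket:
  "Poly_Mapping.lookup (bracket free_alg p q) w =
     (case w of Gen g \<Rightarrow> 0 | Br u v \<Rightarrow> Poly_Mapping.lookup p u * Poly_Mapping.lookup q v)"
proof -
  have "Poly_Mapping.lookup (bracket free_alg p q) w =
    (\<Sum>u\<in>Poly_Mapping.keys p. \<Sum>v\<in>Poly_Mapping.keys q.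
       Poly_Mapping.lookup p u * Poly_Mapping.lookup q v when Br u v = w)"
    by (simp add: free_bracket lookup_sum lookup_single)
  also have "\<dots> = (case w of Gen g \<Rightarrow> 0 | Br u v \<Rightarrow> Poly_Mapping.lookup p u * Poly_Mapping.lookup q v)"
  proof (cases w)
    case (Br a b)
    have "(\<Sum>u\<in>Poly_Mapping.keys p. \<Sum>v\<in>Poly_Mapping.keys q.
       Poly_Mapping.lookup p u * Poly_Mapping.lookup q v when Br u v = Br a b) =
      (\<Sum>u\<in>Poly_Mapping.keys p. if u = a then (\<Sum>v\<in>Poly_Mapping.keys q.
         if v = b then Poly_Mapping.lookup p u * Poly_Mapping.lookup q v else 0) else 0)"
      by (intro sum.cong refl) (auto simp: when_def intro!: sum.cong)
    also have "\<dots> = Poly_Mapping.lookup p a * Poly_Mapping.lookup q b"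
      by (auto simp: sum.delta in_keys_iff)
    finally show ?thesis using Br by simp
  qed simp
  finally show ?thesis .
qed

lemma algebra_free_alg: "algebra (free_alg :: ('k::field, 'a word \<Rightarrow>\<^sub>0 'k) lie)"
  by unfold_locales
    (auto intro!: poly_mapping_eqI simp: lookup_add lookup_free_bracket algebra_simps split: word.splits)

interpretation free: algebra "free_alg :: ('k::field, 'a word \<Rightarrow>\<^sub>0 'k) lie"
  by (rule algebra_free_alg)

lemma lie_ideal_Inter:
  assumes "\<And>I. I \<in> F \<Longrightarrow> lie_ideal L I" "F \<noteq> {}"
  shows "lie_ideal L (\<Inter>F)"
  using assms unfolding lie_ideal_def vsubspace_def by blast

lemma lie_ideal_carrier: "algebra L \<Longrightarrow> lie_ideal L (vcarrier L)"
  using algebra.axioms(1)[of L] by (auto simp: lie_ideal_def algebra.bracket_in vspace.carrier_subspace)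

lemma ideal_gen_ideal:
  assumes "algebra L" "S \<subseteq> vcarrier L" shows "lie_ideal L (ideal_gen L S)"
  unfolding ideal_gen_def using assms lie_ideal_carrier by (intro lie_ideal_Inter) auto

lemma ideal_gen_superset: "S \<subseteq> ideal_gen L S"
  by (auto simp: ideal_gen_def)

lemma ideal_gen_least: "lie_ideal L I \<Longrightarrow> S \<subseteq> I \<Longrightarrow> ideal_gen L S \<subseteq> I"
  by (auto simp: ideal_gen_def)

lemma presentation_ideal_ideal: "lie_ideal free_alg (presentation_ideal R)"
  unfolding presentation_ideal_def by (rule ideal_gen_ideal[OF algebra_free_alg]) simp

lemma presentation_quotient_lie_algebra:
  "lie_algebra (lie_quot free_alg (presentation_ideal R) :: ('k::field, ('a word \<Rightarrow>\<^sub>0 'k) set) lie)"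
proof -
  let ?J = "presentation_ideal R"
  note I = presentation_ideal_ideal[of R]
  have U: "vsubspace free_alg ?J" using I by (simp add: lie_ideal_def)
  interpret Q: algebra "lie_quot free_alg ?J" by (rule free.algebra_lie_quot[OF I])
  have laws: "lie_laws \<subseteq> ?J"
    unfolding presentation_ideal_def using ideal_gen_superset[of "lie_laws \<union> R" free_alg] by simp
  note q = free.vquot_carrier free.vquot_zero free.vquot_add[OF U] free.vquot_scale[OF U]
    free.lie_quot_bracket[OF I]
  show ?thesis
  proof unfold_locales
    fix x assume "x \<in> vcarrier (lie_quot free_alg ?J)"
    then obtain p where p: "x = vcoset free_alg ?J p"
      unfolding lie_quot_simps free.vquot_carrier by blast
    have "bracket free_alg p p \<in> lie_laws" by (simp add: lie_laws_def Let_def)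
    then have "bracket free_alg p p \<in> ?J" using laws by blast
    then show "bracket (lie_quot free_alg ?J) x x = vzero (lie_quot free_alg ?J)"
      using p by (simp add: q free.vcoset_eq_zero_iff[OF U])
  next
    fix x y z assume "x \<in> vcarrier (lie_quot free_alg ?J)" "y \<in> vcarrier (lie_quot free_alg ?J)"
      "z \<in> vcarrier (lie_quot free_alg ?J)"
    then obtain p r s where p: "x = vcoset free_alg ?J p" "y = vcoset free_alg ?J r" "z = vcoset free_alg ?J s"
      unfolding lie_quot_simps free.vquot_carrier by blast
    have "bracket free_alg p (bracket free_alg r s) + bracket free_alg r (bracket free_alg s p)
        + bracket free_alg s (bracket free_alg p r) \<in> lie_laws"
      unfolding lie_laws_def Let_def by blast
    then have "bracket free_alg p (bracket free_alg r s) + bracket free_alg r (bracket free_alg s p)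
        + bracket free_alg s (bracket free_alg p r) \<in> ?J"
      using laws by blast
    then show "vadd (lie_quot free_alg ?J)
          (vadd (lie_quot free_alg ?J)
            (bracket (lie_quot free_alg ?J) x (bracket (lie_quot free_alg ?J) y z))
            (bracket (lie_quot free_alg ?J) y (bracket (lie_quot free_alg ?J) z x)))
          (bracket (lie_quot free_alg ?J) z (bracket (lie_quot free_alg ?J) x y)) = vzero (lie_quot free_alg ?J)"
      using p by (simp add: q free.vcoset_eq_zero_iff[OF U])
  qed
qed

section \<open>Algebras given by structure constants\<close>

definition sc_bracket :: "('i::finite \<Rightarrow> 'i \<Rightarrow> 'i \<Rightarrow> 'k::field) \<Rightarrow> ('i \<Rightarrow> 'k) \<Rightarrow> ('i \<Rightarrow> 'k) \<Rightarrow> 'i \<Rightarrow> 'k" where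
  "sc_bracket S f g k = (\<Sum>i\<in>UNIV. \<Sum>j\<in>UNIV. f i * g j * S i j k)"

lemma sc_bracket_add_left: "sc_bracket S (\<lambda>u. f u + f' u) g k = sc_bracket S f g k + sc_bracket S f' g k"
  by (simp add: sc_bracket_def algebra_simps sum.distrib)

lemma sc_bracket_add_right: "sc_bracket S f (\<lambda>u. g u + g' u) k = sc_bracket S f g k + sc_bracket S f g' k"
  by (simp add: sc_bracket_def algebra_simps sum.distrib)

lemma sc_bracket_scale_left: "sc_bracket S (\<lambda>u. a * f u) g k = a * sc_bracket S f g k"
  by (simp add: sc_bracket_def sum_distrib_left mult_ac)

lemma sc_bracket_scale_right: "sc_bracket S f (\<lambda>u. a * g u) k = a * sc_bracket S f g k"
  by (simp add: sc_bracket_def sum_distrib_left mult_ac)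

lemma sc_bracket_zero [simp]: "sc_bracket S (\<lambda>u. 0) g = (\<lambda>k. 0)" "sc_bracket S f (\<lambda>u. 0) = (\<lambda>k. 0)"
  by (simp_all add: sc_bracket_def fun_eq_iff)

lemma sc_bracket_sum_left:
  "finite A \<Longrightarrow> sc_bracket S (\<lambda>u. \<Sum>x\<in>A. c x * F x u) g k = (\<Sum>x\<in>A. c x * sc_bracket S (F x) g k)"
  by (induction A rule: finite_induct) (simp_all add: sc_bracket_add_left sc_bracket_scale_left)

lemma sc_bracket_sum_right:
  "finite A \<Longrightarrow> sc_bracket S f (\<lambda>u. \<Sum>x\<in>A. c x * G x u) k = (\<Sum>x\<in>A. c x * sc_bracket S f (G x) k)"
  by (induction A rule: finite_induct) (simp_all add: sc_bracket_add_right sc_bracket_scale_right)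

definition unit_vec :: "'i \<Rightarrow> 'i \<Rightarrow> 'k::field" where
  "unit_vec i = (\<lambda>j. if j = i then 1 else 0)"

lemma unit_vec_expand: "f = (\<lambda>u. \<Sum>i\<in>UNIV. f i * unit_vec (i::'i::finite) u)"
  by (rule ext) (simp add: unit_vec_def if_distrib cong: if_cong)

lemma sc_bracket_unit_left: "sc_bracket S (unit_vec i) g k = (\<Sum>j\<in>UNIV. g j * S i j k)"
proof -
  have "sc_bracket S (unit_vec i) g k = (\<Sum>i'\<in>UNIV. if i' = i then \<Sum>j\<in>UNIV. g j * S i j k else 0)"
    unfolding sc_bracket_def by (intro sum.cong) (auto simp: unit_vec_def)
  then show ?thesis by simp
qed

lemma sc_bracket_unit: "sc_bracket S (unit_vec i) (unit_vec j) k = S i j k"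
proof -
  have "(\<Sum>j'\<in>UNIV. unit_vec j j' * S i j' k) = (\<Sum>j'\<in>UNIV. if j' = j then S i j k else 0)"
    by (intro sum.cong) (auto simp: unit_vec_def)
  then show ?thesis by (simp add: sc_bracket_unit_left)
qed

definition coord_hom :: "('k::field, 'v) lie \<Rightarrow> ('i::finite \<Rightarrow> 'i \<Rightarrow> 'i \<Rightarrow> 'k) \<Rightarrow> ('v \<Rightarrow> 'i \<Rightarrow> 'k) \<Rightarrow> bool" where
  "coord_hom L S \<phi> \<longleftrightarrow>
     (\<forall>u\<in>vcarrier L. \<forall>v\<in>vcarrier L. \<phi> (vadd L u v) = (\<lambda>k. \<phi> u k + \<phi> v k)) \<and>
     (\<forall>a. \<forall>u\<in>vcarrier L. \<phi> (vscale L a u) = (\<lambda>k. a * \<phi> u k)) \<and>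
     (\<forall>u\<in>vcarrier L. \<forall>v\<in>vcarrier L. \<phi> (bracket L u v) = sc_bracket S (\<phi> u) (\<phi> v))"

lemma coord_homD:
  assumes "coord_hom L S \<phi>"
  shows "\<And>u v. u \<in> vcarrier L \<Longrightarrow> v \<in> vcarrier L \<Longrightarrow> \<phi> (vadd L u v) = (\<lambda>k. \<phi> u k + \<phi> v k)"
    and "\<And>a u. u \<in> vcarrier L \<Longrightarrow> \<phi> (vscale L a u) = (\<lambda>k. a * \<phi> u k)"
    and "\<And>u v. u \<in> vcarrier L \<Longrightarrow> v \<in> vcarrier L \<Longrightarrow> \<phi> (bracket L u v) = sc_bracket S (\<phi> u) (\<phi> v)"
  using assms by (auto simp: coord_hom_def)

lemma coord_hom_zero: "vspace L \<Longrightarrow> coord_hom L S \<phi> \<Longrightarrow> \<phi> (vzero L) = (\<lambda>k. 0)"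
  using coord_homD(2)[of L S \<phi> "vzero L" 0] by (simp add: vspace.scale_zero vspace.zero_in)

definition kernel :: "('k::field, 'v) lie \<Rightarrow> ('v \<Rightarrow> 'i \<Rightarrow> 'k) \<Rightarrow> 'v set" where
  "kernel L \<phi> = {v \<in> vcarrier L. \<phi> v = (\<lambda>k. 0)}"

lemma kernel_ideal:
  assumes "algebra L" "coord_hom L S \<phi>" shows "lie_ideal L (kernel L \<phi>)"
proof -
  interpret algebra L by fact
  show ?thesis
    by (auto simp: lie_ideal_def vsubspace_def kernel_def coord_homD[OF assms(2)]
        coord_hom_zero[OF vspace_axioms assms(2)])
qed

definition quot_map :: "('v \<Rightarrow> 'c) \<Rightarrow> 'v set \<Rightarrow> 'c" where
  "quot_map \<phi> A = \<phi> (SOME x. x \<in> A)"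

lemma quot_map_coset:
  assumes "algebra L" "coord_hom L S \<phi>" "vsubspace L I" "I \<subseteq> kernel L \<phi>" "v \<in> vcarrier L"
  shows "quot_map \<phi> (vcoset L I v) = \<phi> v"
proof -
  interpret algebra L by fact
  have "(SOME x. x \<in> vcoset L I v) \<in> vcoset L I v"
    using vcoset_self[OF assms(3,5)] by (rule someI)
  then obtain u where "u \<in> I" "(SOME x. x \<in> vcoset L I v) = vadd L v u"
    by (auto simp: vcoset_def)
  then show ?thesis
    using assms(4,5) coord_homD(1)[OF assms(2)] by (auto simp: quot_map_def kernel_def)
qed

lemma coord_hom_quot:
  assumes "algebra L" "coord_hom L S \<phi>" "lie_ideal L I" "I \<subseteq> kernel L \<phi>"
  shows "coord_hom (lie_quot L I) S (quot_map \<phi>)"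
proof -
  interpret algebra L by fact
  have U: "vsubspace L I" using assms(3) by (simp add: lie_ideal_def)
  note q = quot_map_coset[OF assms(1,2) U assms(4)]
  show ?thesis
    using coord_homD[OF assms(2)]
    by (auto simp: coord_hom_def vquot_carrier vquot_add[OF U] vquot_scale[OF U] lie_quot_bracket[OF assms(3)] q)
qed

lemma quot_map_inj:
  assumes "algebra L" "coord_hom L S \<phi>"
  shows "inj_on (quot_map \<phi>) (vcarrier (lie_quot L (kernel L \<phi>)))"
proof -
  interpret algebra L by fact
  have U: "vsubspace L (kernel L \<phi>)" using kernel_ideal[OF assms] by (simp add: lie_ideal_def)
  note q = quot_map_coset[OF assms U order.refl]
  show ?thesis
  proof (rule inj_onI)
    fix A B assume "A \<in> vcarrier (lie_quot L (kernel L \<phi>))" "B \<in> vcarrier (lie_quot L (kernel L \<phi>))"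
      and eq: "quot_map \<phi> A = quot_map \<phi> B"
    then obtain u v where uv: "u \<in> vcarrier L" "v \<in> vcarrier L"
      "A = vcoset L (kernel L \<phi>) u" "B = vcoset L (kernel L \<phi>) v"
      unfolding lie_quot_simps vquot_carrier by blast
    have "\<phi> u = \<phi> v" using eq uv by (simp add: q)
    then have "vsub u v \<in> kernel L \<phi>"
      using uv coord_homD[OF assms(2)] by (simp add: kernel_def)
    then show "A = B" using uv by (simp add: vcoset_eq_iff[OF U])
  qed
qed

lemma coord_hom_surj:
  fixes L :: "('k::field, 'v) lie" and \<phi> :: "'v \<Rightarrow> 'i::finite \<Rightarrow> 'k"
  assumes "algebra L" "coord_hom L S \<phi>"
    and "\<And>i. unit_vec i \<in> \<phi> ` vcarrier L"
  shows "\<phi> ` vcarrier L = UNIV"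
proof -
  interpret algebra L by fact
  have "(\<lambda>u. \<Sum>i\<in>A. f i * unit_vec i u) \<in> \<phi> ` vcarrier L" if "finite A" for A and f :: "'i \<Rightarrow> 'k"
    using that
  proof (induction A rule: finite_induct)
    case empty
    then show ?case using coord_hom_zero[OF vspace_axioms assms(2)] zero_in by (auto simp: image_iff intro!: bexI[of _ "vzero L"])
  next
    case (insert i A)
    obtain a b where a: "a \<in> vcarrier L" "unit_vec i = \<phi> a"
      and b: "b \<in> vcarrier L" "(\<lambda>u. \<Sum>i\<in>A. f i * unit_vec i u) = \<phi> b"
      using assms(3)[of i] insert.IH by blast
    have "(\<lambda>u. \<Sum>i\<in>insert i A. f i * unit_vec i u) = \<phi> (vadd L (vscale L (f i) a) b)"
      using insert.hyps a b by (simp add: coord_homD[OF assms(2)] fun_eq_iff)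
    then show ?case using a b by auto
  qed
  from this[OF finite[of UNIV]] have "f \<in> \<phi> ` vcarrier L" for f
    using unit_vec_expand[of f] by metis
  then show ?thesis by blast
qed

section \<open>Evaluation of non-associative words\<close>

primrec word_eval :: "('i::finite \<Rightarrow> 'i \<Rightarrow> 'i \<Rightarrow> 'k::field) \<Rightarrow> ('a \<Rightarrow> 'i \<Rightarrow> 'k) \<Rightarrow> 'a word \<Rightarrow> 'i \<Rightarrow> 'k" where
  "word_eval S e (Gen g) = e g"
| "word_eval S e (Br u v) = sc_bracket S (word_eval S e u) (word_eval S e v)"

definition free_eval :: "('i::finite \<Rightarrow> 'i \<Rightarrow> 'i \<Rightarrow> 'k::field) \<Rightarrow> ('a \<Rightarrow> 'i \<Rightarrow> 'k) \<Rightarrow> ('a word \<Rightarrow>\<^sub>0 'k) \<Rightarrow> 'i \<Rightarrow> 'k" where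
  "free_eval S e p k = (\<Sum>w\<in>Poly_Mapping.keys p. Poly_Mapping.lookup p w * word_eval S e w k)"

lemma free_eval_superset:
  "finite A \<Longrightarrow> Poly_Mapping.keys p \<subseteq> A \<Longrightarrow>
     free_eval S e p k = (\<Sum>w\<in>A. Poly_Mapping.lookup p w * word_eval S e w k)"
  unfolding free_eval_def by (intro sum.mono_neutral_left) (auto simp: in_keys_iff)

lemma free_eval_add: "free_eval S e (p + q) k = free_eval S e p k + free_eval S e q k"
proof -
  let ?A = "Poly_Mapping.keys p \<union> Poly_Mapping.keys q"
  have "Poly_Mapping.keys (p + q) \<subseteq> ?A" by (rule Poly_Mapping.keys_add)
  then show ?thesis
    by (simp add: free_eval_superset[of ?A] lookup_add algebra_simps sum.distrib)
qed

lemma free_eval_scale: "free_eval S e (vscale free_alg a p) k = a * free_eval S e p k"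
proof -
  have "Poly_Mapping.keys (vscale free_alg a p) \<subseteq> Poly_Mapping.keys p"
    by (auto simp: in_keys_iff)
  then show ?thesis
    by (simp add: free_eval_superset[of "Poly_Mapping.keys p"] sum_distrib_left mult.assoc)
qed

lemma free_eval_single: "free_eval S e (Poly_Mapping.single w c) k = c * word_eval S e w k"
  using free_eval_superset[of "{w}" "Poly_Mapping.single w c" S e k] by (simp add: lookup_single split: if_splits)

lemma free_eval_zero [simp]: "free_eval S e 0 k = 0"
  by (simp add: free_eval_def)

lemma free_eval_sum: "finite A \<Longrightarrow> free_eval S e (sum F A) k = (\<Sum>x\<in>A. free_eval S e (F x) k)"
  by (induction A rule: finite_induct) (simp_all add: free_eval_add)

lemma free_eval_bracket:
  "free_eval S e (bracket free_alg p q) k = sc_bracket S (free_eval S e p) (free_eval S e q) k"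
proof -
  have "sc_bracket S (free_eval S e p) (free_eval S e q) k =
    (\<Sum>u\<in>Poly_Mapping.keys p. Poly_Mapping.lookup p u * (\<Sum>v\<in>Poly_Mapping.keys q. Poly_Mapping.lookup q v *
      sc_bracket S (word_eval S e u) (word_eval S e v) k))"
    by (simp add: free_eval_def[abs_def] sc_bracket_sum_left sc_bracket_sum_right)
  then show ?thesis
    by (simp add: free_bracket free_eval_sum free_eval_single sum_distrib_left mult.assoc)
qed

lemma free_eval_hom: "coord_hom free_alg S (free_eval S e)"
  by (auto simp: coord_hom_def fun_eq_iff free_eval_add free_eval_scale free_eval_bracket)

lemma free_eval_gen [simp]: "free_eval S e (gen_poly g) = e g"
  by (rule ext) (simp add: gen_poly_def free_eval_single)

text \<open>A presented algebra maps to every Lie algebra with elements that satisfy the relations.\<close>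

lemma presentation_ideal_kernel:
  assumes alt: "\<And>f. sc_bracket S f f = (\<lambda>k. 0)"
    and jac: "\<And>f g h k. sc_bracket S f (sc_bracket S g h) k + sc_bracket S g (sc_bracket S h f) k
      + sc_bracket S h (sc_bracket S f g) k = 0"
    and rel: "\<And>r. r \<in> R \<Longrightarrow> free_eval S e r = (\<lambda>k. 0)"
  shows "presentation_ideal R \<subseteq> kernel free_alg (free_eval S e)"
  unfolding presentation_ideal_def
proof (rule ideal_gen_least)
  show "lie_ideal free_alg (kernel free_alg (free_eval S e))"
    by (rule kernel_ideal[OF algebra_free_alg free_eval_hom])
  have b: "free_eval S e (bracket free_alg p q) = sc_bracket S (free_eval S e p) (free_eval S e q)" for p q
    by (rule ext) (rule free_eval_bracket)
  show "lie_laws \<union> R \<subseteq> kernel free_alg (free_eval S e)"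
    using rel by (auto simp: lie_laws_def Let_def kernel_def fun_eq_iff free_eval_add b alt jac)
qed

section \<open>The degree-zero part of a contragredient Lie algebra\<close>

locale chevalley = lie_algebra L for L :: "('k::field, 'v) lie" +
  fixes x y :: "'n \<Rightarrow> 'v" and T :: "'v set"
  assumes x_in [simp]: "x i \<in> vcarrier L" and y_in [simp]: "y i \<in> vcarrier L"
    and T_in: "T \<subseteq> vcarrier L"
    and xy: "bracket L (x i) (y j) = vzero L \<or> bracket L (x i) (y j) \<in> T"
    and Tx: "t \<in> T \<Longrightarrow> \<exists>a. bracket L t (x j) = vscale L a (x j)"
    and Ty: "t \<in> T \<Longrightarrow> \<exists>a. bracket L t (y j) = vscale L a (y j)"
    and TT: "t \<in> T \<Longrightarrow> t' \<in> T \<Longrightarrow> bracket L t t' = vzero L"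
begin

abbreviation gens :: "('v \<times> int) set" where
  "gens \<equiv> (\<lambda>i. (x i, 1)) ` UNIV \<union> (\<lambda>i. (y i, - 1)) ` UNIV \<union> (\<lambda>t. (t, 0)) ` T"

inductive tri :: "int \<Rightarrow> 'v \<Rightarrow> bool" where
  tri_x: "tri 1 (x i)"
| tri_y: "tri (- 1) (y i)"
| tri_T: "t \<in> T \<Longrightarrow> tri 0 t"
| tri_zero: "tri d (vzero L)"
| tri_add: "tri d u \<Longrightarrow> tri d v \<Longrightarrow> tri d (vadd L u v)"
| tri_scale: "tri d u \<Longrightarrow> tri d (vscale L a u)"
| tri_ad_x: "d \<ge> 1 \<Longrightarrow> tri d u \<Longrightarrow> tri (d + 1) (bracket L (x i) u)"
| tri_ad_y: "d \<le> - 1 \<Longrightarrow> tri d u \<Longrightarrow> tri (d - 1) (bracket L (y i) u)"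

lemma tri_in: "tri d u \<Longrightarrow> u \<in> vcarrier L"
  by (induction rule: tri.induct) (use T_in in auto)

lemma tri_subspace: "vsubspace L {u. tri d u}"
  using tri_in by (auto simp: vsubspace_def tri_zero tri_add tri_scale)

lemma tri_swap:
  assumes "u \<in> vcarrier L" "v \<in> vcarrier L" "tri d (bracket L v u)"
  shows "tri d (bracket L u v)"
  using bracket_skew[OF assms(2,1)] tri_scale[OF assms(3)] by simp

text \<open>The Jacobi identity moves a bracket into \<open>tri d\<close> when the other two terms lie there.\<close>

lemma tri_jacobi:
  assumes c: "u \<in> vcarrier L" "v \<in> vcarrier L" "w \<in> vcarrier L"
    and 1: "tri d (bracket L (bracket L u v) w)" and 2: "tri d (bracket L v (bracket L u w))"
  shows "tri d (bracket L u (bracket L v w))"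
proof -
  let ?a = "bracket L u (bracket L v w)" and ?b = "bracket L v (bracket L w u)"
    and ?c = "bracket L w (bracket L u v)"
  have "vadd L ?a (vadd L ?b ?c) = vzero L" using jacobi[OF c] c by (simp add: add_assoc)
  then have "vsub (vadd L ?a (vadd L ?b ?c)) (vadd L ?b ?c) = vscale L (- 1) (vadd L ?b ?c)"
    using c by simp
  moreover have "vsub (vadd L ?a (vadd L ?b ?c)) (vadd L ?b ?c) = ?a"
    using c sub_add_cancel[of ?a "vadd L ?b ?c"] by (simp add: add_commute)
  ultimately have "?a = vscale L (- 1) (vadd L ?b ?c)" by simp
  moreover have "tri d ?b"
    using tri_scale[OF 2, of "- 1"] bracket_skew[of u w] c by (simp add: bracket_scale_right)
  moreover have "tri d ?c" using tri_swap[OF _ _ 1] c by simp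
  ultimately show ?thesis by (simp add: tri_add tri_scale)
qed

lemma tri_jacobi':
  assumes c: "u \<in> vcarrier L" "v \<in> vcarrier L" "w \<in> vcarrier L"
    and 1: "tri d (bracket L u (bracket L v w))" and 2: "tri d (bracket L v (bracket L u w))"
  shows "tri d (bracket L (bracket L u v) w)"
proof -
  have "tri d (bracket L w (bracket L v u))"
  proof (rule tri_jacobi)
    have "tri d (bracket L (bracket L v w) u)" using tri_swap[of "bracket L v w" u] 1 c by simp
    from tri_scale[OF this, of "- 1"] show "tri d (bracket L (bracket L w v) u)"
      using bracket_skew[of v w] c by (simp add: bracket_scale_left)
    show "tri d (bracket L v (bracket L w u))"
      using tri_scale[OF 2, of "- 1"] bracket_skew[of u w] c by (simp add: bracket_scale_right)
  qed (use c in auto)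
  then have "tri d (bracket L (bracket L v u) w)" using tri_swap[of "bracket L v u" w] c by simp
  from tri_scale[OF this, of "- 1"] show ?thesis
    using bracket_skew[of v u] c by (simp add: bracket_scale_left)
qed

lemma tri_zero_span: "tri d u \<Longrightarrow> d = 0 \<Longrightarrow> u \<in> vspan L T"
proof (induction rule: tri.induct)
  case (tri_T t)
  then show ?case using vspan_superset[of T L] by blast
qed (use vspan_subspace[OF T_in] in \<open>auto simp: vsubspace_def\<close>)

lemma tri_T_bracket: "t \<in> T \<Longrightarrow> tri d u \<Longrightarrow> tri d (bracket L t u)"
proof -
  assume t: "t \<in> T"
  then have tc [simp]: "t \<in> vcarrier L" using T_in by blast
  assume "tri d u"
  then show ?thesis
  proof (induction rule: tri.induct)
    case (tri_x i) then show ?case using Tx[OF t, of i] tri.tri_scale[OF tri.tri_x] by auto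
  next
    case (tri_y i) then show ?case using Ty[OF t, of i] tri.tri_scale[OF tri.tri_y] by auto
  next
    case (tri_T t') then show ?case using TT[OF t, of t'] by (simp add: tri.tri_zero)
  next
    case (tri_zero d) then show ?case by (simp add: tri.tri_zero)
  next
    case (tri_add d u v) then show ?case by (simp add: bracket_add_right tri_in tri.tri_add)
  next
    case (tri_scale d u a) then show ?case by (simp add: bracket_scale_right tri_in tri.tri_scale)
  next
    case (tri_ad_x d u i)
    obtain a where "bracket L t (x i) = vscale L a (x i)" using Tx[OF t] by blast
    then have "bracket L (bracket L t (x i)) u = vscale L a (bracket L (x i) u)"
      using tri_in[OF tri_ad_x(2)] by (simp add: bracket_scale_left)
    then show ?case
      using tri_jacobi[OF tc x_in tri_in[OF tri_ad_x(2)]] tri.tri_ad_x[OF tri_ad_x(1,2)]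
        tri.tri_ad_x[OF tri_ad_x(1,3)] by (simp add: tri.tri_scale)
  next
    case (tri_ad_y d u i)
    obtain a where "bracket L t (y i) = vscale L a (y i)" using Ty[OF t] by blast
    then have "bracket L (bracket L t (y i)) u = vscale L a (bracket L (y i) u)"
      using tri_in[OF tri_ad_y(2)] by (simp add: bracket_scale_left)
    then show ?case
      using tri_jacobi[OF tc y_in tri_in[OF tri_ad_y(2)]] tri.tri_ad_y[OF tri_ad_y(1,2)]
        tri.tri_ad_y[OF tri_ad_y(1,3)] by (simp add: tri.tri_scale)
  qed
qed

lemma tri_T_span_bracket:
  assumes z: "z \<in> vcarrier L" and Tz: "\<And>t. t \<in> T \<Longrightarrow> tri d (bracket L z t)" and u: "u \<in> vspan L T"
  shows "tri d (bracket L z u)"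
proof -
  have "vspan L T \<subseteq> {u \<in> vcarrier L. tri d (bracket L z u)}"
    using z T_in Tz by (intro vspan_least)
      (auto simp: vsubspace_def bracket_add_right bracket_scale_right tri_zero tri_add tri_scale)
  then show ?thesis using u by blast
qed

lemma tri_xT: "t \<in> T \<Longrightarrow> tri 1 (bracket L (x i) t)"
  using tri_swap[of "x i" t 1] tri_T_bracket[OF _ tri_x] T_in by auto

lemma tri_yT: "t \<in> T \<Longrightarrow> tri (- 1) (bracket L (y i) t)"
  using tri_swap[of "y i" t "- 1"] tri_T_bracket[OF _ tri_y] T_in by auto

lemma tri_xy: "tri 0 (bracket L (x i) (y j))"
  using xy[of i j] by (auto simp: tri_zero intro: tri_T)

lemma tri_xy_bracket: "tri d u \<Longrightarrow> tri d (bracket L (bracket L (x i) (y j)) u)"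
  using xy[of i j] tri_T_bracket by (auto simp: tri_zero tri_in)

lemma tri_x_bracket: "tri d u \<Longrightarrow> tri (d + 1) (bracket L (x i) u)"
proof (induction rule: tri.induct)
  case (tri_x j) then show ?case using tri.tri_ad_x[OF _ tri.tri_x, of i j] by simp
next
  case (tri_y j) then show ?case using tri_xy by simp
next
  case (tri_T t) then show ?case using tri_xT by simp
next
  case (tri_zero d) then show ?case by (simp add: tri.tri_zero)
next
  case (tri_add d u v) then show ?case by (simp add: bracket_add_right tri_in tri.tri_add)
next
  case (tri_scale d u a) then show ?case by (simp add: bracket_scale_right tri_in tri.tri_scale)
next
  case (tri_ad_x d u j)
  then show ?case using tri.tri_ad_x[OF _ tri.tri_ad_x[OF tri_ad_x(1,2)]] by simp
next
  case (tri_ad_y d u j)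
  have "tri d (bracket L (x i) (bracket L (y j) u))"
  proof (rule tri_jacobi)
    show "tri d (bracket L (bracket L (x i) (y j)) u)" by (rule tri_xy_bracket[OF tri_ad_y(2)])
    show "tri d (bracket L (y j) (bracket L (x i) u))"
    proof (cases "d = - 1")
      case True
      have "bracket L (x i) u \<in> vspan L T" using tri_zero_span tri_ad_y.IH True by simp
      then show ?thesis using tri_T_span_bracket[of "y j" "- 1"] tri_yT True by simp
    next
      case False
      then show ?thesis using tri.tri_ad_y[OF _ tri_ad_y.IH, of j] tri_ad_y(1) by simp
    qed
  qed (use tri_ad_y tri_in in auto)
  then show ?case by simp
qed

lemma tri_y_bracket: "tri d u \<Longrightarrow> tri (d - 1) (bracket L (y i) u)"
proof (induction rule: tri.induct)
  case (tri_x j) then show ?case using tri_swap[of "y i" "x j", OF _ _ tri_xy] by simp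
next
  case (tri_y j) then show ?case using tri.tri_ad_y[OF _ tri.tri_y, of i j] by simp
next
  case (tri_T t) then show ?case using tri_yT by simp
next
  case (tri_zero d) then show ?case by (simp add: tri.tri_zero)
next
  case (tri_add d u v) then show ?case by (simp add: bracket_add_right tri_in tri.tri_add)
next
  case (tri_scale d u a) then show ?case by (simp add: bracket_scale_right tri_in tri.tri_scale)
next
  case (tri_ad_y d u j)
  then show ?case using tri.tri_ad_y[OF _ tri.tri_ad_y[OF tri_ad_y(1,2)]] by simp
next
  case (tri_ad_x d u j)
  have "tri d (bracket L (y i) (bracket L (x j) u))"
  proof (rule tri_jacobi)
    have "tri d (vscale L (- 1) (bracket L (bracket L (x j) (y i)) u))"
      by (rule tri.tri_scale[OF tri_xy_bracket[OF tri_ad_x(2)]])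
    then show "tri d (bracket L (bracket L (y i) (x j)) u)"
      using bracket_skew[of "x j" "y i"] tri_in[OF tri_ad_x(2)] by (simp add: bracket_scale_left)
    show "tri d (bracket L (x j) (bracket L (y i) u))"
    proof (cases "d = 1")
      case True
      have "bracket L (y i) u \<in> vspan L T" using tri_zero_span tri_ad_x.IH True by simp
      then show ?thesis using tri_T_span_bracket[of "x j" 1] tri_xT True by simp
    next
      case False
      then show ?thesis using tri.tri_ad_x[OF _ tri_ad_x.IH, of j] tri_ad_x(1) by simp
    qed
  qed (use tri_ad_x tri_in in auto)
  then show ?case by simp
qed

lemma tri_bracket: "tri d u \<Longrightarrow> tri e v \<Longrightarrow> tri (d + e) (bracket L u v)"
proof (induction arbitrary: e v rule: tri.induct)
  case (tri_x i) then show ?case using tri_x_bracket[of e v i] by (simp add: add.commute)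
next
  case (tri_y i) then show ?case using tri_y_bracket[of e v i] by simp
next
  case (tri_T t) then show ?case using tri_T_bracket by simp
next
  case (tri_zero d) then show ?case by (simp add: tri.tri_zero tri_in)
next
  case (tri_add d u u') then show ?case by (simp add: bracket_add_left tri_in tri.tri_add)
next
  case (tri_scale d u a) then show ?case by (simp add: bracket_scale_left tri_in tri.tri_scale)
next
  case (tri_ad_x d u i)
  have 1: "tri (d + 1 + e) (bracket L (x i) (bracket L u v))"
    using tri_x_bracket[OF tri_ad_x.IH[OF tri_ad_x.prems], of i] by (simp add: algebra_simps)
  have 2: "tri (d + 1 + e) (bracket L u (bracket L (x i) v))"
    using tri_ad_x.IH[OF tri_x_bracket[OF tri_ad_x.prems, of i]] by (simp add: algebra_simps)
  show ?case using tri_jacobi'[OF _ _ _ 1 2] tri_ad_x tri_in by simp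
next
  case (tri_ad_y d u i)
  have 1: "tri (d - 1 + e) (bracket L (y i) (bracket L u v))"
    using tri_y_bracket[OF tri_ad_y.IH[OF tri_ad_y.prems], of i] by (simp add: algebra_simps)
  have 2: "tri (d - 1 + e) (bracket L u (bracket L (y i) v))"
    using tri_ad_y.IH[OF tri_y_bracket[OF tri_ad_y.prems, of i]] by (simp add: algebra_simps)
  show ?case using tri_jacobi'[OF _ _ _ 1 2] tri_ad_y tri_in by simp
qed

lemma homog_tri: "homog L gens d u \<Longrightarrow> tri d u"
proof (induction rule: homog.induct)
  case (gen g d) then show ?case by (auto intro: tri_x tri_y tri_T)
qed (auto intro: tri_zero tri_add tri_scale tri_bracket)

theorem homog_zero_in_span: "homog L gens 0 u \<Longrightarrow> u \<in> vspan L T"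
  using tri_zero_span homog_tri by blast

lemma homog_in: "homog L gens d u \<Longrightarrow> u \<in> vcarrier L"
  using homog_tri tri_in by blast

section \<open>The maximal graded ideal that avoids the Cartan subalgebra\<close>

text \<open>A representation on a finite-dimensional graded algebra.\<close>

lemma coord_hom_homog:
  fixes \<phi> :: "'v \<Rightarrow> 'i::finite \<Rightarrow> 'k"
  assumes \<phi>: "coord_hom L S \<phi>"
    and S: "\<And>i j k. S i j k \<noteq> 0 \<Longrightarrow> deg k = deg i + deg j"
    and gens: "\<And>i k. \<phi> (x i) k \<noteq> 0 \<Longrightarrow> deg k = 1" "\<And>i k. \<phi> (y i) k \<noteq> 0 \<Longrightarrow> deg k = - 1"
      "\<And>t k. t \<in> T \<Longrightarrow> \<phi> t k \<noteq> 0 \<Longrightarrow> deg k = 0"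
  shows "homog L gens d u \<Longrightarrow> \<phi> u k \<noteq> 0 \<Longrightarrow> deg k = (d::int)"
proof (induction arbitrary: k rule: homog.induct)
  case (gen g d) then show ?case using gens by auto
next
  case (zero d) then show ?case using coord_hom_zero[OF vspace_axioms \<phi>] by simp
next
  case (add d u v)
  then have "\<phi> u k + \<phi> v k \<noteq> 0"
    using coord_homD(1)[OF \<phi> homog_in[OF add.hyps(1)] homog_in[OF add.hyps(2)]] by simp
  then have "\<phi> u k \<noteq> 0 \<or> \<phi> v k \<noteq> 0" by auto
  then show ?case using add.IH by blast
next
  case (scale d u a)
  then show ?case using coord_homD(2)[OF \<phi> homog_in[OF scale.hyps]] by simp
next
  case (bracket d u e v)
  have "sc_bracket S (\<phi> u) (\<phi> v) k \<noteq> 0"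
    using bracket.prems coord_homD(3)[OF \<phi>] homog_in[OF bracket.hyps(1)] homog_in[OF bracket.hyps(2)] by simp
  then obtain i j where "\<phi> u i * \<phi> v j * S i j k \<noteq> 0"
    unfolding sc_bracket_def by (metis (mono_tags, lifting) sum.neutral)
  then show ?case using bracket.IH(1)[of i] bracket.IH(2)[of j] S[of i j k] by simp
qed

text \<open>
  The kernel of such a representation is the maximal graded ideal: an element of positive degree in
  an ideal is brought to degree \<open>0\<close> by bracketing with the \<open>y\<^sub>i\<close> without leaving the ideal, and the
  image in the finite-dimensional algebra shows that this does not kill it.
\<close>

theorem kernel_greatest:
  fixes \<phi> :: "'v \<Rightarrow> 'i::finite \<Rightarrow> 'k" and deg :: "'i \<Rightarrow> int"
  assumes \<phi>: "coord_hom L S \<phi>"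
    and S: "\<And>i j k. S i j k \<noteq> 0 \<Longrightarrow> deg k = deg i + deg j"
    and gens: "\<And>i k. \<phi> (x i) k \<noteq> 0 \<Longrightarrow> deg k = 1" "\<And>i k. \<phi> (y i) k \<noteq> 0 \<Longrightarrow> deg k = - 1"
      "\<And>t k. t \<in> T \<Longrightarrow> \<phi> t k \<noteq> 0 \<Longrightarrow> deg k = 0"
    and generated: "vspan L {u. \<exists>d. homog L gens d u} = vcarrier L"
    and lift: "\<And>i. homog L gens (deg i) (l i)" "\<And>i. \<phi> (l i) = unit_vec i"
    and inj: "\<And>u. u \<in> vspan L T \<Longrightarrow> \<phi> u = (\<lambda>k. 0) \<Longrightarrow> u = vzero L"
    and pos: "\<And>d f. d > 0 \<Longrightarrow> (\<And>k. f k \<noteq> 0 \<Longrightarrow> deg k = d) \<Longrightarrow>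
      (\<And>i. sc_bracket S (\<phi> (y i)) f = (\<lambda>k. 0)) \<Longrightarrow> f = (\<lambda>k. 0)"
    and neg: "\<And>d f. d < 0 \<Longrightarrow> (\<And>k. f k \<noteq> 0 \<Longrightarrow> deg k = d) \<Longrightarrow>
      (\<And>i. sc_bracket S (\<phi> (x i)) f = (\<lambda>k. 0)) \<Longrightarrow> f = (\<lambda>k. 0)"
  shows "(GREATEST I. graded_ideal L gens I \<and> I \<inter> vspan L T = {vzero L}) = kernel L \<phi>"
proof (rule Greatest_equality)
  note hom = coord_homD[OF \<phi>]
  have deg: "deg k = d" if "homog L gens d u" "\<phi> u k \<noteq> 0" for d u k
    by (rule coord_hom_homog[where deg = deg, OF \<phi> _ _ _ _ that]) (fact S | fact gens)+
  have K: "lie_ideal L (kernel L \<phi>)" by (rule kernel_ideal[OF algebra_axioms \<phi>])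
  have Ksub: "vsubspace L (kernel L \<phi>)" using K by (simp add: lie_ideal_def)
  have \<phi>0: "\<phi> (vzero L) = (\<lambda>k. 0)" by (rule coord_hom_zero[OF vspace_axioms \<phi>])
  define N where "N = vspan L {v \<in> kernel L \<phi>. \<exists>d. homog L gens d v}"
  have Nsub: "vsubspace L N"
    unfolding N_def using vsubspaceD(1)[OF Ksub] by (intro vspan_subspace) auto
  have "kernel L \<phi> \<subseteq> N"
  proof
    obtain ls :: "'i list" where ls: "set ls = UNIV" "distinct ls"
      using finite_distinct_list[OF finite[of "UNIV :: 'i set"]] by blast
    define sec where "sec f = vsum L (map (\<lambda>i. vscale L (f i) (l i)) ls)" for f
    have l_in: "l i \<in> vcarrier L" for i using lift(1) homog_in by blast
    have sum_in: "vsum L (map (\<lambda>i. vscale L (f i) (l i)) js) \<in> vcarrier L" for f js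
      by (induction js) (simp_all add: vsum_def l_in)
    have sec_in: "sec f \<in> vcarrier L" for f unfolding sec_def by (rule sum_in)
    have sum_add: "vsum L (map (\<lambda>i. vscale L (f i + g i) (l i)) js) =
      vadd L (vsum L (map (\<lambda>i. vscale L (f i) (l i)) js)) (vsum L (map (\<lambda>i. vscale L (g i) (l i)) js))" for f g js
    proof (induction js)
      case (Cons j js)
      let ?F = "vsum L (map (\<lambda>i. vscale L (f i) (l i)) js)" and ?G = "vsum L (map (\<lambda>i. vscale L (g i) (l i)) js)"
      have "vsum L (map (\<lambda>i. vscale L (f i + g i) (l i)) (j # js)) =
        vadd L (vadd L (vscale L (f j) (l j)) (vscale L (g j) (l j))) (vadd L ?F ?G)"
        using Cons by (simp add: vsum_def add_scale l_in)
      also have "\<dots> = vadd L (vadd L (vscale L (f j) (l j)) ?F) (vadd L (vscale L (g j) (l j)) ?G)"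
        using sum_in[of f js] sum_in[of g js] l_in[of j] by (simp add: add_assoc add_left_commute)
      finally show ?case by (simp add: vsum_def)
    qed (simp add: vsum_def)
    have sum_scale: "vsum L (map (\<lambda>i. vscale L (a * f i) (l i)) js) =
      vscale L a (vsum L (map (\<lambda>i. vscale L (f i) (l i)) js))" for f a js
    proof (induction js)
      case (Cons j js)
      then show ?case using sum_in[of f js] l_in[of j] by (simp add: vsum_def scale_add scale_scale)
    qed (simp add: vsum_def)
    have sum_\<phi>: "\<phi> (vsum L (map (\<lambda>i. vscale L (f i) (l i)) js)) k = (\<Sum>i\<leftarrow>js. f i * unit_vec i k)" for f js k
    proof (induction js)
      case Nil then show ?case by (simp add: vsum_def \<phi>0)
    next
      case (Cons j js)
      then show ?case using sum_in[of f js] l_in[of j] by (simp add: vsum_def hom lift(2))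
    qed
    have sec_\<phi>: "\<phi> (sec f) = f" for f
    proof
      fix k
      have "\<phi> (sec f) k = (\<Sum>i\<in>UNIV. f i * unit_vec i k)"
        unfolding sec_def sum_\<phi> using ls by (simp add: sum_list_distinct_conv_sum_set)
      also have "\<dots> = f k" using unit_vec_expand[of f] by metis
      finally show "\<phi> (sec f) k = f k" .
    qed
    have sec_homog: "homog L gens d (sec f)" if f: "\<And>k. f k \<noteq> 0 \<Longrightarrow> deg k = d" for f d
    proof -
      have "homog L gens d (vscale L (f i) (l i))" for i
        using f[of i] lift(1)[of i] l_in[of i] by (cases "f i = 0") (auto intro: homog.scale homog.zero)
      then have "homog L gens d (vsum L (map (\<lambda>i. vscale L (f i) (l i)) js))" for js
        by (induction js) (auto simp: vsum_def intro: homog.zero homog.add)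
      then show ?thesis unfolding sec_def .
    qed
    define W where "W = {v \<in> vcarrier L. vsub v (sec (\<phi> v)) \<in> N}"
    have "vsubspace L W"
      unfolding vsubspace_def
    proof (intro conjI ballI allI)
      show "W \<subseteq> vcarrier L" by (auto simp: W_def)
      have "sec (\<lambda>k. 0) = vzero L"
        using sum_scale[of 0 "\<lambda>k. 0" "ls"] sum_in[of "\<lambda>k. 0" "ls"] by (simp add: sec_def)
      then show "vzero L \<in> W" using vsubspaceD(2)[OF Nsub] by (simp add: W_def \<phi>0)
    next
      fix u v assume uv: "u \<in> W" "v \<in> W"
      then have c: "u \<in> vcarrier L" "v \<in> vcarrier L" by (auto simp: W_def)
      have "vadd L (vsub u (sec (\<phi> u))) (vsub v (sec (\<phi> v))) \<in> N"
        using uv vsubspaceD(3)[OF Nsub] by (simp add: W_def)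
      then show "vadd L u v \<in> W"
        using c by (simp add: W_def sub_self_add sec_in hom sum_add[of "\<phi> u" "\<phi> v" "ls", folded sec_def])
    next
      fix a u assume u: "u \<in> W"
      then have c: "u \<in> vcarrier L" by (auto simp: W_def)
      have "vscale L a (vsub u (sec (\<phi> u))) \<in> N"
        using u vsubspaceD(4)[OF Nsub] by (simp add: W_def)
      then show "vscale L a u \<in> W"
        using c by (simp add: W_def sec_in hom sum_scale[of a "\<phi> u" "ls", folded sec_def] scale_add
            scale_scale mult.commute)
    qed
    moreover have "u \<in> W" if "homog L gens d u" for u d
    proof -
      have c: "u \<in> vcarrier L" using that homog_in by blast
      have "homog L gens d (vsub u (sec (\<phi> u)))"
        using that sec_homog[of "\<phi> u" d] deg[OF that] by (intro homog.add homog.scale) auto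
      moreover have "vsub u (sec (\<phi> u)) \<in> kernel L \<phi>"
        using c sec_in[of "\<phi> u"] by (simp add: kernel_def hom sec_\<phi>)
      ultimately have "vsub u (sec (\<phi> u)) \<in> N"
        unfolding N_def by (intro subsetD[OF vspan_superset]) auto
      then show ?thesis using c by (simp add: W_def)
    qed
    ultimately have "vcarrier L \<subseteq> W"
      unfolding generated[symmetric] by (intro vspan_least) auto
    moreover fix v assume v: "v \<in> kernel L \<phi>"
    ultimately have "vsub v (sec (\<lambda>k. 0)) \<in> N" by (auto simp: W_def kernel_def)
    moreover have "sec (\<lambda>k. 0) = vzero L"
      using sum_scale[of 0 "\<lambda>k. 0" "ls"] sum_in[of "\<lambda>k. 0" "ls"] by (simp add: sec_def)
    ultimately show "v \<in> N" using v by (simp add: kernel_def)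
  qed
  moreover have "N \<subseteq> kernel L \<phi>"
    unfolding N_def by (rule vspan_least[OF Ksub]) auto
  ultimately have "kernel L \<phi> = N" by (rule equalityI)
  then have "graded_ideal L gens (kernel L \<phi>)"
    using K unfolding graded_ideal_def N_def by simp
  moreover have "kernel L \<phi> \<inter> vspan L T = {vzero L}"
  proof (rule equalityI)
    show "kernel L \<phi> \<inter> vspan L T \<subseteq> {vzero L}"
    proof
      fix u assume "u \<in> kernel L \<phi> \<inter> vspan L T"
      then have "u = vzero L" by (intro inj) (auto simp: kernel_def)
      then show "u \<in> {vzero L}" by simp
    qed
    show "{vzero L} \<subseteq> kernel L \<phi> \<inter> vspan L T"
      using vsubspaceD(2)[OF Ksub] vsubspaceD(2)[OF vspan_subspace[OF T_in]] by simp
  qed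
  ultimately show "graded_ideal L gens (kernel L \<phi>) \<and> kernel L \<phi> \<inter> vspan L T = {vzero L}" ..
next
  note hom = coord_homD[OF \<phi>]
  have deg: "deg k = d" if "homog L gens d u" "\<phi> u k \<noteq> 0" for d u k
    by (rule coord_hom_homog[where deg = deg, OF \<phi> _ _ _ _ that]) (fact S | fact gens)+
  fix I assume I: "graded_ideal L gens I \<and> I \<inter> vspan L T = {vzero L}"
  then have ideal: "lie_ideal L I" and gr: "I = vspan L {v \<in> I. \<exists>d. homog L gens d v}"
    by (auto simp: graded_ideal_def)
  have br: "bracket L u v \<in> I" if "u \<in> vcarrier L" "v \<in> I" for u v
    using ideal that by (auto simp: lie_ideal_def)
  have zero: "\<phi> v = (\<lambda>k. 0)" if "v \<in> I" "homog L gens 0 v" for v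
  proof -
    have "v = vzero L" using that I homog_zero_in_span by blast
    then show ?thesis using coord_hom_zero[OF vspace_axioms \<phi>] by simp
  qed
  have p: "\<phi> v = (\<lambda>k. 0)" if "v \<in> I" "homog L gens (int n) v" for v n
    using that
  proof (induction n arbitrary: v)
    case 0 then show ?case using zero by simp
  next
    case (Suc n)
    have v: "v \<in> vcarrier L" using Suc.prems homog_in by blast
    have "\<phi> (bracket L (y i) v) = (\<lambda>k. 0)" for i
    proof (rule Suc.IH)
      show "bracket L (y i) v \<in> I" using br Suc.prems by simp
      have "homog L gens (- 1 + int (Suc n)) (bracket L (y i) v)"
        by (rule homog.bracket[OF homog.gen Suc.prems(2)]) auto
      then show "homog L gens (int n) (bracket L (y i) v)" by simp
    qed
    then have b: "sc_bracket S (\<phi> (y i)) (\<phi> v) = (\<lambda>k. 0)" for i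
      using hom(3)[OF y_in v, of i] by metis
    show ?case by (rule pos[OF _ deg[OF Suc.prems(2)] b]) auto
  qed
  have n: "\<phi> v = (\<lambda>k. 0)" if "v \<in> I" "homog L gens (- int n) v" for v n
    using that
  proof (induction n arbitrary: v)
    case 0 then show ?case using zero by simp
  next
    case (Suc n)
    have v: "v \<in> vcarrier L" using Suc.prems homog_in by blast
    have "\<phi> (bracket L (x i) v) = (\<lambda>k. 0)" for i
    proof (rule Suc.IH)
      show "bracket L (x i) v \<in> I" using br Suc.prems by simp
      have "homog L gens (1 + - int (Suc n)) (bracket L (x i) v)"
        by (rule homog.bracket[OF homog.gen Suc.prems(2)]) auto
      then show "homog L gens (- int n) (bracket L (x i) v)" by simp
    qed
    then have b: "sc_bracket S (\<phi> (x i)) (\<phi> v) = (\<lambda>k. 0)" for i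
      using hom(3)[OF x_in v, of i] by metis
    show ?case by (rule neg[OF _ deg[OF Suc.prems(2)] b]) auto
  qed
  have "{v \<in> I. \<exists>d. homog L gens d v} \<subseteq> kernel L \<phi>"
  proof safe
    fix v d assume v: "v \<in> I" "homog L gens d v"
    then have "\<phi> v = (\<lambda>k. 0)"
      using p[of v "nat d"] n[of v "nat (- d)"] by (cases "d \<ge> 0") auto
    then show "v \<in> kernel L \<phi>" using homog_in[OF v(2)] by (simp add: kernel_def)
  qed
  moreover have "vsubspace L (kernel L \<phi>)"
    using kernel_ideal[OF algebra_axioms \<phi>] by (simp add: lie_ideal_def)
  ultimately show "I \<subseteq> kernel L \<phi>"
    using gr vspan_least[of L "kernel L \<phi>" "{v \<in> I. \<exists>d. homog L gens d v}"] by blast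
qed

end

instance idx :: finite
proof
  have "i \<in> Pos ` {R1, R2, R3, R4, R5, R6, R7} \<union> Neg ` {R1, R2, R3, R4, R5, R6, R7} \<union> Tor ` {T1, T2, T3, T4}" for i
  proof (cases i)
    case (Pos r) then show ?thesis by (cases r) auto
  next
    case (Neg r) then show ?thesis by (cases r) auto
  next
    case (Tor t) then show ?thesis by (cases t) auto
  qed
  then show "finite (UNIV :: idx set)"
    by (intro finite_subset[OF subsetI, of UNIV "Pos ` {R1, R2, R3, R4, R5, R6, R7} \<union> Neg ` {R1, R2, R3, R4, R5, R6, R7} \<union> Tor ` {T1, T2, T3, T4}"]) auto
qed

section \<open>Evaluation of the tables\<close>

primrec ev :: "'k::field \<Rightarrow> poly2 \<Rightarrow> 'k" where
  "ev \<alpha> [] = 0"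
| "ev \<alpha> (b # p) = of_bool b + \<alpha> * ev \<alpha> p"

definition val :: "'k::field \<Rightarrow> comb \<Rightarrow> idx \<Rightarrow> 'k" where
  "val \<alpha> vs u = ev \<alpha> (coef vs u)"

definition sc :: "'k::field \<Rightarrow> table \<Rightarrow> idx \<Rightarrow> idx \<Rightarrow> idx \<Rightarrow> 'k" where
  "sc \<alpha> br i j k = val \<alpha> (br i j) k"

primrec idx_label :: "idx \<Rightarrow> label" where
  "idx_label (Pos r) = X (case r of R1 \<Rightarrow> 1 | R2 \<Rightarrow> 2 | R3 \<Rightarrow> 3 | R4 \<Rightarrow> 4 | R5 \<Rightarrow> 5 | R6 \<Rightarrow> 6 | R7 \<Rightarrow> 7)"
| "idx_label (Neg r) = Y (case r of R1 \<Rightarrow> 1 | R2 \<Rightarrow> 2 | R3 \<Rightarrow> 3 | R4 \<Rightarrow> 4 | R5 \<Rightarrow> 5 | R6 \<Rightarrow> 6 | R7 \<Rightarrow> 7)"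
| "idx_label (Tor t) = H (case t of T1 \<Rightarrow> 1 | T2 \<Rightarrow> 2 | T3 \<Rightarrow> 3 | T4 \<Rightarrow> 4)"

lemma idx_label_inj: "idx_label i = idx_label j \<longleftrightarrow> i = j"
  by (cases i; cases j) (auto split: root.splits torus.splits)

definition term_of_entry :: "'k::field \<Rightarrow> poly2 \<times> idx \<times> idx \<times> idx \<Rightarrow> 'k \<times> label \<times> label \<times> label" where
  "term_of_entry \<alpha> = (\<lambda>(a, u, v, w). (ev \<alpha> a, idx_label u, idx_label v, idx_label w))"

lemma pick_if: "pick c a b = (if c then a else b)"
  by (cases c) auto

locale params =
  fixes \<alpha> :: "'k::field"
  assumes two: "(1::'k) + 1 = 0" and \<alpha>_0: "\<alpha> \<noteq> 0" and \<alpha>_1: "\<alpha> \<noteq> 1"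
begin

lemma two_eq_0 [simp]: "(2::'k) = 0"
  using two one_add_one[where 'a = 'k] by simp

lemma double [simp]: "(a::'k) + a = 0"
  using two distrib_left[of a 1 1] by simp

lemma double_left [simp]: "(a::'k) + (a + b) = b"
  by (simp add: add.assoc[symmetric])

lemma neg_id [simp]: "- (a::'k) = a"
  by (rule minus_unique) simp

lemma add_eq_0 [simp]: "(a::'k) + b = 0 \<longleftrightarrow> a = b"
  using add_eq_0_iff[of a b] by auto

lemma shift: "(a::'k) + b = c \<longleftrightarrow> a = b + c"
  by auto

lemma ev_padd: "ev \<alpha> (padd p q) = ev \<alpha> p + ev \<alpha> q"
  by (induction p q rule: padd.induct) (auto simp: algebra_simps)

lemma ev_pmul: "ev \<alpha> (pmul p q) = ev \<alpha> p * ev \<alpha> q"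
  by (induction p q rule: pmul.induct) (auto simp: algebra_simps ev_padd)

lemma ev_pnull: "pnull p \<Longrightarrow> ev \<alpha> p = 0"
  by (induction p) (auto simp: pnull_def)

lemma ev_punit: assumes "punit p" shows "ev \<alpha> p \<noteq> 0"
proof -
  have "1 + \<alpha> \<noteq> 0" using \<alpha>_1 by auto
  moreover have "1 + \<alpha> * \<alpha> = (1 + \<alpha>) * (1 + \<alpha>)" by (simp add: algebra_simps)
  ultimately have nz: "1 + \<alpha> \<noteq> 0" "1 + \<alpha> * \<alpha> \<noteq> 0" by auto
  have "\<exists>q\<in>{c1, c\<alpha>, c\<beta>, c\<alpha>\<beta>, pmul c\<alpha>\<beta> c\<beta>}. ev \<alpha> (padd p q) = 0"
    using assms ev_pnull by (auto simp: punit_def)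
  then have "ev \<alpha> p \<in> {1, \<alpha>, 1 + \<alpha>, \<alpha> * (1 + \<alpha>), \<alpha> * (1 + \<alpha> * \<alpha>)}"
    by (auto simp: ev_padd)
  then show ?thesis using \<alpha>_0 nz by auto
qed

lemma val_Nil [simp]: "val \<alpha> [] u = 0"
  by (simp add: val_def)

lemma val_Cons: "val \<alpha> ((a, l) # vs) u = (if l = u then ev \<alpha> a else 0) + val \<alpha> vs u"
  by (simp add: val_def pick_if ev_padd)

lemma val_append [simp]: "val \<alpha> (vs @ ws) u = val \<alpha> vs u + val \<alpha> ws u"
  by (induction vs) (auto simp: val_Cons)

lemma val_scale: "val \<alpha> (map (\<lambda>(c, u). (pmul a c, u)) vs) u = ev \<alpha> a * val \<alpha> vs u"
  by (induction vs) (auto simp: val_Cons ev_pmul algebra_simps)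

lemma coef_not_in: "u \<notin> snd ` set vs \<Longrightarrow> coef vs u = []"
  by (induction vs) (auto simp: pick_if)

lemma comb_null: assumes "comb_null vs" shows "val \<alpha> vs u = 0"
proof (cases "u \<in> snd ` set vs")
  case True
  then show ?thesis using assms ev_pnull by (auto simp: comb_null_def val_def list_all_iff)
next
  case False
  then show ?thesis by (simp add: val_def coef_not_in)
qed

lemma sum_val: "(\<Sum>l\<in>UNIV. val \<alpha> vs l * F l) = (\<Sum>(a, l)\<leftarrow>vs. ev \<alpha> a * F l)"
proof (induction vs)
  case (Cons p vs)
  obtain a m where p: "p = (a, m)" by (cases p)
  have "(\<Sum>l\<in>UNIV. val \<alpha> (p # vs) l * F l) =
    (\<Sum>l\<in>UNIV. (if l = m then ev \<alpha> a * F l else 0) + val \<alpha> vs l * F l)"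
    by (intro sum.cong) (auto simp: p val_Cons algebra_simps)
  then show ?case using Cons p by (simp add: sum.distrib)
qed simp

lemma val_ad_comb: "val \<alpha> (ad_comb br i vs) u = (\<Sum>l\<in>UNIV. val \<alpha> vs l * sc \<alpha> br i l u)"
  unfolding sum_val by (induction br i vs rule: ad_comb.induct) (auto simp: val_scale sc_def)

lemma val_expr_comb: "val \<alpha> (expr_comb ts vs k) u = (\<Sum>l\<in>UNIV. val \<alpha> vs l * val \<alpha> (expr_val ts l k) u)"
  unfolding sum_val by (induction ts vs k rule: expr_comb.induct) (auto simp: val_scale)

lemma all_pairsD:
  "all_pairs Q xs \<Longrightarrow> i \<in> set xs \<Longrightarrow> j \<in> set xs \<Longrightarrow> i = j \<or> Q i j \<or> Q j i"
  by (induction Q xs rule: all_pairs.induct) (auto simp: list_all_iff)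

lemma all_triplesD:
  assumes "all_triples Q xs" "i \<in> set xs" "j \<in> set xs" "k \<in> set xs"
    and "\<And>i j k. Q i j k \<Longrightarrow> P i j k" and "\<And>i j k. P i j k \<Longrightarrow> P j i k" "\<And>i j k. P i j k \<Longrightarrow> P i k j"
    and "\<And>i k. P i i k"
  shows "P i j k"
  using assms(1-4)
proof (induction xs arbitrary: i j k)
  case (Cons x xs)
  have h: "P x a b" if "a \<in> set xs" "b \<in> set xs" for a b
    using all_pairsD[of "Q x" xs a b] Cons.prems(1) that assms(5-8) by (metis all_triples.simps(2))
  have h': "P x x a" "P x a x" "P a x x" if "a \<in> set (x # xs)" for a
    using assms(6-8) by metis+
  have "P i j k" if "i \<in> set xs" "j \<in> set xs" "k \<in> set xs"
    using Cons that by simp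
  moreover have "P a x b" "P a b x" if "a \<in> set xs" "b \<in> set xs" for a b
    using h[OF that] assms(6,7) by metis+
  ultimately show ?case using Cons.prems(2-4) h h' by auto
qed simp

text \<open>A cochain with values in an algebra with structure constants is a cocycle if this sum vanishes.\<close>

definition cocycle_sum :: "table \<Rightarrow> (idx \<Rightarrow> idx \<Rightarrow> idx \<Rightarrow> 'k) \<Rightarrow> idx \<Rightarrow> idx \<Rightarrow> idx \<Rightarrow> idx \<Rightarrow> 'k" where
  "cocycle_sum br C i j k u =
     (\<Sum>l\<in>UNIV. C l j k * sc \<alpha> br i l u) + (\<Sum>l\<in>UNIV. C l i k * sc \<alpha> br j l u) + (\<Sum>l\<in>UNIV. C l i j * sc \<alpha> br k l u) +
     (\<Sum>l\<in>UNIV. sc \<alpha> br i j l * C u l k) + (\<Sum>l\<in>UNIV. sc \<alpha> br i k l * C u l j) + (\<Sum>l\<in>UNIV. sc \<alpha> br j k l * C u l i)"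

definition expr_array :: "expr \<Rightarrow> idx \<Rightarrow> idx \<Rightarrow> idx \<Rightarrow> 'k" where
  "expr_array ts u v w = val \<alpha> (expr_val ts v w) u"

lemma expr_val_commute: "expr_val ts v w = expr_val ts w v"
  by (induction ts v w rule: expr_val.induct) (auto simp: pick_if)

lemma expr_val_diag: "expr_val ts v v = []"
  by (induction ts) (auto simp: pick_if)

lemma cocycle_table:
  assumes "cocycle_table br I ts" and sym: "\<And>i j k. i \<in> set I \<Longrightarrow> j \<in> set I \<Longrightarrow> sc \<alpha> br i j k = sc \<alpha> br j i k"
    and alt: "\<And>i k. i \<in> set I \<Longrightarrow> sc \<alpha> br i i k = 0"
    and ijk: "i \<in> set I" "j \<in> set I" "k \<in> set I"
  shows "cocycle_sum br (expr_array ts) i j k u = 0"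
proof -
  let ?P = "\<lambda>i j k. i \<in> set I \<longrightarrow> j \<in> set I \<longrightarrow> k \<in> set I \<longrightarrow> cocycle_sum br (expr_array ts) i j k u = 0"
  have C: "expr_array ts u v w = expr_array ts u w v" "expr_array ts u v v = 0" for u v w
    using expr_val_commute[of ts v w] by (simp_all add: expr_array_def expr_val_diag)
  have "?P i j k"
  proof (rule all_triplesD[OF assms(1)[unfolded cocycle_table_def] ijk, where P = ?P])
    fix i j k
    assume "comb_null (ad_comb br i (expr_val ts j k) @ ad_comb br j (expr_val ts i k) @ ad_comb br k (expr_val ts i j) @
     expr_comb ts (br i j) k @ expr_comb ts (br i k) j @ expr_comb ts (br j k) i)"
    from comb_null[OF this, of u] show "?P i j k"
      by (simp add: cocycle_sum_def expr_array_def val_ad_comb val_expr_comb sc_def add.assoc)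
  next
    fix i j k assume "?P i j k"
    then show "?P j i k" "?P i k j"
      using C(1) sym by (auto simp: cocycle_sum_def ac_simps)
  next
    fix i k show "?P i i k"
      using C alt by (auto simp: cocycle_sum_def)
  qed
  then show ?thesis using ijk by blast
qed

end

section \<open>Second cohomology of a Lie algebra\<close>

lemma cochains2_simps:
  "vzero (cochains2 L) = (\<lambda>p\<in>vcarrier L \<times> vcarrier L. vzero L)"
  "vadd (cochains2 L) = (\<lambda>c c'. \<lambda>p\<in>vcarrier L \<times> vcarrier L. vadd L (c p) (c' p))"
  "vscale (cochains2 L) = (\<lambda>a c. \<lambda>p\<in>vcarrier L \<times> vcarrier L. vscale L a (c p))"
  by (simp_all add: cochains2_def Let_def)

lemma cocycles2_simps [simp]:
  "vzero (cocycles2 L) = vzero (cochains2 L)" "vadd (cocycles2 L) = vadd (cochains2 L)"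
  "vscale (cocycles2 L) = vscale (cochains2 L)"
  by (simp_all add: cocycles2_def)

lemma H2_spanned_byI:
  assumes Z: "vspace (cocycles2 L)" and B: "vsubspace (cocycles2 L) (coboundaries2 L)"
    and S: "S \<subseteq> vcarrier (cocycles2 L)"
    and gen: "\<And>W. vsubspace (cocycles2 L) W \<Longrightarrow> S \<subseteq> W \<Longrightarrow> coboundaries2 L \<subseteq> W \<Longrightarrow> vcarrier (cocycles2 L) \<subseteq> W"
  shows "H2_spanned_by L S"
proof -
  interpret Z: vspace "cocycles2 L" by fact
  interpret H: vspace "H2 L" unfolding H2_def by (rule Z.vspace_vquot[OF B])
  have car: "vcarrier (H2 L) = cohomology_class L ` vcarrier (cocycles2 L)"
    by (simp add: H2_def Z.vquot_carrier cohomology_class_def[abs_def])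
  have SH: "cohomology_class L ` S \<subseteq> vcarrier (H2 L)" using S car by auto
  let ?U = "vspan (H2 L) (cohomology_class L ` S)"
  have U: "vsubspace (H2 L) ?U" by (rule H.vspan_subspace[OF SH])
  let ?W = "{c \<in> vcarrier (cocycles2 L). cohomology_class L c \<in> ?U}"
  have zero: "cohomology_class L c = vzero (H2 L)" if "c \<in> coboundaries2 L" for c
    using that vsubspaceD(1)[OF B] Z.vcoset_eq_zero_iff[OF B, of c]
    by (auto simp: cohomology_class_def H2_def Z.vquot_zero)
  have "vsubspace (cocycles2 L) ?W"
    unfolding vsubspace_def
  proof (intro conjI ballI allI)
    show "vzero (cocycles2 L) \<in> ?W"
      using zero[OF vsubspaceD(2)[OF B]] vsubspaceD(2)[OF U] Z.zero_in by simp
  next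
    fix c d assume cd: "c \<in> ?W" "d \<in> ?W"
    then have "cohomology_class L (vadd (cocycles2 L) c d) = vadd (H2 L) (cohomology_class L c) (cohomology_class L d)"
      unfolding cohomology_class_def H2_def by (intro Z.vquot_add[OF B, symmetric]) auto
    then show "vadd (cocycles2 L) c d \<in> ?W"
      using cd Z.add_in vsubspaceD(3)[OF U] by simp
  next
    fix a c assume c: "c \<in> ?W"
    then have "cohomology_class L (vscale (cocycles2 L) a c) = vscale (H2 L) a (cohomology_class L c)"
      unfolding cohomology_class_def H2_def by (intro Z.vquot_scale[OF B, symmetric]) auto
    then show "vscale (cocycles2 L) a c \<in> ?W"
      using c Z.scale_in vsubspaceD(4)[OF U] by simp
  qed auto
  moreover have "S \<subseteq> ?W" using S vspan_superset[of "cohomology_class L ` S" "H2 L"] by auto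
  moreover have "coboundaries2 L \<subseteq> ?W"
    using zero vsubspaceD(1)[OF B] vsubspaceD(2)[OF U] by auto
  ultimately have "vcarrier (cocycles2 L) \<subseteq> ?W" by (rule gen)
  then have "vcarrier (H2 L) \<subseteq> ?U" using car by auto
  then show ?thesis
    unfolding H2_spanned_by_def using S H.vspan_carrier[OF SH] by auto
qed

section \<open>Lie algebras with a basis and structure constants\<close>

locale based_lie = params \<alpha> + lie_algebra L for \<alpha> :: "'k::field" and L :: "('k, 'v) lie" +
  fixes I :: "idx list" and br :: table and b :: "label \<Rightarrow> 'v" and \<phi> :: "'v \<Rightarrow> idx \<Rightarrow> 'k"
  assumes hom: "coord_hom L (sc \<alpha> br) \<phi>"
    and inj: "inj_on \<phi> (vcarrier L)"
    and supp: "u \<in> vcarrier L \<Longrightarrow> i \<notin> set I \<Longrightarrow> \<phi> u i = 0"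
    and basis: "i \<in> set I \<Longrightarrow> b (idx_label i) \<in> vcarrier L" "i \<in> set I \<Longrightarrow> \<phi> (b (idx_label i)) = unit_vec i"
    and table: "table_ok br I"
begin

abbreviation "e i \<equiv> b (idx_label i)"
abbreviation "S \<equiv> sc \<alpha> br"
abbreviation "lab \<equiv> idx_label ` set I"

lemmas e_in [simp] = basis(1) and \<phi>_e [simp] = basis(2)

lemma \<phi>_simps [simp]:
  "\<phi> (vzero L) k = 0"
  "u \<in> vcarrier L \<Longrightarrow> v \<in> vcarrier L \<Longrightarrow> \<phi> (vadd L u v) k = \<phi> u k + \<phi> v k"
  "u \<in> vcarrier L \<Longrightarrow> \<phi> (vscale L a u) k = a * \<phi> u k"
  "u \<in> vcarrier L \<Longrightarrow> \<phi> (vneg L u) k = \<phi> u k"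
  using coord_homD[OF hom] coord_hom_zero[OF vspace_axioms hom] by (simp_all add: vneg_def)

lemma \<phi>_bracket: "u \<in> vcarrier L \<Longrightarrow> v \<in> vcarrier L \<Longrightarrow> \<phi> (bracket L u v) k = sc_bracket S (\<phi> u) (\<phi> v) k"
  using coord_homD(3)[OF hom] by simp

lemma eqI: "u \<in> vcarrier L \<Longrightarrow> v \<in> vcarrier L \<Longrightarrow> (\<And>k. \<phi> u k = \<phi> v k) \<Longrightarrow> u = v"
  using inj by (auto simp: inj_on_def fun_eq_iff)

lemma vneg_in [simp]: "u \<in> vcarrier L \<Longrightarrow> vneg L u \<in> vcarrier L"
  by (simp add: vneg_def)

lemma span_support:
  assumes "finite A" "vsubspace L U" "\<And>i. i \<in> A \<Longrightarrow> i \<in> set I \<Longrightarrow> e i \<in> U"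
    and "u \<in> vcarrier L" "\<And>i. \<phi> u i \<noteq> 0 \<Longrightarrow> i \<in> A"
  shows "u \<in> U"
  using assms
proof (induction A arbitrary: u rule: finite_induct)
  case empty
  then have "u = vzero L" by (intro eqI) auto
  then show ?case using vsubspaceD(2)[OF empty(1)] by simp
next
  case (insert a A)
  show ?case
  proof (cases "a \<in> set I")
    case True
    let ?v = "vscale L (\<phi> u a) (e a)"
    have v: "?v \<in> vcarrier L" using True by simp
    have "vsub u ?v \<in> U"
    proof (rule insert.IH[OF insert.prems(1)])
      fix i assume "\<phi> (vsub u ?v) i \<noteq> 0"
      then have "\<phi> u i + \<phi> u a * unit_vec a i \<noteq> 0" using insert.prems(3) v True by simp
      then show "i \<in> A" using insert.prems(4)[of i] by (auto simp: unit_vec_def split: if_splits)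
    qed (use insert.prems v in auto)
    moreover have "?v \<in> U" using insert.prems(1,2) True by (auto intro: vsubspaceD(4))
    ultimately have "vadd L ?v (vsub u ?v) \<in> U" using vsubspaceD(3)[OF insert.prems(1)] by blast
    then show ?thesis using add_sub_cancel[OF insert.prems(3) v] by simp
  next
    case False
    then have "\<phi> u i \<noteq> 0 \<Longrightarrow> i \<in> A" for i using insert.prems(4)[of i] supp[OF insert.prems(3)] by auto
    then show ?thesis using insert.IH insert.prems by blast
  qed
qed

lemma span_all: "vsubspace L U \<Longrightarrow> (\<And>i. i \<in> set I \<Longrightarrow> e i \<in> U) \<Longrightarrow> u \<in> vcarrier L \<Longrightarrow> u \<in> U"
  by (rule span_support[of UNIV U u]) auto

definition linear_form :: "('v \<Rightarrow> 'k) \<Rightarrow> bool" where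
  "linear_form F \<longleftrightarrow> (\<forall>u\<in>vcarrier L. \<forall>v\<in>vcarrier L. F (vadd L u v) = F u + F v) \<and>
     (\<forall>a. \<forall>u\<in>vcarrier L. F (vscale L a u) = a * F u)"

lemma linear_form_zero:
  assumes F: "linear_form F" and 0: "\<And>i. i \<in> set I \<Longrightarrow> F (e i) = 0" and u: "u \<in> vcarrier L"
  shows "F u = 0"
proof -
  have "F (vzero L) = 0" using F[unfolded linear_form_def] scale_zero[OF zero_in] by (metis mult_zero_left zero_in)
  then have "vsubspace L {u \<in> vcarrier L. F u = 0}"
    using F by (auto simp: vsubspace_def linear_form_def)
  from span_all[OF this] show ?thesis using 0 u by auto
qed

lemma linear_form_expand:
  assumes F: "linear_form F" and u: "u \<in> vcarrier L"
  shows "F u = (\<Sum>l\<in>UNIV. \<phi> u l * (if l \<in> set I then F (e l) else 0))"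
proof -
  let ?G = "\<lambda>u. F u + (\<Sum>l\<in>UNIV. \<phi> u l * (if l \<in> set I then F (e l) else 0))"
  have "?G u = 0"
  proof (rule linear_form_zero[OF _ _ u])
    show "linear_form ?G"
      using F by (auto simp: linear_form_def algebra_simps sum.distrib sum_distrib_left)
    fix i assume i: "i \<in> set I"
    have "(\<Sum>l\<in>UNIV. \<phi> (e i) l * (if l \<in> set I then F (e l) else 0)) = (\<Sum>l\<in>UNIV. if l = i then F (e i) else 0)"
      using i by (intro sum.cong) (auto simp: unit_vec_def)
    then show "?G (e i) = 0" by simp
  qed
  then show ?thesis by simp
qed

lemma linear_form_coord: "vlinear L L f \<Longrightarrow> linear_form (\<lambda>u. \<phi> (f u) k)"
  by (auto simp: linear_form_def vlinear_def Pi_iff)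

lemma vlinear_in: "vlinear L W f \<Longrightarrow> u \<in> vcarrier L \<Longrightarrow> f u \<in> vcarrier W"
  by (auto simp: vlinear_def)

theorem vbasis_e: "vbasis L lab b"
  unfolding vbasis_def
proof (intro conjI ballI)
  show im: "b ` lab \<subseteq> vcarrier L" by auto
  show "vspan L (b ` lab) = vcarrier L"
  proof (rule equalityI)
    show "vspan L (b ` lab) \<subseteq> vcarrier L" by (rule vspan_carrier[OF im])
    show "vcarrier L \<subseteq> vspan L (b ` lab)"
      using span_all[OF vspan_subspace[OF im]] vspan_superset[of "b ` lab" L] by blast
  qed
  fix l assume "l \<in> lab"
  then obtain i where i: "i \<in> set I" "l = idx_label i" by auto
  have "vspan L (b ` (lab - {l})) \<subseteq> {u \<in> vcarrier L. \<phi> u i = 0}"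
    using i by (intro vspan_least) (auto simp: vsubspace_def idx_label_inj unit_vec_def)
  then show "b l \<notin> vspan L (b ` (lab - {l}))" using i by (auto simp: unit_vec_def)
qed

lemma dual_vec_e:
  assumes i: "i \<in> set I" and u: "u \<in> vcarrier L"
  shows "dual_vec L lab b (idx_label i) u = \<phi> u i"
proof -
  let ?f = "restrict (\<lambda>u. \<phi> u i) (vcarrier L)"
  have "dual_vec L lab b (idx_label i) = ?f"
    unfolding dual_vec_def
  proof (rule the_equality)
    show "?f \<in> extensional (vcarrier L) \<and> vlinear L scalars ?f \<and>
      (\<forall>j\<in>lab. ?f (b j) = (if j = idx_label i then 1 else 0))"
      using i by (auto simp: vlinear_def scalars_def idx_label_inj unit_vec_def)
    fix g assume g: "g \<in> extensional (vcarrier L) \<and> vlinear L scalars g \<and>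
      (\<forall>j\<in>lab. g (b j) = (if j = idx_label i then 1 else 0))"
    show "g = ?f"
    proof (rule extensionalityI[of _ "vcarrier L"])
      fix u assume u: "u \<in> vcarrier L"
      have "linear_form (\<lambda>u. g u + \<phi> u i)"
        using g by (auto simp: linear_form_def vlinear_def scalars_def algebra_simps)
      then have "g u + \<phi> u i = 0"
        using g by (rule_tac linear_form_zero) (auto simp: u unit_vec_def idx_label_inj)
      then show "g u = ?f u" using u by simp
    qed (use g in auto)
  qed
  then show ?thesis using u by simp
qed

text \<open>Cochains in coordinates.\<close>

lemma cochains2_iff:
  "c \<in> vcarrier (cochains2 L) \<longleftrightarrow> c \<in> extensional (vcarrier L \<times> vcarrier L) \<and>
     (\<forall>x\<in>vcarrier L. vlinear L L (\<lambda>y. c (x, y))) \<and> (\<forall>y\<in>vcarrier L. vlinear L L (\<lambda>x. c (x, y))) \<and>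
     (\<forall>x\<in>vcarrier L. c (x, x) = vzero L)"
  by (simp add: cochains2_def Let_def)

lemma cochain_in [simp]:
  "c \<in> vcarrier (cochains2 L) \<Longrightarrow> x \<in> vcarrier L \<Longrightarrow> y \<in> vcarrier L \<Longrightarrow> c (x, y) \<in> vcarrier L"
  using vlinear_in[of L "\<lambda>y. c (x, y)" y] by (auto simp: cochains2_iff)

lemma cochain_form:
  assumes "c \<in> vcarrier (cochains2 L)" "x \<in> vcarrier L"
  shows "linear_form (\<lambda>y. \<phi> (c (x, y)) k)" "linear_form (\<lambda>y. \<phi> (c (y, x)) k)"
  using assms linear_form_coord by (auto simp: cochains2_iff)

lemma cochain_sym:
  assumes c: "c \<in> vcarrier (cochains2 L)" and x: "x \<in> vcarrier L" and y: "y \<in> vcarrier L"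
  shows "\<phi> (c (x, y)) k = \<phi> (c (y, x)) k"
proof -
  have xy: "vadd L x y \<in> vcarrier L" using x y by simp
  have "0 = \<phi> (c (vadd L x y, vadd L x y)) k" using c xy by (simp add: cochains2_iff)
  also have "\<dots> = \<phi> (c (x, vadd L x y)) k + \<phi> (c (y, vadd L x y)) k"
    using cochain_form(2)[OF c xy, of k] x y by (simp add: linear_form_def)
  also have "\<dots> = \<phi> (c (x, y)) k + \<phi> (c (y, x)) k"
    using cochain_form(1)[OF c x, of k] cochain_form(1)[OF c y, of k] c x y
    by (simp add: linear_form_def cochains2_iff)
  finally show ?thesis by simp
qed

lemma vspace_cochains2: "vspace (cochains2 L)"
proof
  fix c d and a :: 'k assume c: "c \<in> vcarrier (cochains2 L)" and d: "d \<in> vcarrier (cochains2 L)"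
  have lin: "vlinear L L (\<lambda>y. if y \<in> vcarrier L then vadd L (f y) (g y) else undefined)"
    if "vlinear L L f" "vlinear L L g" for f g
    using that vlinear_in[OF that(1)] vlinear_in[OF that(2)]
    by (auto simp: vlinear_def scale_add add_assoc add_left_commute)
  show "vadd (cochains2 L) c d \<in> vcarrier (cochains2 L)"
    using c d lin by (auto simp: cochains2_iff cochains2_simps restrict_def extensional_def)
next
  fix c and a :: 'k assume c: "c \<in> vcarrier (cochains2 L)"
  have lin: "vlinear L L (\<lambda>y. if y \<in> vcarrier L then vscale L a (f y) else undefined)"
    if "vlinear L L f" for f
    using that vlinear_in[OF that(1)]
    by (auto simp: vlinear_def scale_add scale_scale mult.commute)
  show "vscale (cochains2 L) a c \<in> vcarrier (cochains2 L)"
    using c lin by (auto simp: cochains2_iff cochains2_simps restrict_def extensional_def)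
next
  have lin: "vlinear L L (\<lambda>y. if y \<in> vcarrier L then vzero L else undefined)"
    by (auto simp: vlinear_def)
  then show "vzero (cochains2 L) \<in> vcarrier (cochains2 L)"
    by (auto simp: cochains2_iff cochains2_simps restrict_def extensional_def)
qed (auto simp: cochains2_simps restrict_def fun_eq_iff add_assoc scale_add add_scale scale_scale add_commute add_left_commute
    cochains2_iff extensional_def)

lemma \<phi>_cochain_ops [simp]:
  assumes "x \<in> vcarrier L" "y \<in> vcarrier L"
  shows "c \<in> vcarrier (cochains2 L) \<Longrightarrow> d \<in> vcarrier (cochains2 L) \<Longrightarrow>
      \<phi> (vadd (cochains2 L) c d (x, y)) k = \<phi> (c (x, y)) k + \<phi> (d (x, y)) k"
    and "c \<in> vcarrier (cochains2 L) \<Longrightarrow> \<phi> (vscale (cochains2 L) a c (x, y)) k = a * \<phi> (c (x, y)) k"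
    and "\<phi> (vzero (cochains2 L) (x, y)) k = 0"
  using assms by (simp_all add: cochains2_simps)

lemma cochain_eqI:
  assumes c: "c \<in> vcarrier (cochains2 L)" and d: "d \<in> vcarrier (cochains2 L)"
    and eq: "\<And>u v w. v \<in> set I \<Longrightarrow> w \<in> set I \<Longrightarrow> \<phi> (c (e v, e w)) u = \<phi> (d (e v, e w)) u"
  shows "c = d"
proof -
  have lin: "linear_form (\<lambda>y. F y + G y)" if "linear_form F" "linear_form G" for F G
    using that by (auto simp: linear_form_def algebra_simps)
  have 1: "\<phi> (c (e v, y)) u + \<phi> (d (e v, y)) u = 0" if "v \<in> set I" "y \<in> vcarrier L" for u v y
    by (rule linear_form_zero[OF lin[OF cochain_form(1)[OF c] cochain_form(1)[OF d]]]) (use that eq in auto)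
  have 2: "\<phi> (c (x, y)) u + \<phi> (d (x, y)) u = 0" if "x \<in> vcarrier L" "y \<in> vcarrier L" for u x y
    by (rule linear_form_zero[OF lin[OF cochain_form(2)[OF c] cochain_form(2)[OF d]]]) (use that 1 in auto)
  show ?thesis
  proof (rule extensionalityI[of _ "vcarrier L \<times> vcarrier L"])
    fix p assume "p \<in> vcarrier L \<times> vcarrier L"
    then obtain x y where p: "p = (x, y)" "x \<in> vcarrier L" "y \<in> vcarrier L" by auto
    then show "c p = d p" using 2 c d by (auto intro!: eqI)
  qed (use c d in \<open>auto simp: cochains2_iff\<close>)
qed

text \<open>Only the basis elements matter for the cocycle condition.\<close>

lemma \<phi>_coboundary2:
  assumes c: "c \<in> vcarrier (cochains2 L)" and "x \<in> vcarrier L" "y \<in> vcarrier L" "z \<in> vcarrier L"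
  shows "\<phi> (coboundary2 L c x y z) u =
    \<phi> (bracket L x (c (y, z))) u + \<phi> (bracket L y (c (x, z))) u + \<phi> (bracket L z (c (x, y))) u +
    \<phi> (c (bracket L x y, z)) u + \<phi> (c (bracket L x z, y)) u + \<phi> (c (bracket L y z, x)) u"
  using assms by (simp add: coboundary2_def vsum_def add.assoc)

lemma coboundary2_in:
  "c \<in> vcarrier (cochains2 L) \<Longrightarrow> x \<in> vcarrier L \<Longrightarrow> y \<in> vcarrier L \<Longrightarrow> z \<in> vcarrier L \<Longrightarrow>
    coboundary2 L c x y z \<in> vcarrier L"
  by (simp add: coboundary2_def vsum_def)

lemma cocycles2_iff:
  "c \<in> vcarrier (cocycles2 L) \<longleftrightarrow> c \<in> vcarrier (cochains2 L) \<and>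
    (\<forall>x\<in>vcarrier L. \<forall>y\<in>vcarrier L. \<forall>z\<in>vcarrier L. \<forall>u. \<phi> (coboundary2 L c x y z) u = 0)"
proof -
  have "coboundary2 L c x y z = vzero L \<longleftrightarrow> (\<forall>u. \<phi> (coboundary2 L c x y z) u = 0)"
    if "c \<in> vcarrier (cochains2 L)" "x \<in> vcarrier L" "y \<in> vcarrier L" "z \<in> vcarrier L" for x y z
    using coboundary2_in[OF that] by (auto intro: eqI)
  then show ?thesis by (auto simp: cocycles2_def)
qed

lemma vlinear_ops:
  assumes "vlinear L L f" "u \<in> vcarrier L"
  shows "v \<in> vcarrier L \<Longrightarrow> f (vadd L u v) = vadd L (f u) (f v)" "f (vscale L a u) = vscale L a (f u)"
  using assms by (auto simp: vlinear_def)

lemma cochain_add: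
  assumes c: "c \<in> vcarrier (cochains2 L)" and x: "x \<in> vcarrier L" and y: "y \<in> vcarrier L" and z: "z \<in> vcarrier L"
  shows "c (x, vadd L y z) = vadd L (c (x, y)) (c (x, z))" "c (vadd L y z, x) = vadd L (c (y, x)) (c (z, x))"
    "c (x, vscale L a y) = vscale L a (c (x, y))" "c (vscale L a y, x) = vscale L a (c (y, x))"
proof -
  have l: "vlinear L L (\<lambda>y. c (x, y))" "vlinear L L (\<lambda>y. c (y, x))"
    using c x by (simp_all add: cochains2_iff)
  show "c (x, vadd L y z) = vadd L (c (x, y)) (c (x, z))" "c (vadd L y z, x) = vadd L (c (y, x)) (c (z, x))"
    "c (x, vscale L a y) = vscale L a (c (x, y))" "c (vscale L a y, x) = vscale L a (c (y, x))"
    using vlinear_ops[OF l(1) y] vlinear_ops[OF l(2) y] z by simp_all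
qed

lemma coboundary2_form:
  assumes c: "c \<in> vcarrier (cochains2 L)" and x: "x \<in> vcarrier L" and y: "y \<in> vcarrier L"
  shows "linear_form (\<lambda>z. \<phi> (coboundary2 L c x y z) u)"
    "linear_form (\<lambda>z. \<phi> (coboundary2 L c x z y) u)" "linear_form (\<lambda>z. \<phi> (coboundary2 L c z x y) u)"
  using c x y
  by (auto simp: linear_form_def \<phi>_coboundary2 cochain_add bracket_add_left bracket_add_right
      bracket_scale_left bracket_scale_right algebra_simps)

definition arr :: "('v \<times> 'v \<Rightarrow> 'v) \<Rightarrow> idx \<Rightarrow> idx \<Rightarrow> idx \<Rightarrow> 'k" where
  "arr c u v w = (if v \<in> set I \<and> w \<in> set I then \<phi> (c (e v, e w)) u else 0)"

lemma \<phi>_coboundary2_basis: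
  assumes c: "c \<in> vcarrier (cochains2 L)" and ijk: "i \<in> set I" "j \<in> set I" "k \<in> set I"
  shows "\<phi> (coboundary2 L c (e i) (e j) (e k)) u = cocycle_sum br (arr c) i j k u"
proof -
  have 1: "\<phi> (bracket L (e i) (c (e j, e k))) u = (\<Sum>l\<in>UNIV. arr c l j k * S i l u)"
    if "i \<in> set I" "j \<in> set I" "k \<in> set I" for i j k
    using that c by (simp add: \<phi>_bracket sc_bracket_unit_left arr_def)
  have 2: "\<phi> (c (bracket L (e i) (e j), e k)) u = (\<Sum>l\<in>UNIV. S i j l * arr c u l k)"
    if "i \<in> set I" "j \<in> set I" "k \<in> set I" for i j k
    using linear_form_expand[OF cochain_form(2)[OF c e_in[OF that(3)]], of "bracket L (e i) (e j)" u] that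
    by (simp add: \<phi>_bracket sc_bracket_unit arr_def if_distrib cong: if_cong)
  show ?thesis using ijk c by (simp add: \<phi>_coboundary2 1 2 cocycle_sum_def)
qed

lemma cocycle_iff_arr:
  "c \<in> vcarrier (cocycles2 L) \<longleftrightarrow> c \<in> vcarrier (cochains2 L) \<and>
     (\<forall>i\<in>set I. \<forall>j\<in>set I. \<forall>k\<in>set I. \<forall>u. cocycle_sum br (arr c) i j k u = 0)" (is "_ \<longleftrightarrow> ?R")
proof
  assume "c \<in> vcarrier (cocycles2 L)"
  then show ?R using \<phi>_coboundary2_basis[symmetric] by (auto simp: cocycles2_iff)
next
  assume R: ?R
  then have c: "c \<in> vcarrier (cochains2 L)" by blast
  have 1: "\<phi> (coboundary2 L c (e i) (e j) z) u = 0" if "i \<in> set I" "j \<in> set I" "z \<in> vcarrier L" for i j z u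
    by (rule linear_form_zero[OF coboundary2_form(1)[OF c]]) (use R \<phi>_coboundary2_basis[OF c] that in auto)
  have 2: "\<phi> (coboundary2 L c (e i) y z) u = 0" if "i \<in> set I" "y \<in> vcarrier L" "z \<in> vcarrier L" for i y z u
    by (rule linear_form_zero[OF coboundary2_form(2)[OF c]]) (use 1 that in auto)
  have "\<phi> (coboundary2 L c x y z) u = 0" if "x \<in> vcarrier L" "y \<in> vcarrier L" "z \<in> vcarrier L" for x y z u
    by (rule linear_form_zero[OF coboundary2_form(3)[OF c]]) (use 2 that in auto)
  then show "c \<in> vcarrier (cocycles2 L)" using c by (simp add: cocycles2_iff)
qed

lemma vspace_cocycles2: "vspace (cocycles2 L)"
proof -
  interpret C: vspace "cochains2 L" by (rule vspace_cochains2)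
  have arr_ops: "arr (vadd (cochains2 L) c d) = (\<lambda>u v w. arr c u v w + arr d u v w)"
    "arr (vscale (cochains2 L) a c) = (\<lambda>u v w. a * arr c u v w)" "arr (vzero (cochains2 L)) = (\<lambda>u v w. 0)"
    if "c \<in> vcarrier (cochains2 L)" "d \<in> vcarrier (cochains2 L)" for c d a
    using that by (auto simp: arr_def fun_eq_iff)
  have cs: "cocycle_sum br (\<lambda>u v w. C u v w + D u v w) i j k u = cocycle_sum br C i j k u + cocycle_sum br D i j k u"
    "cocycle_sum br (\<lambda>u v w. a * C u v w) i j k u = a * cocycle_sum br C i j k u"
    "cocycle_sum br (\<lambda>u v w. 0) i j k u = 0" for C D a i j k u
    by (simp_all add: cocycle_sum_def algebra_simps sum.distrib sum_distrib_left)
  have sub: "vcarrier (cocycles2 L) \<subseteq> vcarrier (cochains2 L)" by (auto simp: cocycle_iff_arr)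
  show ?thesis
    by unfold_locales
      (use sub arr_ops(3)[OF C.zero_in C.zero_in] in \<open>auto simp: cocycle_iff_arr arr_ops cs C.add_assoc C.scale_add C.add_scale C.scale_scale C.add_commute C.add_left_commute\<close>)
qed


text \<open>Coboundaries are cocycles by the Jacobi identity.\<close>

lemma \<phi>_coboundary1:
  assumes f: "vlinear L L f" and x: "x \<in> vcarrier L" and y: "y \<in> vcarrier L"
  shows "\<phi> (coboundary1 L f (x, y)) u =
    \<phi> (bracket L x (f y)) u + \<phi> (bracket L y (f x)) u + \<phi> (f (bracket L x y)) u"
  using x y vlinear_in[OF f] by (simp add: coboundary1_def vsum_def add.assoc)

lemma vlinearI:
  assumes "\<And>u. u \<in> vcarrier L \<Longrightarrow> f u \<in> vcarrier L"
    and "\<And>k. linear_form (\<lambda>u. \<phi> (f u) k)"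
  shows "vlinear L L f"
  using assms by (auto simp: vlinear_def linear_form_def intro!: eqI)

lemma coboundary1_in:
  assumes f: "vlinear L L f" shows "coboundary1 L f \<in> vcarrier (cochains2 L)"
proof -
  note fin = vlinear_in[OF f]
  have car: "coboundary1 L f (x, y) \<in> vcarrier L" if "x \<in> vcarrier L" "y \<in> vcarrier L" for x y
    using that fin by (simp add: coboundary1_def vsum_def)
  have f0: "f (vzero L) = vzero L" using vlinear_ops(2)[OF f zero_in, of 0] fin by simp
  show ?thesis
    unfolding cochains2_iff
  proof (intro conjI ballI)
    show "coboundary1 L f \<in> extensional (vcarrier L \<times> vcarrier L)"
      by (simp add: coboundary1_def)
    fix x assume x: "x \<in> vcarrier L"
    show "vlinear L L (\<lambda>y. coboundary1 L f (x, y))" "vlinear L L (\<lambda>y. coboundary1 L f (y, x))"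
      using x fin car
      by (auto intro!: vlinearI simp: linear_form_def \<phi>_coboundary1[OF f] vlinear_ops[OF f] bracket_add_left
          bracket_add_right bracket_scale_left bracket_scale_right algebra_simps)
    show "coboundary1 L f (x, x) = vzero L"
      using x fin car f0 by (intro eqI) (auto simp: \<phi>_coboundary1[OF f])
  qed
qed

lemma \<phi>_jacobi:
  assumes "x \<in> vcarrier L" "y \<in> vcarrier L" "z \<in> vcarrier L"
  shows "\<phi> (bracket L x (bracket L y z)) k = \<phi> (bracket L y (bracket L x z)) k + \<phi> (bracket L (bracket L x y) z) k"
proof -
  have "\<phi> (vadd L (vadd L (bracket L x (bracket L y z)) (bracket L y (bracket L z x))) (bracket L z (bracket L x y))) k = 0"
    using jacobi[OF assms] by simp
  moreover have "\<phi> (bracket L y (bracket L z x)) k = \<phi> (bracket L y (bracket L x z)) k"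
    using assms bracket_skew[of x z] by (simp add: bracket_scale_right)
  moreover have "\<phi> (bracket L z (bracket L x y)) k = \<phi> (bracket L (bracket L x y) z) k"
    using assms bracket_skew[of "bracket L x y" z] by simp
  ultimately show ?thesis using assms by (simp add: shift)
qed

lemma \<phi>_bracket_commute: "x \<in> vcarrier L \<Longrightarrow> y \<in> vcarrier L \<Longrightarrow> \<phi> (bracket L x y) k = \<phi> (bracket L y x) k"
  using bracket_skew[of x y] by simp

lemma coboundary_cocycle:
  assumes f: "vlinear L L f" shows "coboundary1 L f \<in> vcarrier (cocycles2 L)"
  unfolding cocycles2_iff
proof (intro conjI ballI allI)
  let ?c = "coboundary1 L f"
  show c: "?c \<in> vcarrier (cochains2 L)" by (rule coboundary1_in[OF f])
  note fin = vlinear_in[OF f]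
  fix x y z u assume xyz: "x \<in> vcarrier L" "y \<in> vcarrier L" "z \<in> vcarrier L"
  have B: "\<phi> (bracket L x (?c (y, z))) u = \<phi> (bracket L x (bracket L y (f z))) u +
      \<phi> (bracket L x (bracket L z (f y))) u + \<phi> (bracket L x (f (bracket L y z))) u"
    if "x \<in> vcarrier L" "y \<in> vcarrier L" "z \<in> vcarrier L" for x y z
  proof -
    have "?c (y, z) = vadd L (vadd L (bracket L y (f z)) (bracket L z (f y))) (f (bracket L y z))"
      using that fin c by (intro eqI) (auto simp: \<phi>_coboundary1[OF f])
    then show ?thesis using that fin by (simp add: bracket_add_right)
  qed
  have C: "\<phi> (?c (bracket L x y, z)) u = \<phi> (bracket L (bracket L x y) (f z)) u +
      \<phi> (bracket L z (f (bracket L x y))) u + \<phi> (f (bracket L (bracket L x y) z)) u"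
    if "x \<in> vcarrier L" "y \<in> vcarrier L" "z \<in> vcarrier L" for x y z
    using that by (simp add: \<phi>_coboundary1[OF f])
  have J: "\<phi> (bracket L x (bracket L y (f z))) u =
      \<phi> (bracket L y (bracket L x (f z))) u + \<phi> (bracket L (bracket L x y) (f z)) u"
    if "x \<in> vcarrier L" "y \<in> vcarrier L" "z \<in> vcarrier L" for x y z
    using that fin by (intro \<phi>_jacobi) auto
  have "f (bracket L (bracket L x y) z) = vadd L (f (bracket L (bracket L x z) y)) (f (bracket L (bracket L y z) x))"
  proof -
    have "bracket L (bracket L x y) z = vadd L (bracket L (bracket L x z) y) (bracket L (bracket L y z) x)"
      using xyz \<phi>_jacobi[of x y z] \<phi>_bracket_commute[of x "bracket L y z"] \<phi>_bracket_commute[of y "bracket L x z"]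
      by (intro eqI) (auto simp: add.commute)
    then show ?thesis using xyz vlinear_ops[OF f] by simp
  qed
  then have F: "\<phi> (f (bracket L (bracket L x y) z)) u =
      \<phi> (f (bracket L (bracket L x z) y)) u + \<phi> (f (bracket L (bracket L y z) x)) u"
    using xyz fin by simp
  show "\<phi> (coboundary2 L ?c x y z) u = 0"
    unfolding \<phi>_coboundary2[OF c xyz] B[OF xyz] B[OF xyz(2,1,3)] B[OF xyz(3,1,2)] C[OF xyz] C[OF xyz(1,3,2)]
      C[OF xyz(2,3,1)] F J[OF xyz] J[OF xyz(1,3,2)] J[OF xyz(2,3,1)]
    by (simp add: add.left_commute add.commute add.assoc)
qed

lemma coboundaries_subspace: "vsubspace (cocycles2 L) (coboundaries2 L)"
  unfolding vsubspace_def
proof (intro conjI ballI allI)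
  show "coboundaries2 L \<subseteq> vcarrier (cocycles2 L)"
    using coboundary_cocycle by (auto simp: coboundaries2_def cochains1_def)
  interpret C: vspace "cochains2 L" by (rule vspace_cochains2)
  have zero: "vlinear L L (\<lambda>u\<in>vcarrier L. vzero L)"
    by (intro vlinearI) (auto simp: linear_form_def)
  have "coboundary1 L (\<lambda>u\<in>vcarrier L. vzero L) = vzero (cochains2 L)"
    using coboundary1_in[OF zero] by (intro cochain_eqI) (auto simp: \<phi>_coboundary1[OF zero])
  then show "vzero (cocycles2 L) \<in> coboundaries2 L"
    using zero by (auto simp: coboundaries2_def cochains1_def intro!: image_eqI[OF sym])
next
  interpret C: vspace "cochains2 L" by (rule vspace_cochains2)
  fix c d assume "c \<in> coboundaries2 L" "d \<in> coboundaries2 L"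
  then obtain f g where f: "vlinear L L f" "c = coboundary1 L f" and g: "vlinear L L g" "d = coboundary1 L g"
    by (auto simp: coboundaries2_def cochains1_def)
  let ?h = "\<lambda>u\<in>vcarrier L. vadd L (f u) (g u)"
  note fin = vlinear_in[OF f(1)] vlinear_in[OF g(1)]
  have h: "vlinear L L ?h"
    using fin by (intro vlinearI) (auto simp: linear_form_def vlinear_ops[OF f(1)] vlinear_ops[OF g(1)] algebra_simps)
  have "vadd (cochains2 L) c d = coboundary1 L ?h"
    using coboundary1_in[OF h] coboundary1_in[OF f(1)] coboundary1_in[OF g(1)] fin
    by (intro cochain_eqI) (auto simp: f(2) g(2) \<phi>_coboundary1[OF h] \<phi>_coboundary1[OF f(1)] \<phi>_coboundary1[OF g(1)]
        bracket_add_right add.left_commute add.commute add.assoc)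
  then show "vadd (cocycles2 L) c d \<in> coboundaries2 L"
    using h by (auto simp: coboundaries2_def cochains1_def)
next
  interpret C: vspace "cochains2 L" by (rule vspace_cochains2)
  fix a c assume "c \<in> coboundaries2 L"
  then obtain f where f: "vlinear L L f" "c = coboundary1 L f"
    by (auto simp: coboundaries2_def cochains1_def)
  let ?h = "\<lambda>u\<in>vcarrier L. vscale L a (f u)"
  note fin = vlinear_in[OF f(1)]
  have h: "vlinear L L ?h"
    using fin by (intro vlinearI) (auto simp: linear_form_def vlinear_ops[OF f(1)] algebra_simps)
  have "vscale (cochains2 L) a c = coboundary1 L ?h"
    using coboundary1_in[OF h] coboundary1_in[OF f(1)] fin
    by (intro cochain_eqI) (auto simp: f(2) \<phi>_coboundary1[OF h] \<phi>_coboundary1[OF f(1)]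
        bracket_scale_right algebra_simps)
  then show "vscale (cocycles2 L) a c \<in> coboundaries2 L"
    using h by (auto simp: coboundaries2_def cochains1_def)
qed

text \<open>The cochains given by expressions.\<close>

definition lab_cochain :: "expr \<Rightarrow> 'v \<times> 'v \<Rightarrow> 'v" where
  "lab_cochain ts = cochain L lab b (map (term_of_entry \<alpha>) ts)"

definition indices_in :: "expr \<Rightarrow> bool" where
  "indices_in ts \<longleftrightarrow> (\<forall>(a, u, v, w)\<in>set ts. u \<in> set I \<and> v \<in> set I \<and> w \<in> set I)"

lemma elementary_in:
  assumes u: "u \<in> set I" and v: "v \<in> set I" and w: "w \<in> set I"
  shows "elementary_cochain L lab b (idx_label u) (idx_label v) (idx_label w) \<in> vcarrier (cochains2 L)" (is "?c \<in> _")
    and "x \<in> vcarrier L \<Longrightarrow> y \<in> vcarrier L \<Longrightarrow>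
      \<phi> (elementary_cochain L lab b (idx_label u) (idx_label v) (idx_label w) (x, y)) k =
        (\<phi> x v * \<phi> y w + \<phi> y v * \<phi> x w) * unit_vec u k"
proof -
  have c: "?c (x, y) = vscale L (\<phi> x v * \<phi> y w + \<phi> y v * \<phi> x w) (e u)" if "x \<in> vcarrier L" "y \<in> vcarrier L" for x y
    using that u v w by (simp add: elementary_cochain_def dual_vec_e)
  show "?c \<in> vcarrier (cochains2 L)"
    unfolding cochains2_iff
  proof (intro conjI ballI)
    show "?c \<in> extensional (vcarrier L \<times> vcarrier L)" by (simp add: elementary_cochain_def)
    fix x assume x: "x \<in> vcarrier L"
    show "vlinear L L (\<lambda>y. ?c (x, y))" "vlinear L L (\<lambda>y. ?c (y, x))"
      using x u by (auto intro!: vlinearI simp: linear_form_def c algebra_simps)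
    show "?c (x, x) = vzero L"
      using x u by (intro eqI) (auto simp: c)
  qed
  show "\<phi> (?c (x, y)) k = (\<phi> x v * \<phi> y w + \<phi> y v * \<phi> x w) * unit_vec u k"
    if "x \<in> vcarrier L" "y \<in> vcarrier L"
    using that u by (simp add: c)
qed

lemma lab_cochain_Nil: "lab_cochain [] = vzero (cochains2 L)"
  by (simp add: lab_cochain_def cochain_def vsum_def)

lemma lab_cochain_Cons: "lab_cochain ((a, u, v, w) # ts) = vadd (cochains2 L)
    (vscale (cochains2 L) (ev \<alpha> a) (elementary_cochain L lab b (idx_label u) (idx_label v) (idx_label w))) (lab_cochain ts)"
  by (simp add: lab_cochain_def cochain_def vsum_def term_of_entry_def)

lemma lab_cochain_in: "indices_in ts \<Longrightarrow> lab_cochain ts \<in> vcarrier (cochains2 L)"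
proof (induction ts)
  interpret C: vspace "cochains2 L" by (rule vspace_cochains2)
  case Nil show ?case by (simp add: lab_cochain_Nil)
next
  interpret C: vspace "cochains2 L" by (rule vspace_cochains2)
  case (Cons t ts)
  obtain a u v w where t: "t = (a, u, v, w)" by (cases t)
  show ?case using Cons t elementary_in(1)[of u v w] by (auto simp: lab_cochain_Cons indices_in_def)
qed

lemma \<phi>_lab_cochain:
  "indices_in ts \<Longrightarrow> x \<in> vcarrier L \<Longrightarrow> y \<in> vcarrier L \<Longrightarrow> \<phi> (lab_cochain ts (x, y)) k =
    (\<Sum>(a, u, v, w)\<leftarrow>ts. ev \<alpha> a * ((\<phi> x v * \<phi> y w + \<phi> y v * \<phi> x w) * unit_vec u k))"
proof (induction ts)
  case Nil then show ?case by (simp add: lab_cochain_Nil)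
next
  interpret C: vspace "cochains2 L" by (rule vspace_cochains2)
  case (Cons t ts)
  obtain a u v w where t: "t = (a, u, v, w)" by (cases t)
  have ts: "indices_in ts" "u \<in> set I" "v \<in> set I" "w \<in> set I" using Cons.prems t by (auto simp: indices_in_def)
  have "\<phi> (lab_cochain (t # ts) (x, y)) k = ev \<alpha> a *
      \<phi> (elementary_cochain L lab b (idx_label u) (idx_label v) (idx_label w) (x, y)) k + \<phi> (lab_cochain ts (x, y)) k"
    using Cons.prems(2,3) by (simp add: t lab_cochain_Cons lab_cochain_in[OF ts(1)] elementary_in(1)[OF ts(2-4)])
  then show ?case
    unfolding Cons.IH[OF ts(1) Cons.prems(2,3)] elementary_in(2)[OF ts(2-4) Cons.prems(2,3)]
    by (simp only: t list.map sum_list.Cons prod.case)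
qed

lemma arr_lab_cochain:
  assumes "indices_in ts" "v \<in> set I" "w \<in> set I"
  shows "arr (lab_cochain ts) u v w = expr_array ts u v w"
proof -
  have entry: "ev \<alpha> a * ((unit_vec v v' * unit_vec w w' + unit_vec w v' * unit_vec v w') * unit_vec u' u)
      = val \<alpha> (pick ((v' = v \<and> w' = w) \<noteq> (v' = w \<and> w' = v)) [(a, u')] []) u" for a u' v' w'
    by (cases "v' = v"; cases "w' = w"; cases "v' = w"; cases "w' = v"; cases "u' = u")
      (simp_all add: unit_vec_def val_Cons)
  have "(\<Sum>(a, u', v', w')\<leftarrow>ts. ev \<alpha> a * ((unit_vec v v' * unit_vec w w' + unit_vec w v' * unit_vec v w') * unit_vec u' u))
      = val \<alpha> (expr_val ts v w) u"
  proof (induction ts)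
    case (Cons t ts)
    then show ?case by (cases t) (simp only: list.map sum_list.Cons prod.case entry expr_val.simps val_append)
  qed simp
  then show ?thesis
    using assms by (simp add: arr_def expr_array_def \<phi>_lab_cochain)
qed

end

lemma wadd_simps:
  "wadd a b = wadd b a" "wadd (wadd a b) c = wadd a (wadd b c)" "wadd a (wadd a b) = b" "wadd a a = (False, False, False)"
  "wadd (False, False, False) a = a" "wadd a b = (False, False, False) \<longleftrightarrow> a = b"
  by (cases a; cases b; cases c; auto)+

lemma wadd_eq: "wadd a b = c \<longleftrightarrow> a = wadd b c"
  by (cases a; cases b; cases c; auto)

lemma (in params) ev_tor_value_add: "ev \<alpha> (tor_value t (wadd a b)) = ev \<alpha> (tor_value t a) + ev \<alpha> (tor_value t b)"
  by (cases t; cases a; cases b) (auto simp: algebra_simps)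

text \<open>For every nonzero weight, one of the two elements \<open>h\<^sub>2\<close>, \<open>h\<^sub>3\<close> acts with a nonzero value.\<close>

definition tor_for :: "weight \<Rightarrow> torus" where
  "tor_for w = (if fst (snd w) then T3 else T2)"

lemma (in params) tor_for_nonzero: "w \<noteq> (False, False, False) \<Longrightarrow> ev \<alpha> (tor_value (tor_for w) w) \<noteq> 0"
  using \<alpha>_0 \<alpha>_1 by (cases w) (auto simp: tor_for_def)

context based_lie
begin

lemma table_facts:
  shows "distinct I" "Tor T2 \<in> set I" "Tor T3 \<in> set I"
    and of_weight: "set (of_weight I w) = {i \<in> set I. wt i = w}" "distinct (of_weight I w)"
    and S_alt: "i \<in> set I \<Longrightarrow> S i i k = 0"
    and S_sym: "i \<in> set I \<Longrightarrow> j \<in> set I \<Longrightarrow> S i j k = S j i k"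
    and S_tor: "i \<in> set I \<Longrightarrow> S (Tor (tor_for w)) i k = (if k = i then ev \<alpha> (tor_value (tor_for w) (wt i)) else 0)"
    and S_wt: "i \<in> set I \<Longrightarrow> j \<in> set I \<Longrightarrow> S i j k \<noteq> 0 \<Longrightarrow> wt k = wadd (wt i) (wt j)"
    and S_deg: "i \<in> set I \<Longrightarrow> j \<in> set I \<Longrightarrow> S i j k \<noteq> 0 \<Longrightarrow> idx_deg k = idx_deg i + idx_deg j"
proof -
  note t = table[unfolded table_ok_def list_all_iff]
  show "distinct I" "Tor T2 \<in> set I" "Tor T3 \<in> set I" using t by auto
  have w: "w \<in> set weights" by (cases w) (auto simp: weights_def)
  then show "distinct (of_weight I w)" using t by blast
  show "set (of_weight I w) = {i \<in> set I. wt i = w}" using t w by auto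
  show "S i i k = 0" if "i \<in> set I"
    using t that comb_null[of "br i i" k] by (simp add: sc_def)
  show "S i j k = S j i k" if "i \<in> set I" "j \<in> set I"
  proof -
    have "comb_null (br i j @ br j i)" using t that by blast
    then show ?thesis using comb_null[of "br i j @ br j i" k] by (simp add: sc_def)
  qed
  show "S (Tor (tor_for w)) i k = (if k = i then ev \<alpha> (tor_value (tor_for w) (wt i)) else 0)" if "i \<in> set I"
  proof -
    have "comb_null ((tor_value (tor_for w) (wt i), i) # br (Tor (tor_for w)) i)"
      using t that by (auto simp: tor_for_def)
    from comb_null[OF this, of k] show ?thesis by (auto simp: sc_def val_Cons split: if_splits)
  qed
  have "wt k = wadd (wt i) (wt j) \<and> idx_deg k = idx_deg i + idx_deg j" if "i \<in> set I" "j \<in> set I" "S i j k \<noteq> 0"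
  proof (rule ccontr)
    assume n: "\<not> ?thesis"
    have h: "\<forall>p\<in>set (br i j). case p of (a, k) \<Rightarrow> pnull a \<or> wt k = wadd (wt i) (wt j) \<and> idx_deg k = idx_deg i + idx_deg j"
      using t that(1,2) by blast
    have "val \<alpha> vs k = 0" if "set vs \<subseteq> set (br i j)" for vs
      using that
    proof (induction vs)
      case (Cons p vs)
      then show ?case using h n ev_pnull by (cases p) (force simp: val_Cons)
    qed simp
    then show False using that(3) by (simp add: sc_def)
  qed
  then show "i \<in> set I \<Longrightarrow> j \<in> set I \<Longrightarrow> S i j k \<noteq> 0 \<Longrightarrow> wt k = wadd (wt i) (wt j)"
    "i \<in> set I \<Longrightarrow> j \<in> set I \<Longrightarrow> S i j k \<noteq> 0 \<Longrightarrow> idx_deg k = idx_deg i + idx_deg j" by blast+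
qed

abbreviation "Z2 \<equiv> vcarrier (cocycles2 L)"

lemma Z2_C2: "c \<in> Z2 \<Longrightarrow> c \<in> vcarrier (cochains2 L)"
  by (simp add: cocycles2_iff)

lemma arr_sym: "c \<in> Z2 \<Longrightarrow> arr c u v w = arr c u w v"
  using cochain_sym[OF Z2_C2] by (simp add: arr_def)

lemma arr_diag: "c \<in> Z2 \<Longrightarrow> arr c u v v = 0"
  using Z2_C2[of c] by (auto simp: arr_def cochains2_iff)

lemma arr_outside: "c \<in> Z2 \<Longrightarrow> u \<notin> set I \<or> v \<notin> set I \<or> w \<notin> set I \<Longrightarrow> arr c u v w = 0"
  using supp[of "c (e v, e w)" u] Z2_C2[of c] by (auto simp: arr_def)

lemma arr_cocycle: "c \<in> Z2 \<Longrightarrow> i \<in> set I \<Longrightarrow> j \<in> set I \<Longrightarrow> k \<in> set I \<Longrightarrow> cocycle_sum br (arr c) i j k u = 0"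
  by (simp add: cocycle_iff_arr)

lemma arr_add_scale:
  assumes "c \<in> Z2" "d \<in> Z2"
  shows "vadd (cochains2 L) c (vscale (cochains2 L) a d) \<in> Z2"
    and "arr (vadd (cochains2 L) c (vscale (cochains2 L) a d)) u v w = arr c u v w + a * arr d u v w"
proof -
  interpret C: vspace "cochains2 L" by (rule vspace_cochains2)
  show "vadd (cochains2 L) c (vscale (cochains2 L) a d) \<in> Z2"
    using vspace.add_in[OF vspace_cocycles2] vspace.scale_in[OF vspace_cocycles2] assms by simp
  show "arr (vadd (cochains2 L) c (vscale (cochains2 L) a d)) u v w = arr c u v w + a * arr d u v w"
    using Z2_C2[OF assms(1)] Z2_C2[OF assms(2)] by (simp add: arr_def)
qed

lemma add_scale_back:
  assumes W: "vsubspace (cocycles2 L) W" and "c \<in> Z2" "d \<in> W" "vadd (cochains2 L) c (vscale (cochains2 L) a d) \<in> W"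
  shows "c \<in> W"
proof -
  interpret Z: vspace "cocycles2 L" by (rule vspace_cocycles2)
  have d: "d \<in> Z2" using vsubspaceD(1)[OF W] assms(3) by blast
  have "vadd (cocycles2 L) (vadd (cocycles2 L) c (vscale (cocycles2 L) a d)) (vscale (cocycles2 L) (- 1) (vscale (cocycles2 L) a d)) \<in> W"
    using assms vsubspaceD[OF W] by simp
  moreover have "Z.vsub (vadd (cocycles2 L) c (vscale (cocycles2 L) a d)) (vscale (cocycles2 L) a d) = c"
  proof -
    have "Z.vsub (vadd (cocycles2 L) (vscale (cocycles2 L) a d) c) (vscale (cocycles2 L) a d) = c"
      by (rule Z.sub_add_cancel) (use assms d Z.scale_in in auto)
    then show ?thesis using Z.add_commute[of c "vscale (cocycles2 L) a d"] Z.scale_in[OF d] assms(2) by simp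
  qed
  ultimately show ?thesis by simp
qed

text \<open>Linear maps given by matrices.\<close>

definition matrix_map :: "(idx \<Rightarrow> idx \<Rightarrow> 'k) \<Rightarrow> 'v \<Rightarrow> 'v" where
  "matrix_map M = (\<lambda>x\<in>vcarrier L. vsum L (map (\<lambda>u. vscale L (\<Sum>v\<in>UNIV. \<phi> x v * M u v) (e u)) I))"

lemma matrix_map:
  shows matrix_map_in: "x \<in> vcarrier L \<Longrightarrow> matrix_map M x \<in> vcarrier L"
    and \<phi>_matrix_map: "x \<in> vcarrier L \<Longrightarrow> \<phi> (matrix_map M x) k = (if k \<in> set I then \<Sum>v\<in>UNIV. \<phi> x v * M k v else 0)"
proof -
  have 1: "vsum L (map (\<lambda>u. vscale L (F u) (e u)) js) \<in> vcarrier L" if "set js \<subseteq> set I" for js F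
    using that by (induction js) (auto simp: vsum_def)
  have 2: "\<phi> (vsum L (map (\<lambda>u. vscale L (F u) (e u)) js)) k = (if k \<in> set js then F k else 0)"
    if "set js \<subseteq> set I" "distinct js" for js F
    using that
  proof (induction js)
    case (Cons j js)
    then have "\<phi> (vsum L (map (\<lambda>u. vscale L (F u) (e u)) (j # js))) k =
      F j * unit_vec j k + (if k \<in> set js then F k else 0)"
      using 1[of js F] by (simp add: vsum_def)
    then show ?case using Cons.prems by (auto simp: unit_vec_def)
  qed (simp add: vsum_def)
  show "x \<in> vcarrier L \<Longrightarrow> matrix_map M x \<in> vcarrier L" using 1 by (simp add: matrix_map_def)
  show "x \<in> vcarrier L \<Longrightarrow> \<phi> (matrix_map M x) k = (if k \<in> set I then \<Sum>v\<in>UNIV. \<phi> x v * M k v else 0)"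
    using 2[OF order.refl table_facts(1)] by (simp add: matrix_map_def)
qed

lemma matrix_map_cochain: "matrix_map M \<in> cochains1 L"
proof -
  have "linear_form (\<lambda>x. \<phi> (matrix_map M x) k)" for k
    by (auto simp: linear_form_def \<phi>_matrix_map algebra_simps sum.distrib sum_distrib_left)
  then have "vlinear L L (matrix_map M)" by (intro vlinearI) (auto simp: matrix_map_in)
  then show ?thesis by (simp add: cochains1_def matrix_map_def)
qed

definition mcob :: "(idx \<Rightarrow> idx \<Rightarrow> 'k) \<Rightarrow> 'v \<times> 'v \<Rightarrow> 'v" where
  "mcob M = coboundary1 L (matrix_map M)"

lemma mcob_in: "mcob M \<in> coboundaries2 L" "mcob M \<in> Z2"
  using matrix_map_cochain coboundary_cocycle by (auto simp: mcob_def coboundaries2_def cochains1_def)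

lemma arr_mcob:
  assumes M: "\<And>u v. u \<notin> set I \<Longrightarrow> M u v = 0" and vw: "v \<in> set I" "w \<in> set I"
  shows "arr (mcob M) u v w = (\<Sum>l\<in>UNIV. M l w * S v l u) + (\<Sum>l\<in>UNIV. M l v * S w l u) + (\<Sum>l\<in>UNIV. S v w l * M u l)"
proof -
  have lin: "vlinear L L (matrix_map M)" using matrix_map_cochain by (simp add: cochains1_def)
  have m: "\<phi> (matrix_map M x) k = (\<Sum>v\<in>UNIV. \<phi> x v * M k v)" if "x \<in> vcarrier L" for x k
    using that M by (simp add: \<phi>_matrix_map)
  have me: "\<phi> (matrix_map M (e w)) = (\<lambda>l. M l w)" if "w \<in> set I" for w
  proof
    fix l
    have "(\<Sum>v\<in>UNIV. unit_vec w v * M l v) = (\<Sum>v\<in>UNIV. if v = w then M l w else 0)"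
      by (intro sum.cong) (auto simp: unit_vec_def)
    then show "\<phi> (matrix_map M (e w)) l = M l w" using that by (simp add: m)
  qed
  have b1: "\<phi> (bracket L (e v) (matrix_map M (e w))) u = (\<Sum>l\<in>UNIV. M l w * S v l u)"
    if "v \<in> set I" "w \<in> set I" for v w
    using that by (simp add: \<phi>_bracket matrix_map_in me sc_bracket_unit_left)
  have b2: "\<phi> (bracket L (e v) (e w)) l = S v w l" for l
    using vw by (simp add: \<phi>_bracket sc_bracket_unit)
  show ?thesis
    using vw by (simp add: arr_def mcob_def \<phi>_coboundary1[OF lin] m b1 b2)
qed

definition weight_zero :: "(idx \<Rightarrow> idx \<Rightarrow> idx \<Rightarrow> 'k) \<Rightarrow> bool" where
  "weight_zero C \<longleftrightarrow> (\<forall>u v w. C u v w \<noteq> 0 \<longrightarrow> wt u = wadd (wt v) (wt w))"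

lemma sum_UNIV_I: "(\<And>l. l \<notin> set I \<Longrightarrow> F l = 0) \<Longrightarrow> (\<Sum>l\<in>UNIV. F l) = (\<Sum>l\<in>set I. F l :: 'k)"
  by (intro sum.mono_neutral_right) auto

text \<open>
  Let \<open>\<chi>\<close> be a nonzero weight and \<open>h\<close> an element of the torus with \<open>\<chi>(h) \<noteq> 0\<close>. The cocycle condition
  with \<open>h\<close> as one of the arguments expresses \<open>\<chi>(h) c\<close>, on the component of weight \<open>\<chi>\<close>, as the coboundary
  of the contraction of \<open>c\<close> with \<open>h\<close>.
\<close>

lemma weight_reduction:
  assumes c: "c \<in> Z2"
  obtains f where "f \<in> coboundaries2 L" "f \<in> Z2"
    "weight_zero (arr (vadd (cochains2 L) c (vscale (cochains2 L) 1 f)))"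
proof -
  let ?C = "arr c"
  let ?h = "\<lambda>w. Tor (tor_for w)"
  let ?z = "(False, False, False)"
  define M where "M u v = (let w = wadd (wt u) (wt v) in
      if w = ?z \<or> u \<notin> set I then 0 else ?C u (?h w) v / ev \<alpha> (tor_value (tor_for w) w))" for u v
  have M0: "u \<notin> set I \<Longrightarrow> M u v = 0" for u v by (simp add: M_def Let_def)
  have "?C u v w + arr (mcob M) u v w = 0" if ne: "wt u \<noteq> wadd (wt v) (wt w)" for u v w
  proof (cases "u \<in> set I \<and> v \<in> set I \<and> w \<in> set I")
    case False
    then show ?thesis using arr_outside[OF c, of u v w] arr_outside[OF mcob_in(2), of u v w M] by auto
  next
    case True
    then have I: "u \<in> set I" "v \<in> set I" "w \<in> set I" by auto
    define x where "x = wadd (wt u) (wadd (wt v) (wt w))"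
    have x: "x \<noteq> ?z" using ne by (simp add: x_def wadd_simps(6))
    let ?t = "\<lambda>y. ev \<alpha> (tor_value (tor_for x) y)"
    have tx: "?t x \<noteq> 0" by (rule tor_for_nonzero[OF x])
    have hI: "?h x \<in> set I" using table_facts by (simp add: tor_for_def)
    have Mt: "?t x * M l l' = ?C l (?h x) l'" if "wadd (wt l) (wt l') = x" "l \<in> set I" for l l'
      using that x tx by (simp add: M_def Let_def)
    have sums: "(\<Sum>l\<in>UNIV. ?C l v w * S (?h x) l u) = ?t (wt u) * ?C u v w"
      "(\<Sum>l\<in>UNIV. S (?h x) v l * ?C u l w) = ?t (wt v) * ?C u v w"
      "(\<Sum>l\<in>UNIV. S (?h x) w l * ?C u l v) = ?t (wt w) * ?C u v w"
    proof -
      have "(\<Sum>l\<in>UNIV. ?C l v w * S (?h x) l u) = (\<Sum>l\<in>UNIV. if l = u then ?t (wt u) * ?C u v w else 0)"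
      proof (intro sum.cong refl)
        fix l show "?C l v w * S (?h x) l u = (if l = u then ?t (wt u) * ?C u v w else 0)"
          using I arr_outside[OF c, of l v w] by (cases "l \<in> set I") (auto simp: S_tor)
      qed
      then show "(\<Sum>l\<in>UNIV. ?C l v w * S (?h x) l u) = ?t (wt u) * ?C u v w" by simp
      have "(\<Sum>l\<in>UNIV. S (?h x) v l * ?C u l w) = (\<Sum>l\<in>UNIV. if l = v then ?t (wt v) * ?C u v w else 0)"
        using I by (intro sum.cong) (auto simp: S_tor)
      then show "(\<Sum>l\<in>UNIV. S (?h x) v l * ?C u l w) = ?t (wt v) * ?C u v w" by simp
      have "(\<Sum>l\<in>UNIV. S (?h x) w l * ?C u l v) = (\<Sum>l\<in>UNIV. if l = w then ?t (wt w) * ?C u v w else 0)"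
        using I arr_sym[OF c] by (intro sum.cong) (auto simp: S_tor)
      then show "(\<Sum>l\<in>UNIV. S (?h x) w l * ?C u l v) = ?t (wt w) * ?C u v w" by simp
    qed
    have cob: "?t x * (\<Sum>l\<in>UNIV. M l w * S v l u) = (\<Sum>l\<in>UNIV. ?C l (?h x) w * S v l u)"
      "?t x * (\<Sum>l\<in>UNIV. M l v * S w l u) = (\<Sum>l\<in>UNIV. ?C l (?h x) v * S w l u)"
      "?t x * (\<Sum>l\<in>UNIV. S v w l * M u l) = (\<Sum>l\<in>UNIV. S v w l * ?C u l (?h x))"
    proof -
      have 1: "?t x * (M l w' * S v' l u) = ?C l (?h x) w' * S v' l u" if "wadd (wt u) (wadd (wt v') (wt w')) = x" "v' \<in> set I" for l v' w'
      proof (cases "l \<in> set I \<and> S v' l u \<noteq> 0")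
        case True
        then have "wt u = wadd (wt v') (wt l)" using S_wt that(2) by blast
        then have "wadd (wt l) (wt w') = x" using that(1) by (metis wadd_simps(1-3))
        then show ?thesis using Mt[of l w'] True by (simp add: mult.assoc[symmetric])
      next
        case False
        then show ?thesis using M0[of l] arr_outside[OF c, of l] by auto
      qed
      show "?t x * (\<Sum>l\<in>UNIV. M l w * S v l u) = (\<Sum>l\<in>UNIV. ?C l (?h x) w * S v l u)"
        unfolding sum_distrib_left by (intro sum.cong refl 1) (auto simp: x_def I)
      have xw: "wadd (wt u) (wadd (wt w) (wt v)) = x" by (simp add: x_def wadd_simps(1)[of "wt w"])
      then show "?t x * (\<Sum>l\<in>UNIV. M l v * S w l u) = (\<Sum>l\<in>UNIV. ?C l (?h x) v * S w l u)"
        unfolding sum_distrib_left by (intro sum.cong refl 1) (auto simp: I)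
      have "?t x * (S v w l * M u l) = S v w l * ?C u l (?h x)" for l
      proof (cases "S v w l \<noteq> 0")
        case True
        then have "wt l = wadd (wt v) (wt w)" using S_wt I by blast
        then show ?thesis using Mt[of u l] I arr_sym[OF c, of u l] by (simp add: x_def mult.left_commute)
      qed simp
      then show "?t x * (\<Sum>l\<in>UNIV. S v w l * M u l) = (\<Sum>l\<in>UNIV. S v w l * ?C u l (?h x))"
        unfolding sum_distrib_left by (intro sum.cong refl)
    qed
    have coc: "cocycle_sum br ?C (?h x) v w u = 0" by (rule arr_cocycle[OF c hI I(2,3)])
    have "?t (wt u) * ?C u v w + (?t (wt v) * ?C u v w + ?t (wt w) * ?C u v w) =
      ?t x * ((\<Sum>l\<in>UNIV. M l w * S v l u) + (\<Sum>l\<in>UNIV. M l v * S w l u) + (\<Sum>l\<in>UNIV. S v w l * M u l))"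
    proof -
      have regroup: "a + (b' + d) = A + B + D" if "a + A + B + b' + d + D = 0" for a b' d A B D :: 'k
        using that by (simp add: algebra_simps)
      show ?thesis
        unfolding distrib_left cob by (rule regroup) (use coc in \<open>simp only: cocycle_sum_def sums\<close>)
    qed
    also have "?t (wt u) * ?C u v w + (?t (wt v) * ?C u v w + ?t (wt w) * ?C u v w) = ?t x * ?C u v w"
      unfolding x_def ev_tor_value_add by (simp add: algebra_simps)
    finally have "?t x * ?C u v w = ?t x * arr (mcob M) u v w"
      using arr_mcob[OF M0 I(2,3), where u = u] by simp
    then show ?thesis using tx by simp
  qed
  then have "weight_zero (arr (vadd (cochains2 L) c (vscale (cochains2 L) 1 (mcob M))))"
    using arr_add_scale(2)[OF c mcob_in(2), of 1] unfolding weight_zero_def by auto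
  then show thesis using that mcob_in by blast
qed

end

context based_lie
begin

subsection \<open>Normalisation at the pivots\<close>

fun at_key :: "(idx \<Rightarrow> idx \<Rightarrow> idx \<Rightarrow> 'k) \<Rightarrow> key \<Rightarrow> 'k" where
  "at_key C (u, v, w) = C u v w"

definition elem_matrix :: "idx \<Rightarrow> idx \<Rightarrow> idx \<Rightarrow> idx \<Rightarrow> 'k" where
  "elem_matrix p q = (\<lambda>u v. if u = p \<and> v = q then 1 else 0)"

primrec gener_cochain :: "gener \<Rightarrow> 'v \<times> 'v \<Rightarrow> 'v" where
  "gener_cochain (Elem p q) = mcob (elem_matrix p q)"
| "gener_cochain (Coc ts) = lab_cochain ts"

lemma expr_array_support:
  assumes "expr_array ts u v w \<noteq> 0"
  shows "\<exists>(a, u', v', w')\<in>set ts. u' = u \<and> ({v', w'} = {v, w})"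
  using assms
proof (induction ts)
  case (Cons t ts)
  then show ?case
    by (cases t) (auto simp: expr_array_def val_Cons pick_if split: if_splits)
qed (simp add: expr_array_def)

lemma weight_zero_expr:
  assumes "expr_ok I d ts" shows "weight_zero (expr_array ts)"
  unfolding weight_zero_def
proof (intro allI impI)
  fix u v w assume "expr_array ts u v w \<noteq> 0"
  from expr_array_support[OF this] assms show "wt u = wadd (wt v) (wt w)"
    by (auto simp: expr_ok_def list_all_iff doubleton_eq_iff wadd_simps(1))
qed

lemma expr_ok_indices: "expr_ok I d ts \<Longrightarrow> indices_in ts"
  by (auto simp: expr_ok_def indices_in_def list_all_iff)

lemma arr_lab_cochain_all:
  assumes "indices_in ts" shows "arr (lab_cochain ts) = expr_array ts"
proof (intro ext)
  fix u v w
  show "arr (lab_cochain ts) u v w = expr_array ts u v w"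
  proof (cases "v \<in> set I \<and> w \<in> set I")
    case True then show ?thesis using arr_lab_cochain[OF assms] by simp
  next
    case False
    have "expr_array ts u v w = 0"
    proof (rule ccontr)
      assume "expr_array ts u v w \<noteq> 0"
      then obtain a u' v' w' where "(a, u', v', w') \<in> set ts" "{v', w'} = {v, w}"
        using expr_array_support by blast
      then show False using False assms by (auto simp: indices_in_def doubleton_eq_iff)
    qed
    then show ?thesis using False by (auto simp: arr_def)
  qed
qed

lemma lab_cochain_cocycle:
  assumes "indices_in ts" "\<And>i j k u. i \<in> set I \<Longrightarrow> j \<in> set I \<Longrightarrow> k \<in> set I \<Longrightarrow> cocycle_sum br (expr_array ts) i j k u = 0"
  shows "lab_cochain ts \<in> Z2"
  using assms lab_cochain_in[OF assms(1)] by (simp add: cocycle_iff_arr arr_lab_cochain_all)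

lemma arr_elem:
  assumes "u \<in> set I" "v \<in> set I" "w \<in> set I" "p \<in> set I"
  shows "arr (mcob (elem_matrix p q)) u v w =
    (if w = q then S v p u else 0) + (if v = q then S w p u else 0) + (if u = p then S v w q else 0)"
proof -
  have "arr (mcob (elem_matrix p q)) u v w = (\<Sum>l\<in>UNIV. elem_matrix p q l w * S v l u) +
    (\<Sum>l\<in>UNIV. elem_matrix p q l v * S w l u) + (\<Sum>l\<in>UNIV. S v w l * elem_matrix p q u l)"
    using assms by (intro arr_mcob) (auto simp: elem_matrix_def)
  also have "(\<Sum>l\<in>UNIV. elem_matrix p q l w * S v l u) = (\<Sum>l\<in>UNIV. if l = p then if w = q then S v p u else 0 else 0)"
    by (intro sum.cong) (auto simp: elem_matrix_def)
  also have "(\<Sum>l\<in>UNIV. elem_matrix p q l v * S w l u) = (\<Sum>l\<in>UNIV. if l = p then if v = q then S w p u else 0 else 0)"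
    by (intro sum.cong) (auto simp: elem_matrix_def)
  also have "(\<Sum>l\<in>UNIV. S v w l * elem_matrix p q u l) = (\<Sum>l\<in>UNIV. if l = q then if u = p then S v w q else 0 else 0)"
    by (intro sum.cong) (auto simp: elem_matrix_def)
  finally show ?thesis by simp
qed

lemma gener_cochain:
  assumes ok: "gener_ok I cs g" and cs: "\<And>ts. ts \<in> set cs \<Longrightarrow> expr_ok I (dg ts) ts \<and> lab_cochain ts \<in> Z2"
  shows "gener_cochain g \<in> Z2"
    and "key_in I x \<Longrightarrow> at_key (arr (gener_cochain g)) x = ev \<alpha> (gener_val br g x)"
    and "weight_zero (arr (gener_cochain g))"
proof -
  obtain u v w where x: "x = (u, v, w)" by (cases x)
  show "gener_cochain g \<in> Z2"
    using ok cs mcob_in by (cases g) auto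
  show "at_key (arr (gener_cochain g)) x = ev \<alpha> (gener_val br g x)" if "key_in I x"
  proof (cases g)
    case (Elem p q)
    then show ?thesis using ok that by (simp add: x arr_elem ev_padd sc_def val_def)
  next
    case (Coc ts)
    then show ?thesis using ok that cs[of ts] expr_ok_indices[of "dg ts" ts]
      by (simp add: x arr_lab_cochain_all expr_array_def val_def)
  qed
  show "weight_zero (arr (gener_cochain g))"
  proof (cases g)
    case (Elem p q)
    then have pq: "p \<in> set I" "q \<in> set I" "wt p = wt q" using ok by auto
    show ?thesis
      unfolding weight_zero_def
    proof (intro allI impI)
      fix u v w assume nz: "arr (gener_cochain g) u v w \<noteq> 0"
      have z: "mcob (elem_matrix p q) \<in> Z2" by (rule mcob_in)
      have I: "u \<in> set I" "v \<in> set I" "w \<in> set I" using nz arr_outside[OF z, of u v w] Elem by auto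
      have "(w = q \<and> S v p u \<noteq> 0) \<or> (v = q \<and> S w p u \<noteq> 0) \<or> (u = p \<and> S v w q \<noteq> 0)"
        using nz Elem arr_elem[OF I pq(1), of q] by (auto split: if_splits)
      then show "wt u = wadd (wt v) (wt w)"
        using S_wt[of v p u] S_wt[of w p u] S_wt[of v w q] I pq by (auto simp: wadd_simps(1))
    qed
  next
    case (Coc ts)
    then show ?thesis using ok cs[of ts] expr_ok_indices[of "dg ts" ts] weight_zero_expr[of "dg ts" ts]
      by (simp add: arr_lab_cochain_all)
  qed
qed

lemma pivot_reduction:
  assumes W: "vsubspace (cocycles2 L) W"
    and cs: "\<And>ts. ts \<in> set cs \<Longrightarrow> expr_ok I (dg ts) ts \<and> lab_cochain ts \<in> Z2"
    and gW: "\<And>g. gener_ok I cs g \<Longrightarrow> gener_cochain g \<in> W"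
    and "pivots_ok br I cs ps pv" and "c \<in> Z2" "weight_zero (arr c)"
    and "\<And>x. x \<in> set ps \<Longrightarrow> key_in I x \<and> at_key (arr c) x = 0"
  shows "\<exists>c'\<in>Z2. weight_zero (arr c') \<and> (\<forall>x\<in>set ps \<union> fst ` set pv. at_key (arr c') x = 0) \<and> (c' \<in> W \<longrightarrow> c \<in> W)"
  using assms(4-7)
proof (induction pv arbitrary: ps c)
  case Nil
  then show ?case by auto
next
  case (Cons pg pv)
  obtain p g where pg: "pg = (p, g)" by (cases pg)
  have ok: "key_in I p" "gener_ok I cs g" "punit (gener_val br g p)"
    "\<And>q. q \<in> set ps \<Longrightarrow> pnull (gener_val br g q)" "pivots_ok br I cs (p # ps) pv"
    using Cons.prems(1) pg by (auto simp: list_all_iff)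
  have g: "gener_cochain g \<in> Z2" "weight_zero (arr (gener_cochain g))"
    "\<And>x. key_in I x \<Longrightarrow> at_key (arr (gener_cochain g)) x = ev \<alpha> (gener_val br g x)"
    using gener_cochain[OF ok(2), of dg] cs by blast+
  let ?g = "gener_cochain g"
  let ?a = "at_key (arr c) p / at_key (arr ?g) p"
  let ?c = "vadd (cochains2 L) c (vscale (cochains2 L) ?a ?g)"
  have nz: "at_key (arr ?g) p \<noteq> 0" using g(3)[OF ok(1)] ev_punit[OF ok(3)] by simp
  have arr: "at_key (arr ?c) x = at_key (arr c) x + ?a * at_key (arr ?g) x" for x
    using arr_add_scale(2)[OF Cons.prems(2) g(1)] by (cases x) simp
  have "\<exists>c'\<in>Z2. weight_zero (arr c') \<and> (\<forall>x\<in>set (p # ps) \<union> fst ` set pv. at_key (arr c') x = 0) \<and> (c' \<in> W \<longrightarrow> ?c \<in> W)"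
  proof (rule Cons.IH[OF ok(5)])
    show "?c \<in> Z2" by (rule arr_add_scale(1)[OF Cons.prems(2) g(1)])
    show "weight_zero (arr ?c)"
      using Cons.prems(3) g(2) arr_add_scale(2)[OF Cons.prems(2) g(1)]
      unfolding weight_zero_def by (metis add_0 mult_zero_right)
    fix x assume "x \<in> set (p # ps)"
    then consider "x = p" | "x \<in> set ps" by auto
    then show "key_in I x \<and> at_key (arr ?c) x = 0"
    proof cases
      case 1 then show ?thesis using ok(1) nz by (simp add: arr)
    next
      case 2
      then have "at_key (arr ?g) x = 0" "at_key (arr c) x = 0" "key_in I x"
        using Cons.prems(4) g(3) ev_pnull ok(4) by auto
      then show ?thesis by (simp add: arr)
    qed
  qed
  then obtain c' where c': "c' \<in> Z2" "weight_zero (arr c')"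
    "\<forall>x\<in>set (p # ps) \<union> fst ` set pv. at_key (arr c') x = 0" "c' \<in> W \<longrightarrow> ?c \<in> W" by blast
  moreover have "?c \<in> W \<Longrightarrow> c \<in> W" by (rule add_scale_back[OF W Cons.prems(2) gW[OF ok(2)]])
  ultimately show ?case using pg by (intro bexI[of _ c']) auto
qed

subsection \<open>Solving the cocycle equations\<close>

definition vanish :: "(idx \<Rightarrow> idx \<Rightarrow> idx \<Rightarrow> 'k) \<Rightarrow> keyset \<Rightarrow> bool" where
  "vanish C Z \<longleftrightarrow> (\<forall>x. known Z x \<longrightarrow> at_key C x = 0)"

definition total :: "(idx \<Rightarrow> idx \<Rightarrow> idx \<Rightarrow> 'k) \<Rightarrow> (poly2 \<times> key) list \<Rightarrow> 'k" where
  "total C es = (\<Sum>(a, x)\<leftarrow>es. ev \<alpha> a * at_key C x)"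

lemma total_simps [simp]:
  "total C [] = 0" "total C ((a, x) # es) = ev \<alpha> a * at_key C x + total C es"
  "total C (es @ es') = total C es + total C es'"
  by (simp_all add: total_def)

lemma known_insert_key: "known (insert_key x Z) y \<Longrightarrow> known Z y \<or> same_key x y"
proof -
  obtain u v w u' v' w' where xy: "x = (u, v, w)" "y = (u', v', w')" by (cases x; cases y)
  have "outputs (insert_key (u, v, w) Z) u' = outputs Z u' \<or>
     u' = u \<and> outputs (insert_key (u, v, w) Z) u' = (v, w) # outputs Z u'"
    by (induction Z) (auto simp: pick_if split: if_splits)
  then show "known (insert_key x Z) y \<Longrightarrow> known Z y \<or> same_key x y"
    by (auto simp: xy same_key_def)
qed

lemma same_key_at:
  assumes "\<And>u v w. C u v w = C u w v" "same_key x y" shows "at_key C x = at_key C y"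
  using assms(2) by (cases x; cases y) (auto simp: same_key_def intro: assms(1))

lemma vanish_insert_keys:
  assumes sym: "\<And>u v w. C u v w = C u w v"
  shows "vanish C Z \<Longrightarrow> (\<And>x. x \<in> set xs \<Longrightarrow> at_key C x = 0) \<Longrightarrow> vanish C (insert_keys xs Z)"
proof (induction xs arbitrary: Z)
  case (Cons x xs)
  have "vanish C (insert_key x Z)"
    unfolding vanish_def
  proof (intro allI impI)
    fix y assume "known (insert_key x Z) y"
    then consider "known Z y" | "same_key x y" using known_insert_key by blast
    then show "at_key C y = 0"
    proof cases
      case 1 then show ?thesis using Cons.prems(1) unfolding vanish_def by blast
    next
      case 2 then show ?thesis using same_key_at[of C x y, OF sym] Cons.prems(2)[of x] by simp
    qed
  qed
  then show ?case using Cons.IH Cons.prems(2) by simp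
qed simp

lemma total_unknown:
  assumes "vanish C Z"
  shows "total C (map snd (filter fst (unknown_terms Z es))) = total C es"
proof (induction es)
  case (Cons e es)
  obtain a x where e: "e = (a, x)" by (cases e)
  have "known Z x \<Longrightarrow> at_key C x = 0" using assms unfolding vanish_def by blast
  then show ?case using Cons ev_pnull[of a] by (auto simp: e)
qed simp

lemma total_add_term:
  assumes "\<And>u v w. C u v w = C u w v"
  shows "total C (add_term a x es) = ev \<alpha> a * at_key C x + total C es"
  using same_key_at[OF assms] by (induction a x es rule: add_term.induct) (auto simp: ev_padd algebra_simps)

lemma total_collect:
  assumes "\<And>u v w. C u v w = C u w v"
  shows "total C (fold (\<lambda>(b, a, x). add_term a x) es acc) = total C (map snd es) + total C acc"
  by (induction es arbitrary: acc) (auto simp: total_add_term[OF assms] algebra_simps)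

lemma total_filter: "total C (filter (\<lambda>(a, x). \<not> pnull a) es) = total C es"
  by (induction es) (auto simp: ev_pnull)

lemma solvable_vanish:
  assumes sym: "\<And>u v w. C u v w = C u w v" and Z: "vanish C Z" and 0: "total C es = 0"
    and x: "x \<in> set (solvable (unknown_terms Z es))"
  shows "at_key C x = 0"
proof -
  let ?r = "filter (\<lambda>(a, x). \<not> pnull a) (fold (\<lambda>(b, a, x). add_term a x) (filter fst (unknown_terms Z es)) [])"
  have "total C ?r = 0"
    using 0 by (simp add: total_filter total_collect[OF sym] total_unknown[OF Z])
  moreover obtain a where "?r = [(a, x)]" "punit a"
  proof (cases ?r)
    case Nil then show ?thesis using x by (simp add: solvable_def)
  next
    case (Cons p r)
    then show ?thesis using x that by (cases p; cases r) (auto simp: solvable_def split: if_splits)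
  qed
  ultimately show ?thesis using ev_punit by simp
qed

lemma total_of_weight:
  assumes wz: "weight_zero C"
  shows "total C (map (\<lambda>l. (coef (br i l) u, (l, j, k))) (of_weight I (wadd (wt j) (wt k)))) =
    (\<Sum>l\<in>set I. C l j k * S i l u)"
proof -
  have "total C (map (\<lambda>l. (coef (br i l) u, (l, j, k))) (of_weight I (wadd (wt j) (wt k)))) =
    (\<Sum>l\<in>set (of_weight I (wadd (wt j) (wt k))). C l j k * S i l u)"
    using of_weight(2)[of "wadd (wt j) (wt k)"]
    by (simp add: total_def o_def sum_list_distinct_conv_sum_set sc_def val_def mult.commute)
  also have "\<dots> = (\<Sum>l\<in>set I. C l j k * S i l u)"
    using wz by (intro sum.mono_neutral_left) (auto simp: of_weight weight_zero_def)
  finally show ?thesis .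
qed

lemma total_br: "total C (map (\<lambda>(a, l). (a, (u, l, k))) (br i j)) = (\<Sum>l\<in>UNIV. S i j l * C u l k)"
  unfolding sc_def sum_val total_def by (simp add: o_def case_prod_unfold)

lemma total_cocycle_eqn:
  assumes "c \<in> Z2" "weight_zero (arr c)" "i \<in> set I" "j \<in> set I" "k \<in> set I"
  shows "total (arr c) (cocycle_eqn br I i j k u) = 0"
proof -
  have r: "(\<Sum>l\<in>set I. arr c l j k * S i l u) = (\<Sum>l\<in>UNIV. arr c l j k * S i l u)" for i j k
    using arr_outside[OF assms(1)] by (intro sum.mono_neutral_left) auto
  show ?thesis
    using arr_cocycle[OF assms(1,3-5), of u]
    by (simp add: cocycle_eqn_def total_of_weight[OF assms(2)] total_br r cocycle_sum_def add.assoc)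
qed

lemma solve_all_vanish:
  assumes c: "c \<in> Z2" "weight_zero (arr c)" and "set is \<subseteq> set I"
  shows "vanish (arr c) Z \<Longrightarrow> vanish (arr c) (solve_all br I is Z)"
proof -
  note sym = arr_sym[OF c(1)]
  have 1: "vanish (arr c) (solve_eqns br I i j k us Z)"
    if "vanish (arr c) Z" "i \<in> set I" "j \<in> set I" "k \<in> set I" for i j k us Z
    using that
  proof (induction us arbitrary: Z)
    case (Cons u us)
    have "vanish (arr c) (solve_eqn (cocycle_eqn br I i j k u) Z)"
      unfolding solve_eqn_def
      using Cons.prems solvable_vanish[OF sym Cons.prems(1) total_cocycle_eqn[OF c Cons.prems(2-4)]]
      by (intro vanish_insert_keys[OF sym]) auto
    then show ?case using Cons by simp
  qed simp
  have 2: "vanish (arr c) (solve_third br I i j ks Z)"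
    if "vanish (arr c) Z" "i \<in> set I" "j \<in> set I" "set ks \<subseteq> set I" for i j ks Z
    using that by (induction ks arbitrary: Z) (auto simp: 1)
  have 3: "vanish (arr c) (solve_second br I i js Z)"
    if "vanish (arr c) Z" "i \<in> set I" "set js \<subseteq> set I" for i js Z
    using that by (induction js arbitrary: Z) (auto simp: 2)
  show "vanish (arr c) Z \<Longrightarrow> vanish (arr c) (solve_all br I is Z)"
    using assms(3) by (induction "is" arbitrary: Z) (auto simp: 3)
qed

lemma all_known_zero:
  assumes c: "c \<in> Z2" "weight_zero (arr c)" and "all_known I Z" "vanish (arr c) Z"
  shows "arr c u v w = 0"
proof (rule ccontr)
  assume nz: "arr c u v w \<noteq> 0"
  then have I: "u \<in> set I" "v \<in> set I" "w \<in> set I" using arr_outside[OF c(1), of u v w] by auto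
  have u: "u \<in> set (of_weight I (wadd (wt v) (wt w)))" "u \<in> set (of_weight I (wadd (wt w) (wt v)))"
    using c(2) nz I by (auto simp: of_weight weight_zero_def wadd_simps(1))
  have "v = w \<or> known Z (u, v, w) \<or> known Z (u, w, v)"
    using all_pairsD[OF assms(3)[unfolded all_known_def] I(2,3)] u by (auto simp: list_all_iff)
  then have "arr c u v w = 0 \<or> arr c u w v = 0"
    using assms(4) arr_diag[OF c(1)] unfolding vanish_def by (metis at_key.simps)
  then show False using nz arr_sym[OF c(1)] by metis
qed

theorem H2_spanned:
  assumes rigid: "rigid br I cs pv"
    and cs: "\<And>ts. ts \<in> set cs \<Longrightarrow> expr_ok I (dg ts) ts \<and> lab_cochain ts \<in> Z2"
  shows "H2_spanned_by L (lab_cochain ` set cs)"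
proof (rule H2_spanned_byI[OF vspace_cocycles2 coboundaries_subspace])
  show "lab_cochain ` set cs \<subseteq> Z2" using cs by auto
  fix W assume W: "vsubspace (cocycles2 L) W" "lab_cochain ` set cs \<subseteq> W" "coboundaries2 L \<subseteq> W"
  show "Z2 \<subseteq> W"
  proof
    fix c assume c: "c \<in> Z2"
    obtain f where f: "f \<in> coboundaries2 L" "f \<in> Z2"
      and wz: "weight_zero (arr (vadd (cochains2 L) c (vscale (cochains2 L) 1 f)))" (is "weight_zero (arr ?c)")
      using weight_reduction[OF c] .
    have c1: "?c \<in> Z2" by (rule arr_add_scale(1)[OF c f(2)])
    have gW: "gener_cochain g \<in> W" if "gener_ok I cs g" for g
      using that W mcob_in by (cases g) auto
    have "\<exists>c'\<in>Z2. weight_zero (arr c') \<and> (\<forall>x\<in>set [] \<union> fst ` set pv. at_key (arr c') x = 0) \<and> (c' \<in> W \<longrightarrow> ?c \<in> W)"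
      by (rule pivot_reduction[OF W(1) cs gW _ c1 wz]) (use rigid in \<open>auto simp: rigid_def\<close>)
    then obtain c' where c': "c' \<in> Z2" "weight_zero (arr c')" "\<forall>x\<in>set [] \<union> fst ` set pv. at_key (arr c') x = 0"
      "c' \<in> W \<longrightarrow> ?c \<in> W" by blast
    have empty: "outputs (map (\<lambda>u. (u, [])) us) u = []" for us u
      by (induction us) (auto simp: pick_if)
    have "vanish (arr c') (map (\<lambda>u. (u, [])) I)"
      using arr_diag[OF c'(1)] by (auto simp: vanish_def empty)
    then have "vanish (arr c') (insert_keys (map fst pv) (map (\<lambda>u. (u, [])) I))"
      using c'(3) by (intro vanish_insert_keys[OF arr_sym[OF c'(1)]]) auto
    then have "vanish (arr c') (solve_all br I I (insert_keys (map fst pv) (map (\<lambda>u. (u, [])) I)))"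
      by (rule solve_all_vanish[OF c'(1,2) order.refl])
    then have 0: "arr c' u v w = 0" for u v w
      using rigid by (intro all_known_zero[OF c'(1,2)]) (auto simp: rigid_def)
    interpret C: vspace "cochains2 L" by (rule vspace_cochains2)
    have "c' = vzero (cochains2 L)"
    proof (rule cochain_eqI)
      fix u v w assume "v \<in> set I" "w \<in> set I"
      then show "\<phi> (c' (e v, e w)) u = \<phi> (vzero (cochains2 L) (e v, e w)) u"
        using 0[of u v w] by (simp add: arr_def)
    qed (use Z2_C2[OF c'(1)] in auto)
    then have "c' \<in> W" using vsubspaceD(2)[OF W(1)] by simp
    then have "?c \<in> W" using c'(4) by blast
    then show "c \<in> W" using add_scale_back[OF W(1) c] f W(3) by blast
  qed
qed

end

declare idx_label.simps [simp del]

lemma swap_swap [simp]: "swap_idx (swap_idx i) = i"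
  by (cases i) auto

lemma swap_eq: "swap_idx i = j \<longleftrightarrow> i = swap_idx j"
  by auto

lemma br_wk_swap: "br_wk (swap_idx i) (swap_idx j) = map (\<lambda>(a, k). (a, swap_idx k)) (br_wk i j)"
proof -
  have pn: "pos_neg s r = map (\<lambda>(a, k). (a, swap_idx k)) (pos_neg r s)" for r s
    by (cases r; cases s) (simp_all add: pos_neg_def)
  show ?thesis by (cases i; cases j) (auto split: option.splits intro: pn)
qed

lemma br_quot_swap: "br_quot (swap_idx i) (swap_idx j) = map (\<lambda>(a, k). (a, swap_idx k)) (br_quot i j)"
  by (auto simp: br_quot_def br_wk_swap swap_eq)

lemma (in params) val_swap: "val \<alpha> (map (\<lambda>(a, k). (a, swap_idx k)) vs) u = val \<alpha> vs (swap_idx u)"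
  by (induction vs) (auto simp: val_Cons swap_eq)

lemma (in params) sc_swap:
  assumes "br = br_wk \<or> br = br_quot" shows "sc \<alpha> br (swap_idx i) (swap_idx j) u = sc \<alpha> br i j (swap_idx u)"
  using assms by (auto simp: sc_def br_wk_swap br_quot_swap val_swap)

lemma sum_swap: "(\<Sum>l\<in>UNIV. F (swap_idx l)) = (\<Sum>l\<in>UNIV. F l)"
  by (rule sum.reindex_bij_witness[of _ swap_idx swap_idx]) auto

lemma (in params) expr_array_swap: "expr_array (swap_expr ts) u v w = expr_array ts (swap_idx u) (swap_idx v) (swap_idx w)"
proof -
  have "expr_val (swap_expr ts) v w = map (\<lambda>(a, k). (a, swap_idx k)) (expr_val ts (swap_idx v) (swap_idx w))"
    by (induction ts) (auto simp: swap_expr_def pick_if swap_eq)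
  then show ?thesis by (simp add: expr_array_def val_swap)
qed

lemma (in params) cocycle_sum_swap:
  assumes "br = br_wk \<or> br = br_quot"
  shows "cocycle_sum br (expr_array (swap_expr ts)) i j k u =
    cocycle_sum br (expr_array ts) (swap_idx i) (swap_idx j) (swap_idx k) (swap_idx u)"
proof -
  have s: "sc \<alpha> br i j k = sc \<alpha> br (swap_idx i) (swap_idx j) (swap_idx k)" for i j k
    using sc_swap[OF assms, of i j "swap_idx k"] by simp
  have e: "expr_array (swap_expr ts) = (\<lambda>u v w. expr_array ts (swap_idx u) (swap_idx v) (swap_idx w))"
    by (intro ext) (rule expr_array_swap)
  show ?thesis
    unfolding cocycle_sum_def e
    by (subst (1 2 3 4 5 6) sum_swap[symmetric]) (simp add: s[of i] s[of j] s[of k])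
qed

lemma root_height_swap: "idx_deg (swap_idx i) = - idx_deg i"
  by (cases i) auto

lemma wt_swap: "wt (swap_idx i) = wt i"
  by (cases i) auto

section \<open>The three algebras at once\<close>

locale wk_like = based_lie +
  fixes hs :: "nat set"
  assumes labels: "labels hs = idx_label ` set I"
    and which: "br = br_wk \<or> br = br_quot"
begin

lemma roots_in: "Pos r \<in> set I" "Neg r \<in> set I"
proof -
  have "Pos r \<in> set (of_weight I (root_weight r)) \<and> Neg r \<in> set (of_weight I (root_weight r))" by (cases r) auto
  then show "Pos r \<in> set I" "Neg r \<in> set I" by (auto simp: of_weight)
qed

lemma swap_in: "swap_idx i \<in> set I \<longleftrightarrow> i \<in> set I"
  by (cases i) (auto simp: roots_in)

lemma S_root_add: 
  assumes "root_add r s = Some t"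
  shows "bracket L (e (Pos r)) (e (Pos s)) = e (Pos t)" "bracket L (e (Neg r)) (e (Neg s)) = e (Neg t)"
proof -
  have "S (Pos r) (Pos s) k = unit_vec (Pos t) k" "S (Neg r) (Neg s) k = unit_vec (Neg t) k" for k
    using assms which by (auto simp: sc_def br_quot_def val_Cons unit_vec_def)
  then show "bracket L (e (Pos r)) (e (Pos s)) = e (Pos t)" "bracket L (e (Neg r)) (e (Neg s)) = e (Neg t)"
    by (auto intro!: eqI simp: roots_in \<phi>_bracket sc_bracket_unit)
qed

abbreviation "grd \<equiv> label_degrees hs b"

lemma label_gens:
  "b (X 1) = e (Pos R1)" "b (X 2) = e (Pos R2)" "b (X 3) = e (Pos R3)"
  "b (Y 1) = e (Neg R1)" "b (Y 2) = e (Neg R2)" "b (Y 3) = e (Neg R3)"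
  by (simp_all add: idx_label.simps)

lemma gens_cases:
  assumes "(g, d) \<in> grd"
  obtains i where "i \<in> set I" "g = e i" "d = idx_deg i"
proof -
  consider i where "i \<in> {1..3::nat}" "g = b (X i)" "d = 1" | i where "i \<in> {1..3::nat}" "g = b (Y i)" "d = - 1"
    | k where "k \<in> hs" "g = b (H k)" "d = 0"
    using assms by (auto simp: label_degrees_def)
  then show thesis
  proof cases
    case 1
    then have "i = 1 \<or> i = 2 \<or> i = 3" by auto
    then show thesis using 1 that[of "Pos R1"] that[of "Pos R2"] that[of "Pos R3"] roots_in label_gens by auto
  next
    case 2
    then have "i = 1 \<or> i = 2 \<or> i = 3" by auto
    then show thesis using 2 that[of "Neg R1"] that[of "Neg R2"] that[of "Neg R3"] roots_in label_gens by auto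
  next
    case 3
    have "H k \<in> idx_label ` set I" using 3(1) labels[symmetric] by (simp add: labels_def)
    then obtain i where i: "i \<in> set I" "H k = idx_label i" by auto
    have "idx_deg i = 0" using i(2) by (cases i) (auto simp: idx_label.simps)
    then show thesis using i 3 that[of i] by simp
  qed
qed

lemma homog_coord: "homog L grd d v \<Longrightarrow> v \<in> vcarrier L \<and> (\<forall>k. \<phi> v k \<noteq> 0 \<longrightarrow> idx_deg k = d)"
proof (induction rule: homog.induct)
  case (gen g d)
  then obtain i where "i \<in> set I" "g = e i" "d = idx_deg i" by (rule gens_cases)
  then show ?case by (auto simp: unit_vec_def)
next
  case (add d u v)
  then show ?case by (auto simp del: add_eq_0) (metis add_0)
next
  case (bracket d u d' v)
  have "idx_deg k = d + d'" if k: "\<phi> (bracket L u v) k \<noteq> 0" for k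
  proof -
    have "sc_bracket S (\<phi> u) (\<phi> v) k \<noteq> 0" using k bracket.IH by (simp add: \<phi>_bracket)
    then obtain i j where ij: "\<phi> u i * \<phi> v j * S i j k \<noteq> 0"
      unfolding sc_bracket_def by (metis (mono_tags, lifting) sum.neutral)
    then have "i \<in> set I" "j \<in> set I" using supp bracket.IH by auto
    then show ?thesis using S_deg[of i j k] ij bracket.IH by simp
  qed
  then show ?case using bracket.IH by simp
qed auto

lemma homog_e: "i \<in> set I \<Longrightarrow> homog L grd (idx_deg i) (e i)"
proof -
  note br = homog.bracket[of L grd]
  have p: "homog L grd (idx_deg (Pos t)) (e (Pos t)) \<and> homog L grd (idx_deg (Neg t)) (e (Neg t))"
    if "root_add r s = Some t" "root_height t = root_height r + root_height s"
      "homog L grd (idx_deg (Pos r)) (e (Pos r)) \<and> homog L grd (idx_deg (Neg r)) (e (Neg r))"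
      "homog L grd (idx_deg (Pos s)) (e (Pos s)) \<and> homog L grd (idx_deg (Neg s)) (e (Neg s))" for r s t
    using that br[of "idx_deg (Pos r)" "e (Pos r)" "idx_deg (Pos s)" "e (Pos s)"]
      br[of "idx_deg (Neg r)" "e (Neg r)" "idx_deg (Neg s)" "e (Neg s)"] S_root_add[OF that(1)] by simp
  have g: "(e (Pos r), 1) \<in> grd \<and> (e (Neg r), - 1) \<in> grd" if "r \<in> {R1, R2, R3}" for r
    using that by (fastforce simp: label_degrees_def idx_label.simps)
  have 1: "homog L grd (idx_deg (Pos r)) (e (Pos r)) \<and> homog L grd (idx_deg (Neg r)) (e (Neg r))" if "r \<in> {R1, R2, R3}" for r
    using g[OF that] that by (auto intro: homog.gen)
  have 4: "homog L grd (idx_deg (Pos R4)) (e (Pos R4)) \<and> homog L grd (idx_deg (Neg R4)) (e (Neg R4))"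
    by (rule p[of R1 R2, OF _ _ 1 1]) auto
  have 5: "homog L grd (idx_deg (Pos R5)) (e (Pos R5)) \<and> homog L grd (idx_deg (Neg R5)) (e (Neg R5))"
    by (rule p[of R2 R3, OF _ _ 1 1]) auto
  have 6: "homog L grd (idx_deg (Pos R6)) (e (Pos R6)) \<and> homog L grd (idx_deg (Neg R6)) (e (Neg R6))"
    by (rule p[of R3 R4, OF _ _ 1 4]) auto
  have 7: "homog L grd (idx_deg (Pos R7)) (e (Pos R7)) \<and> homog L grd (idx_deg (Neg R7)) (e (Neg R7))"
    by (rule p[of R4 R5, OF _ _ 4 5]) auto
  have all: "homog L grd (idx_deg (Pos r)) (e (Pos r)) \<and> homog L grd (idx_deg (Neg r)) (e (Neg r))" for r
    using 1[of r] 4 5 6 7 by (cases r) blast+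
  assume i: "i \<in> set I"
  show ?thesis
  proof (cases i)
    case (Tor t)
    have "idx_label i \<in> labels hs" using i labels by auto
    then have "(e i, 0) \<in> grd" using Tor by (auto simp: labels_def label_degrees_def idx_label.simps)
    then show ?thesis using Tor by (auto intro: homog.gen)
  qed (use all in auto)
qed

lemma coord_homog:
  assumes v: "v \<in> vcarrier L" "\<And>k. \<phi> v k \<noteq> 0 \<Longrightarrow> idx_deg k = d"
  shows "homog L grd d v"
proof -
  have "v \<in> {v. homog L grd d v}"
  proof (rule span_support[where A = "{k. idx_deg k = d}"])
    show "vsubspace L {v. homog L grd d v}"
      using homog_coord by (auto simp: vsubspace_def intro: homog.zero homog.add homog.scale)
  qed (use v homog_e in auto)
  then show ?thesis by simp
qed

lemma lab_cochain_degree: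
  assumes ts: "expr_ok I d ts" shows "has_degree L grd (lab_cochain ts) d"
  unfolding has_degree_def
proof (intro allI impI)
  fix p q s t assume "homog L grd p s \<and> homog L grd q t"
  then have s: "s \<in> vcarrier L" "\<And>k. \<phi> s k \<noteq> 0 \<Longrightarrow> idx_deg k = p"
    and t: "t \<in> vcarrier L" "\<And>k. \<phi> t k \<noteq> 0 \<Longrightarrow> idx_deg k = q" using homog_coord by blast+
  note i = expr_ok_indices[OF ts]
  show "homog L grd (p + q + d) (lab_cochain ts (s, t))"
  proof (rule coord_homog)
    show "lab_cochain ts (s, t) \<in> vcarrier L" using lab_cochain_in[OF i] s t by simp
    fix k assume nz: "\<phi> (lab_cochain ts (s, t)) k \<noteq> 0"
    show "idx_deg k = p + q + d"
    proof (rule ccontr)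
      assume ne: "idx_deg k \<noteq> p + q + d"
      have "ev \<alpha> a * ((\<phi> s v * \<phi> t w + \<phi> t v * \<phi> s w) * unit_vec u k) = 0" if "(a, u, v, w) \<in> set ts" for a u v w
      proof (cases "u = k")
        case True
        then have n: "idx_deg v + idx_deg w \<noteq> p + q" using ts that ne by (auto simp: expr_ok_def list_all_iff)
        have "\<phi> s v = 0 \<or> \<phi> t w = 0" using s(2)[of v] t(2)[of w] n by blast
        moreover have "\<phi> t v = 0 \<or> \<phi> s w = 0" using s(2)[of w] t(2)[of v] n by (metis add.commute)
        ultimately show ?thesis by auto
      qed (auto simp: unit_vec_def)
      then have "(\<Sum>(a, u, v, w)\<leftarrow>ts. ev \<alpha> a * ((\<phi> s v * \<phi> t w + \<phi> t v * \<phi> s w) * unit_vec u k)) = (\<Sum>x\<leftarrow>ts. 0)"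
        by (intro arg_cong[of _ _ sum_list] map_cong) auto
      then show False using nz \<phi>_lab_cochain[OF i s(1) t(1), of k] by simp
    qed
  qed
qed

lemma expr_ok_swap: "expr_ok I d ts \<Longrightarrow> expr_ok I (- d) (swap_expr ts)"
  by (auto simp: expr_ok_def swap_expr_def list_all_iff swap_in wt_swap root_height_swap)

lemma aut_action_lab_cochain:
  assumes \<omega>: "bij_betw \<omega> (vcarrier L) (vcarrier L)" "\<And>v k. v \<in> vcarrier L \<Longrightarrow> \<phi> (\<omega> v) k = \<phi> v (swap_idx k)"
    and ts: "indices_in ts"
  shows "aut_action L \<omega> (lab_cochain ts) = lab_cochain (swap_expr ts)"
proof -
  have ts': "indices_in (swap_expr ts)" using ts by (auto simp: indices_in_def swap_expr_def swap_in)
  let ?i = "inv_into (vcarrier L) \<omega>"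
  have i: "?i s \<in> vcarrier L" "\<omega> (?i s) = s" if "s \<in> vcarrier L" for s
    using that \<omega>(1) by (auto simp: bij_betw_def inv_into_into f_inv_into_f)
  have \<phi>i: "\<phi> (?i s) k = \<phi> s (swap_idx k)" if "s \<in> vcarrier L" for s k
    using \<omega>(2)[OF i(1)[OF that], of "swap_idx k"] i(2)[OF that] by simp
  have win: "\<omega> v \<in> vcarrier L" if "v \<in> vcarrier L" for v using \<omega>(1) that by (auto simp: bij_betw_def)
  show ?thesis
  proof (rule extensionalityI[of _ "vcarrier L \<times> vcarrier L"])
    show "lab_cochain (swap_expr ts) \<in> extensional (vcarrier L \<times> vcarrier L)"
      using lab_cochain_in[OF ts'] by (simp add: cochains2_iff)
    fix p assume "p \<in> vcarrier L \<times> vcarrier L"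
    then obtain s t where p: "p = (s, t)" "s \<in> vcarrier L" "t \<in> vcarrier L" by auto
    show "aut_action L \<omega> (lab_cochain ts) p = lab_cochain (swap_expr ts) p"
    proof (rule eqI)
      show "aut_action L \<omega> (lab_cochain ts) p \<in> vcarrier L"
        using p i win lab_cochain_in[OF ts] by (simp add: aut_action_def)
      show "lab_cochain (swap_expr ts) p \<in> vcarrier L" using p lab_cochain_in[OF ts'] by simp
      fix k
      have "\<phi> (aut_action L \<omega> (lab_cochain ts) p) k = \<phi> (lab_cochain ts (?i s, ?i t)) (swap_idx k)"
        using p i lab_cochain_in[OF ts] by (simp add: aut_action_def \<omega>(2))
      also have "\<dots> = (\<Sum>(a, u, v, w)\<leftarrow>ts. ev \<alpha> a * ((\<phi> s (swap_idx v) * \<phi> t (swap_idx w) + \<phi> t (swap_idx v) * \<phi> s (swap_idx w))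
          * unit_vec u (swap_idx k)))"
        using \<phi>_lab_cochain[OF ts i(1)[OF p(2)] i(1)[OF p(3)]] p by (simp add: \<phi>i)
      also have "\<dots> = \<phi> (lab_cochain (swap_expr ts) p) k"
        unfolding p(1) \<phi>_lab_cochain[OF ts' p(2,3)]
        by (simp add: swap_expr_def o_def case_prod_unfold unit_vec_def swap_eq)
      finally show "\<phi> (aut_action L \<omega> (lab_cochain ts) p) k = \<phi> (lab_cochain (swap_expr ts) p) k" .
    qed
  qed (simp add: aut_action_def)
qed

lemma negative_cocycles_exprs:
  "negative_cocycles \<alpha> = (\<lambda>(ts, d). (map (term_of_entry \<alpha>) ts, d)) ` {(em6, - 6), (em4_1, - 4), (em4_2, - 4), (em2, - 2)}"
  by (simp add: negative_cocycles_def c_m6_def c_m4_1_def c_m4_2_def c_m2_def em6_def em4_1_def em4_2_def em2_def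
      term_of_entry_def idx_label.simps power2_eq_square)

theorem all_cocycles_spanning:
  fixes z :: expr
  assumes rigid: "rigid br I (exprs z) pv"
    and neg: "expr_ok I (- 6) em6" "expr_ok I (- 4) em4_1" "expr_ok I (- 4) em4_2" "expr_ok I (- 2) em2" "expr_ok I 0 z"
    and coc: "\<And>ts i j k u. ts \<in> {em6, em4_1, em4_2, em2, z} \<Longrightarrow> i \<in> set I \<Longrightarrow> j \<in> set I \<Longrightarrow> k \<in> set I \<Longrightarrow>
      cocycle_sum br (expr_array ts) i j k u = 0"
    and \<omega>: "bij_betw \<omega> (vcarrier L) (vcarrier L)" "\<And>v k. v \<in> vcarrier L \<Longrightarrow> \<phi> (\<omega> v) k = \<phi> v (swap_idx k)"
    and c0: "c0 = map (term_of_entry \<alpha>) z"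
  defines "C \<equiv> all_cocycles L (labels hs) b \<omega> \<alpha> c0"
  shows "H2_spanned_by L (fst ` C) \<and> (\<forall>(c, d)\<in>C. has_degree L grd c d)"
proof -
  define N :: "(expr \<times> int) set" where "N = {(em6, - 6), (em4_1, - 4), (em4_2, - 4), (em2, - 2)}"
  have Nok: "expr_ok I d ts" if "(ts, d) \<in> N" for ts d using that neg by (auto simp: N_def)
  have Nfst: "fst ` N = {em6, em4_1, em4_2, em2}" by (simp add: N_def)
  have coch: "cochain L (labels hs) b (map (term_of_entry \<alpha>) ts) = lab_cochain ts" for ts
    by (simp add: lab_cochain_def labels)
  have aut: "aut_action L \<omega> (lab_cochain ts) = lab_cochain (swap_expr ts)" if "(ts, d) \<in> N" for ts d
    by (rule aut_action_lab_cochain[OF \<omega> expr_ok_indices[OF Nok[OF that]]])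
  have C: "C = (\<lambda>(ts, d). (lab_cochain ts, d)) ` N \<union>
      (\<lambda>(ts, d). (lab_cochain (swap_expr ts), - d)) ` N \<union> {(lab_cochain z, 0)}"
  proof -
    have im: "{(f ts, g d) | ts d. (ts, d) \<in> A} = (\<lambda>(ts, d). (f ts, g d)) ` A" for f g and A :: "('k cochain_expr \<times> int) set"
      by force
    have "{(cochain L (labels hs) b ts, d) | ts d. (ts, d) \<in> negative_cocycles \<alpha>} = (\<lambda>(ts, d). (lab_cochain ts, d)) ` N"
      unfolding im[of "cochain L (labels hs) b" "\<lambda>d. d"] negative_cocycles_exprs[folded N_def] image_image
      by (intro image_cong) (auto simp: coch)
    moreover have "{(aut_action L \<omega> (cochain L (labels hs) b ts), - d) | ts d. (ts, d) \<in> negative_cocycles \<alpha>} =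
        (\<lambda>(ts, d). (lab_cochain (swap_expr ts), - d)) ` N"
      unfolding im[of "\<lambda>ts. aut_action L \<omega> (cochain L (labels hs) b ts)" "\<lambda>d. - d"] negative_cocycles_exprs[folded N_def] image_image
    proof (rule image_cong[OF refl])
      fix x assume x: "x \<in> N"
      obtain ts d where "x = (ts, d)" by (cases x)
      then show "(case case x of (ts, d) \<Rightarrow> (map (term_of_entry \<alpha>) ts, d) of
          (ts, d) \<Rightarrow> (aut_action L \<omega> (cochain L (labels hs) b ts), - d)) =
        (case x of (ts, d) \<Rightarrow> (lab_cochain (swap_expr ts), - d))"
        using aut[of ts d] x by (simp only: prod.case coch)
    qed
    ultimately show ?thesis unfolding C_def all_cocycles_def c0 coch by (simp only:)
  qed
  have deg: "\<forall>(c, d)\<in>C. has_degree L grd c d"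
  proof
    fix x assume "x \<in> C"
    then consider ts d where "(ts, d) \<in> N" "x = (lab_cochain ts, d)"
      | ts d where "(ts, d) \<in> N" "x = (lab_cochain (swap_expr ts), - d)" | "x = (lab_cochain z, 0)"
      unfolding C by force
    then show "case x of (c, d) \<Rightarrow> has_degree L grd c d"
      by cases (use lab_cochain_degree Nok expr_ok_swap neg(5) in \<open>simp_all only: prod.case\<close>)
  qed
  have ex: "set (exprs z) = fst ` N \<union> swap_expr ` fst ` N \<union> {z}"
    by (auto simp: exprs_def neg_exprs_def Nfst)
  have "fst ` C = lab_cochain ` set (exprs z)"
    unfolding C ex by (simp add: image_Un image_image case_prod_unfold)
  moreover have "H2_spanned_by L (lab_cochain ` set (exprs z))"
  proof (rule H2_spanned[OF rigid])
    fix ts assume ts: "ts \<in> set (exprs z)"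
    have ok: "\<exists>d. expr_ok I d ts"
    proof -
      consider t d where "(t, d) \<in> N" "ts = t" | t d where "(t, d) \<in> N" "ts = swap_expr t" | "ts = z"
        using ts unfolding ex by force
      then show ?thesis using Nok expr_ok_swap neg(5) by cases blast+
    qed
    have cs: "cocycle_sum br (expr_array ts) i j k u = 0" if "i \<in> set I" "j \<in> set I" "k \<in> set I" for i j k u
    proof -
      consider "ts \<in> {em6, em4_1, em4_2, em2, z}" | t where "t \<in> {em6, em4_1, em4_2, em2, z}" "ts = swap_expr t"
        using ts unfolding ex Nfst by auto
      then show ?thesis
      proof cases
        case 1 then show ?thesis using coc that by blast
      next
        case (2 t)
        then show ?thesis
          using coc[OF 2(1), of "swap_idx i" "swap_idx j" "swap_idx k" "swap_idx u"] that
          by (simp add: cocycle_sum_swap[OF which] swap_in)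
      qed
    qed
    show "expr_ok I (SOME d. expr_ok I d ts) ts \<and> lab_cochain ts \<in> Z2"
      using someI_ex[OF ok] lab_cochain_cocycle[OF _ cs] ok expr_ok_indices by blast
  qed
  ultimately show ?thesis using deg by simp
qed

end

section \<open>Contragredient Lie algebras before factorisation\<close>

lemma free_sub: "p + vscale free_alg (- 1) q = p - q"
  by (rule poly_mapping_eqI) (simp add: lookup_add lookup_minus)

lemma free_scale_minus: "p + vscale free_alg a q = p - vscale free_alg (- a) q"
  by (rule poly_mapping_eqI) (simp add: lookup_add lookup_minus)

context
  fixes A :: "'k::field^'n^'n" and D :: "'k^'n^'m"
begin

private abbreviation "J \<equiv> presentation_ideal (cartan_relations A D)"
private abbreviation "gt \<equiv> g_tilde A D"
private abbreviation "gg \<equiv> g_tilde_gen A D"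
private abbreviation "tor \<equiv> gg ` (range GH \<union> range GD)"

private lemma J_subspace: "vsubspace free_alg J"
  using presentation_ideal_ideal[of "cartan_relations A D"] by (simp add: lie_ideal_def)

private lemmas coset_ops = free.vquot_add[OF J_subspace] free.vquot_scale[OF J_subspace]
  free.lie_quot_bracket[OF presentation_ideal_ideal]

private lemma relation: "r \<in> cartan_relations A D \<Longrightarrow> r \<in> J"
  unfolding presentation_ideal_def using ideal_gen_superset[of "lie_laws \<union> cartan_relations A D" free_alg] by blast

private lemma coset_eq: "p - q \<in> J \<Longrightarrow> vcoset free_alg J p = vcoset free_alg J q"
  using free.vcoset_eq_iff[OF J_subspace, of q p] by (simp add: free_sub)

private lemma coset_zero: "vcoset free_alg J 0 = vzero gt"
  using free.vcoset_zero[OF J_subspace] by (simp add: g_tilde_def free.vquot_zero)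

private lemma gt_ops:
  "bracket gt (vcoset free_alg J p) (vcoset free_alg J q) = vcoset free_alg J (bracket free_alg p q)"
  "vscale gt a (vcoset free_alg J p) = vcoset free_alg J (vscale free_alg a p)"
  "vadd gt (vcoset free_alg J p) (vcoset free_alg J q) = vcoset free_alg J (p + q)"
  using coset_ops(1)[of p q] coset_ops(2)[where v = p and a = a] coset_ops(3)[where x = p and y = q] by (simp_all add: g_tilde_def)

private lemma gg_in: "gg g \<in> vcarrier gt"
  by (simp add: g_tilde_def g_tilde_gen_def free.vquot_carrier)

lemma chevalley_g_tilde: "chevalley gt (\<lambda>i. gg (GX i)) (\<lambda>i. gg (GY i)) tor"
proof -
  interpret lie_algebra gt unfolding g_tilde_def by (rule presentation_quotient_lie_algebra)
  note rel = cartan_relations_def[of A D, unfolded Let_def]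
  show ?thesis
  proof
    show "gg (GX i) \<in> vcarrier gt" "gg (GY i) \<in> vcarrier gt" for i by (rule gg_in)+
    show "tor \<subseteq> vcarrier gt" using gg_in by auto
    fix i j
    have "bracket free_alg (gen_poly (GX i)) (gen_poly (GY j)) - (if i = j then gen_poly (GH i) else 0) \<in> J"
      by (rule relation) (auto simp: rel)
    from coset_eq[OF this] show "bracket gt (gg (GX i)) (gg (GY j)) = vzero gt \<or> bracket gt (gg (GX i)) (gg (GY j)) \<in> tor"
      by (auto simp: g_tilde_gen_def gt_ops coset_zero)
  next
    fix t j assume "t \<in> tor"
    then consider i where "t = gg (GH i)" | k where "t = gg (GD k)" by auto
    then show "\<exists>a. bracket gt t (gg (GX j)) = vscale gt a (gg (GX j))"
    proof cases
      case (1 i)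
      have "bracket free_alg (gen_poly (GH i)) (gen_poly (GX j)) - vscale free_alg (A $ i $ j) (gen_poly (GX j)) \<in> J"
        by (rule relation) (auto simp: rel)
      from coset_eq[OF this] show ?thesis using 1 by (auto simp: g_tilde_gen_def gt_ops)
    next
      case (2 i)
      have "bracket free_alg (gen_poly (GD i)) (gen_poly (GX j)) - vscale free_alg (D $ i $ j) (gen_poly (GX j)) \<in> J"
        by (rule relation) (auto simp: rel)
      from coset_eq[OF this] show ?thesis using 2 by (auto simp: g_tilde_gen_def gt_ops)
    qed
  next
    fix t j assume "t \<in> tor"
    then consider i where "t = gg (GH i)" | k where "t = gg (GD k)" by auto
    then show "\<exists>a. bracket gt t (gg (GY j)) = vscale gt a (gg (GY j))"
    proof cases
      case (1 i)
      have "bracket free_alg (gen_poly (GH i)) (gen_poly (GY j)) + vscale free_alg (A $ i $ j) (gen_poly (GY j)) \<in> J"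
        by (rule relation) (auto simp: rel)
      then show ?thesis using 1 coset_eq by (auto simp: g_tilde_gen_def gt_ops free_scale_minus)
    next
      case (2 i)
      have "bracket free_alg (gen_poly (GD i)) (gen_poly (GY j)) + vscale free_alg (D $ i $ j) (gen_poly (GY j)) \<in> J"
        by (rule relation) (auto simp: rel)
      then show ?thesis using 2 coset_eq by (auto simp: g_tilde_gen_def gt_ops free_scale_minus)
    qed
  next
    fix t t' assume "t \<in> tor" "t' \<in> tor"
    then obtain g g' where g: "t = gg g" "t' = gg g'" "g \<in> range GH \<union> range GD" "g' \<in> range GH \<union> range GD" by auto
    have "gen_poly g \<in> range (\<lambda>i. gen_poly (GH i)) \<union> range (\<lambda>k. gen_poly (GD k))"
      "gen_poly g' \<in> range (\<lambda>i. gen_poly (GH i)) \<union> range (\<lambda>k. gen_poly (GD k))" using g(3,4) by auto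
    then have "bracket free_alg (gen_poly g) (gen_poly g') \<in> cartan_relations A D"
      unfolding rel by blast
    then have "bracket free_alg (gen_poly g) (gen_poly g') - 0 \<in> J" using relation by simp
    from coset_eq[OF this] show "bracket gt t t' = vzero gt"
      using g by (auto simp: g_tilde_gen_def gt_ops coset_zero)
  qed
qed

interpretation gt: chevalley gt "\<lambda>i. gg (GX i)" "\<lambda>i. gg (GY i)" tor
  by (rule chevalley_g_tilde)

lemma g_tilde_gens: "gt.gens = range (\<lambda>g. (gg g, principal_degree g))"
proof -
  have "(UNIV :: ('n, 'm) gen set) = range GX \<union> range GY \<union> (range GH \<union> range GD)"
  proof -
    have "g \<in> range GX \<union> range GY \<union> (range GH \<union> range GD)" for g :: "('n, 'm) gen" by (cases g) auto
    then show ?thesis by blast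
  qed
  then have "range (\<lambda>g. (gg g, principal_degree g)) =
      (\<lambda>g. (gg g, principal_degree g)) ` (range GX \<union> range GY \<union> (range GH \<union> range GD))" by simp
  also have "\<dots> = gt.gens" by (simp add: image_Un image_image)
  finally show ?thesis by simp
qed

lemma g_tilde_generated: "vspan gt {u. \<exists>d. homog gt gt.gens d u} = vcarrier gt"
proof (rule equalityI)
  let ?H = "{u. \<exists>d. homog gt gt.gens d u}"
  have Hc: "?H \<subseteq> vcarrier gt" using gt.homog_in by auto
  show "vspan gt ?H \<subseteq> vcarrier gt" by (rule gt.vspan_carrier[OF Hc])
  have U: "vsubspace gt (vspan gt ?H)" by (rule gt.vspan_subspace[OF Hc])
  have w: "\<exists>d. homog gt gt.gens d (vcoset free_alg J (Poly_Mapping.single w 1))" for w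
  proof (induction w)
    case (Gen g)
    have "homog gt gt.gens (principal_degree g) (gg g)"
      unfolding g_tilde_gens by (rule homog.gen) auto
    then show ?case by (auto simp: g_tilde_gen_def gen_poly_def)
  next
    case (Br u v)
    have "bracket free_alg (Poly_Mapping.single u 1) (Poly_Mapping.single v 1) = Poly_Mapping.single (Br u v) (1 :: 'k)"
      by (simp add: free_bracket lookup_single)
    then show ?case using Br homog.bracket[of gt gt.gens] gt_ops(1) by metis
  qed
  have s: "vcoset free_alg J (Poly_Mapping.single w c) \<in> vspan gt ?H" for w c
  proof -
    have "vcoset free_alg J (Poly_Mapping.single w 1) \<in> vspan gt ?H"
      using w vspan_superset[of ?H gt] by blast
    from vsubspaceD(4)[OF U this, of c] show ?thesis
    proof -
      have "vscale free_alg c (Poly_Mapping.single w 1) = Poly_Mapping.single w c"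
        by (rule poly_mapping_eqI) (simp add: lookup_single when_def)
      then show ?thesis using vsubspaceD(4)[OF U \<open>vcoset free_alg J (Poly_Mapping.single w 1) \<in> vspan gt ?H\<close>, of c]
        by (simp add: gt_ops)
    qed
  qed
  have fin: "vcoset free_alg J (\<Sum>w\<in>B. Poly_Mapping.single w (f w)) \<in> vspan gt ?H" if "finite B" for B f
    using that
  proof (induction B rule: finite_induct)
    case empty then show ?case using vsubspaceD(2)[OF U] coset_zero by simp
  next
    case (insert w B)
    then show ?case using vsubspaceD(3)[OF U s[of w "f w"] insert.IH] by (simp add: gt_ops)
  qed
  have sum: "p = (\<Sum>w\<in>Poly_Mapping.keys p. Poly_Mapping.single w (Poly_Mapping.lookup p w))"
    for p :: "('n, 'm) gen word \<Rightarrow>\<^sub>0 'k"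
    by (rule poly_mapping_eqI) (auto simp: lookup_sum lookup_single when_def in_keys_iff)
  show "vcarrier gt \<subseteq> vspan gt ?H"
  proof
    fix u assume "u \<in> vcarrier gt"
    then obtain p where "u = vcoset free_alg J p"
      unfolding g_tilde_def lie_quot_simps free.vquot_carrier by blast
    then show "u \<in> vspan gt ?H" using fin[OF finite_keys[of p], of "Poly_Mapping.lookup p"] sum[of p] by simp
  qed
qed

text \<open>A Lie algebra with elements that satisfy the Cartan relations is a quotient.\<close>

lemma g_tilde_hom:
  fixes S :: "'i::finite \<Rightarrow> 'i \<Rightarrow> 'i \<Rightarrow> 'k"
  assumes alt: "\<And>f. sc_bracket S f f = (\<lambda>k. 0)"
    and jac: "\<And>f g h k. sc_bracket S f (sc_bracket S g h) k + sc_bracket S g (sc_bracket S h f) k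
      + sc_bracket S h (sc_bracket S f g) k = 0"
    and rel: "\<And>r. r \<in> cartan_relations A D \<Longrightarrow> free_eval S e r = (\<lambda>k. 0)"
  shows "coord_hom gt S (quot_map (free_eval S e))" and "quot_map (free_eval S e) (gg g) = e g"
proof -
  note k = presentation_ideal_kernel[OF alt jac rel]
  show "coord_hom gt S (quot_map (free_eval S e))"
    unfolding g_tilde_def by (rule coord_hom_quot[OF algebra_free_alg free_eval_hom presentation_ideal_ideal k])
  have "quot_map (free_eval S e) (gg g) = free_eval S e (gen_poly g)"
    unfolding g_tilde_gen_def
    by (rule quot_map_coset[OF algebra_free_alg free_eval_hom J_subspace k]) (simp_all add: free_alg_def)
  then show "quot_map (free_eval S e) (gg g) = e g" by simp
qed

end

lemma lie_algebra_quot: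
  assumes "lie_algebra L" "lie_ideal L I" shows "lie_algebra (lie_quot L I)"
proof -
  interpret lie_algebra L by fact
  interpret Q: algebra "lie_quot L I" by (rule algebra_lie_quot[OF assms(2)])
  have U: "vsubspace L I" using assms(2) by (simp add: lie_ideal_def)
  have z: "vzero (lie_quot L I) = vcoset L I (vzero L)" using vcoset_zero[OF U] by (simp add: vquot_zero)
  show ?thesis
  proof
    fix x assume "x \<in> vcarrier (lie_quot L I)"
    then obtain a where "x = vcoset L I a" "a \<in> vcarrier L"
      unfolding lie_quot_simps vquot_carrier by blast
    then show "bracket (lie_quot L I) x x = vzero (lie_quot L I)"
      by (simp add: lie_quot_bracket[OF assms(2)] z del: lie_quot_simps)
  next
    fix x y w assume "x \<in> vcarrier (lie_quot L I)" "y \<in> vcarrier (lie_quot L I)" "w \<in> vcarrier (lie_quot L I)"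
    then obtain a b c where abc: "x = vcoset L I a" "a \<in> vcarrier L" "y = vcoset L I b" "b \<in> vcarrier L"
      "w = vcoset L I c" "c \<in> vcarrier L"
      unfolding lie_quot_simps vquot_carrier by blast
    have add: "vadd (lie_quot L I) (vcoset L I a) (vcoset L I b) = vcoset L I (vadd L a b)"
      if "a \<in> vcarrier L" "b \<in> vcarrier L" for a b
      using vquot_add[OF U that] by simp
    show "vadd (lie_quot L I) (vadd (lie_quot L I) (bracket (lie_quot L I) x (bracket (lie_quot L I) y w))
        (bracket (lie_quot L I) y (bracket (lie_quot L I) w x))) (bracket (lie_quot L I) w (bracket (lie_quot L I) x y)) =
      vzero (lie_quot L I)"
      using abc jacobi[of a b c] by (simp add: lie_quot_bracket[OF assms(2)] add z del: lie_quot_simps)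
  qed
qed

section \<open>The algebra \<open>wk(3;\<alpha>)\<close> in coordinates\<close>

lemma all_idx: "i \<in> set idx_wk"
proof (cases i)
  case (Pos r) then show ?thesis by (cases r) (simp_all add: idx_wk_def)
next
  case (Neg r) then show ?thesis by (cases r) (simp_all add: idx_wk_def)
next
  case (Tor t) then show ?thesis by (cases t) (simp_all add: idx_wk_def)
qed

lemma table_ok_wk: "table_ok br_wk idx_wk" by code_simp
lemma table_ok_derived: "table_ok br_wk idx_derived" by code_simp
lemma table_ok_quot: "table_ok br_quot idx_quot" by code_simp
lemma jacobi_table_wk: "jacobi_table br_wk idx_wk" by code_simp

lemma sum_alternating:
  fixes a :: "'i \<Rightarrow> 'i \<Rightarrow> 'k::comm_ring_1"
  assumes "finite A" "(1::'k) + 1 = 0" "\<And>i j. a i j = a j i" "\<And>i. a i i = 0"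
  shows "(\<Sum>i\<in>A. \<Sum>j\<in>A. a i j) = 0"
  using assms(1)
proof (induction A rule: finite_induct)
  case (insert x A)
  have d: "(c::'k) + c = 0" for c using assms(2) distrib_left[of c 1 1] by simp
  have "(\<Sum>i\<in>insert x A. \<Sum>j\<in>insert x A. a i j) =
    (a x x + (\<Sum>j\<in>A. a x j)) + (\<Sum>i\<in>A. a i x + (\<Sum>j\<in>A. a i j))"
    using insert.hyps by simp
  also have "\<dots> = ((\<Sum>j\<in>A. a x j) + (\<Sum>j\<in>A. a x j)) + (\<Sum>i\<in>A. \<Sum>j\<in>A. a i j)"
    using assms(3,4) by (simp add: sum.distrib add.assoc)
  finally show ?case using insert.IH d by simp
qed simp

lemma linear_functional_zero:
  fixes F :: "('i::finite \<Rightarrow> 'k::field) \<Rightarrow> 'k"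
  assumes add: "\<And>f g. F (\<lambda>u. f u + g u) = F f + F g" and scale: "\<And>a f. F (\<lambda>u. a * f u) = a * F f"
    and 0: "\<And>i. F (unit_vec i) = 0"
  shows "F f = 0"
proof -
  have F0: "F (\<lambda>u. 0) = 0" using scale[of 0 "\<lambda>u. 0"] by simp
  have "F (\<lambda>u. \<Sum>i\<in>A. f i * unit_vec i u) = 0" if "finite A" for A
    using that by (induction A rule: finite_induct) (simp_all add: F0 add scale 0)
  from this[OF finite[of UNIV]] show ?thesis using unit_vec_expand[of f] by simp
qed

context params
begin

abbreviation "Sw \<equiv> sc \<alpha> br_wk"

lemma Sw_facts:
  shows Sw_alt: "Sw i i k = 0" and Sw_sym: "Sw i j k = Sw j i k"
    and Sw_deg: "Sw i j k \<noteq> 0 \<Longrightarrow> idx_deg k = idx_deg i + idx_deg j"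
proof -
  note t = table_ok_wk[unfolded table_ok_def list_all_iff]
  show "Sw i i k = 0"
    using t all_idx comb_null[of "br_wk i i" k] by (simp add: sc_def)
  show "Sw i j k = Sw j i k"
  proof -
    have "comb_null (br_wk i j @ br_wk j i)" using t all_idx by blast
    then show ?thesis using comb_null[of "br_wk i j @ br_wk j i" k] by (simp add: sc_def)
  qed
  assume nz: "Sw i j k \<noteq> 0"
  show "idx_deg k = idx_deg i + idx_deg j"
  proof (rule ccontr)
    assume n: "\<not> ?thesis"
    have h: "\<forall>p\<in>set (br_wk i j). case p of (a, k) \<Rightarrow> pnull a \<or> wt k = wadd (wt i) (wt j) \<and> idx_deg k = idx_deg i + idx_deg j"
      using t all_idx by blast
    have "val \<alpha> vs k = 0" if "set vs \<subseteq> set (br_wk i j)" for vs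
      using that
    proof (induction vs)
      case (Cons p vs)
      then show ?case using h n ev_pnull by (cases p) (force simp: val_Cons)
    qed simp
    then show False using nz by (simp add: sc_def)
  qed
qed

lemma Sw_alternating: "sc_bracket Sw f f = (\<lambda>k. 0)"
proof
  fix k
  show "sc_bracket Sw f f k = 0"
    unfolding sc_bracket_def
    by (rule sum_alternating) (auto simp: Sw_alt Sw_sym[of _ _ k] mult_ac two)
qed

lemma Sw_jacobi:
  "sc_bracket Sw f (sc_bracket Sw g h) u + sc_bracket Sw g (sc_bracket Sw h f) u + sc_bracket Sw h (sc_bracket Sw f g) u = 0"
proof -
  let ?Q = "\<lambda>f g h. sc_bracket Sw f (sc_bracket Sw g h) u + sc_bracket Sw g (sc_bracket Sw h f) u + sc_bracket Sw h (sc_bracket Sw f g) u"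
  have lin: "sc_bracket Sw (\<lambda>u. f u + g u) h = (\<lambda>u. sc_bracket Sw f h u + sc_bracket Sw g h u)"
    "sc_bracket Sw h (\<lambda>u. f u + g u) = (\<lambda>u. sc_bracket Sw h f u + sc_bracket Sw h g u)"
    "sc_bracket Sw (\<lambda>u. a * f u) h = (\<lambda>u. a * sc_bracket Sw f h u)"
    "sc_bracket Sw h (\<lambda>u. a * f u) = (\<lambda>u. a * sc_bracket Sw h f u)" for f g h a
    by (simp_all add: fun_eq_iff sc_bracket_add_left sc_bracket_add_right sc_bracket_scale_left sc_bracket_scale_right)
  let ?P = "\<lambda>i j k. ?Q (unit_vec i) (unit_vec j) (unit_vec k) = 0"
  have bb: "sc_bracket Sw (unit_vec i) (sc_bracket Sw (unit_vec j) (unit_vec k)) u = val \<alpha> (ad_comb br_wk i (br_wk j k)) u" for i j k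
    by (simp add: sc_bracket_unit_left[of _ i] sc_bracket_unit val_ad_comb sc_def)
  have swap: "sc_bracket Sw f (unit_vec j) = sc_bracket Sw (unit_vec j) f" for f j
  proof -
    have e: "f i * g j * Sw i j k = g j * f i * Sw j i k" for f g :: "idx \<Rightarrow> 'k" and i j k
      using Sw_sym[of i j k] by simp
    show ?thesis
    proof
      fix k
      show "sc_bracket Sw f (unit_vec j) k = sc_bracket Sw (unit_vec j) f k"
        unfolding sc_bracket_def by (subst sum.swap) (intro sum.cong refl e)
    qed
  qed
  have P: "?P i j k" for i j k
  proof (rule all_triplesD[OF jacobi_table_wk[unfolded jacobi_table_def] all_idx all_idx all_idx, where P = ?P])
    fix i j k
    assume "comb_null (ad_comb br_wk i (br_wk j k) @ ad_comb br_wk j (br_wk i k) @ ad_comb br_wk k (br_wk i j))"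
    from comb_null[OF this, of u] show "?P i j k"
      unfolding swap[of "unit_vec k" i] bb by simp
  next
    fix i j k assume "?P i j k"
    then show "?P j i k" "?P i k j"
      unfolding swap[of "unit_vec k" i] swap[of "unit_vec j" i] swap[of "unit_vec k" j] by (simp_all add: ac_simps)
  next
    fix i k show "?P i i k"
      unfolding swap[of "unit_vec k" i] using Sw_alternating by simp
  qed
  have 1: "?Q f (unit_vec j) (unit_vec k) = 0" for f j k
    by (rule linear_functional_zero[of "\<lambda>f. ?Q f (unit_vec j) (unit_vec k)"]) (simp_all only: lin P, simp_all add: algebra_simps)
  have 2: "?Q f g (unit_vec k) = 0" for f g k
    by (rule linear_functional_zero[of "\<lambda>g. ?Q f g (unit_vec k)"]) (simp_all only: lin 1, simp_all add: algebra_simps)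
  show "?Q f g h = 0"
    by (rule linear_functional_zero[of "\<lambda>h. ?Q f g h"]) (simp_all only: lin 2, simp_all add: algebra_simps)
qed

text \<open>The images of the generators.\<close>

definition root_of :: "3 \<Rightarrow> root" where
  "root_of i = (if i = 1 then R1 else if i = 2 then R2 else R3)"

definition tor_of :: "3 \<Rightarrow> torus" where
  "tor_of i = (if i = 1 then T1 else if i = 2 then T2 else T3)"

primrec gen_idx :: "(3, 1) gen \<Rightarrow> idx" where
  "gen_idx (GX i) = Pos (root_of i)"
| "gen_idx (GY i) = Neg (root_of i)"
| "gen_idx (GH i) = Tor (tor_of i)"
| "gen_idx (GD k) = Tor T4"

lemma index_cases: "(i::3) = 1 \<or> i = 2 \<or> i = 3"
  by (rule exhaust_3)

lemma wk_matrix_entries: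
  "wk_matrix \<alpha> $ i $ j = ev \<alpha> (tor_value (tor_of i) (root_weight (root_of j)))"
  "wk_grading $ l $ j = ev \<alpha> (tor_value T4 (root_weight (root_of j)))"
proof -
  show "wk_matrix \<alpha> $ i $ j = ev \<alpha> (tor_value (tor_of i) (root_weight (root_of j)))"
    using index_cases[of i] index_cases[of j] by (auto simp: wk_matrix_def root_of_def tor_of_def)
  have "wk_grading $ l = (vector [1, 0, 0] :: 'k^3)"
    unfolding num1_eq1[of l] wk_grading_def by (rule vector_1)
  then show "wk_grading $ l $ j = ev \<alpha> (tor_value T4 (root_weight (root_of j)))"
    using index_cases[of j] by (auto simp: root_of_def)
qed

lemma free_eval_diff: "free_eval S e (p - q) k = free_eval S e p k - free_eval S e q k"
  using free_eval_add[of S e "p - q" q k] by simp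

lemma relations_hold:
  assumes "r \<in> cartan_relations (wk_matrix \<alpha>) (wk_grading :: 'k^3^1)"
  shows "free_eval Sw (\<lambda>g. unit_vec (gen_idx g)) r = (\<lambda>k. 0)"
proof
  fix k
  let ?e = "free_eval Sw (\<lambda>g. unit_vec (gen_idx g))"
  have b: "?e (bracket free_alg (gen_poly g) (gen_poly g')) k = Sw (gen_idx g) (gen_idx g') k" for g g'
    by (simp add: free_eval_bracket sc_bracket_unit)
  consider (xy) i j where "r = bracket free_alg (gen_poly (GX i)) (gen_poly (GY j)) - (if i = j then gen_poly (GH i) else 0)"
    | (hx) i j where "r = bracket free_alg (gen_poly (GH i)) (gen_poly (GX j)) - vscale free_alg (wk_matrix \<alpha> $ i $ j) (gen_poly (GX j))"
    | (hy) i j where "r = bracket free_alg (gen_poly (GH i)) (gen_poly (GY j)) + vscale free_alg (wk_matrix \<alpha> $ i $ j) (gen_poly (GY j))"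
    | (dx) l j where "r = bracket free_alg (gen_poly (GD l)) (gen_poly (GX j)) - vscale free_alg (wk_grading $ l $ j) (gen_poly (GX j))"
    | (dy) l j where "r = bracket free_alg (gen_poly (GD l)) (gen_poly (GY j)) + vscale free_alg (wk_grading $ l $ j) (gen_poly (GY j))"
    | (hh) g g' where "r = bracket free_alg (gen_poly g) (gen_poly g')" "g \<in> range GH \<union> range GD" "g' \<in> range GH \<union> range GD"
    using assms unfolding cartan_relations_def Let_def by blast
  then show "?e r k = 0"
  proof cases
    case (xy i j)
    have "Sw (Pos (root_of i)) (Neg (root_of j)) k = (if i = j then unit_vec (Tor (tor_of i)) k else 0)"
      using index_cases[of i] index_cases[of j]
      by (auto simp: root_of_def tor_of_def sc_def pos_neg_def val_Cons unit_vec_def)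
    then show ?thesis unfolding xy by (simp add: free_eval_diff b)
  next
    case (hx i j)
    show ?thesis unfolding hx
      by (simp add: free_eval_diff free_eval_scale b sc_def val_Cons wk_matrix_entries, simp add: unit_vec_def)
  next
    case (hy i j)
    show ?thesis unfolding hy
      by (simp add: free_eval_add free_eval_scale b sc_def val_Cons wk_matrix_entries, simp add: unit_vec_def)
  next
    case (dx l j)
    show ?thesis unfolding dx
      by (simp add: free_eval_diff free_eval_scale b sc_def val_Cons wk_matrix_entries, simp add: unit_vec_def)
  next
    case (dy l j)
    show ?thesis unfolding dy
      by (simp add: free_eval_add free_eval_scale b sc_def val_Cons wk_matrix_entries, simp add: unit_vec_def)
  next
    case hh
    then show ?thesis by (auto simp: b sc_def)
  qed
qed

abbreviation "gt \<equiv> g_tilde (wk_matrix \<alpha>) (wk_grading :: 'k^3^1)"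
abbreviation "gg \<equiv> g_tilde_gen (wk_matrix \<alpha>) (wk_grading :: 'k^3^1)"
abbreviation "\<phi>1 \<equiv> quot_map (free_eval Sw (\<lambda>g. unit_vec (gen_idx g)))"

sublocale gt: chevalley gt "\<lambda>i. gg (GX i)" "\<lambda>i. gg (GY i)" "gg ` (range GH \<union> range GD)"
  by (rule chevalley_g_tilde)

lemma \<phi>1_hom: "coord_hom gt Sw \<phi>1" and \<phi>1_gen: "\<phi>1 (gg g) = unit_vec (gen_idx g)"
  by (rule g_tilde_hom[OF Sw_alternating Sw_jacobi relations_hold]; assumption)+

end

context params
begin

text \<open>Elements of the presented algebra over the basis.\<close>

primrec lift :: "idx \<Rightarrow> (((3, 1) gen word \<Rightarrow>\<^sub>0 'k) set)" where
  "lift (Pos r) = root_vector gt (gg (GX 1)) (gg (GX 2)) (gg (GX 3))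
     (case r of R1 \<Rightarrow> 1 | R2 \<Rightarrow> 2 | R3 \<Rightarrow> 3 | R4 \<Rightarrow> 4 | R5 \<Rightarrow> 5 | R6 \<Rightarrow> 6 | R7 \<Rightarrow> 7)"
| "lift (Neg r) = root_vector gt (gg (GY 1)) (gg (GY 2)) (gg (GY 3))
     (case r of R1 \<Rightarrow> 1 | R2 \<Rightarrow> 2 | R3 \<Rightarrow> 3 | R4 \<Rightarrow> 4 | R5 \<Rightarrow> 5 | R6 \<Rightarrow> 6 | R7 \<Rightarrow> 7)"
| "lift (Tor t) = (case t of T1 \<Rightarrow> gg (GH 1) | T2 \<Rightarrow> gg (GH 2) | T3 \<Rightarrow> gg (GH 3) | T4 \<Rightarrow> gg (GD 1))"

lemma unit_bracket:
  assumes "br_wk i j = [(c1, k)]" shows "sc_bracket Sw (unit_vec i) (unit_vec j) = unit_vec k"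
proof
  fix u
  have "Sw i j u = unit_vec k u" using assms by (simp add: sc_def val_Cons unit_vec_def)
  then show "sc_bracket Sw (unit_vec i) (unit_vec j) u = unit_vec k u" by (simp add: sc_bracket_unit)
qed

lemma gg_in [simp]: "gg (GH i) \<in> vcarrier gt" "gg (GD k) \<in> vcarrier gt"
  by (rule subsetD[OF gt.T_in], blast)+

lemma gen_homog: "homog gt gt.gens (principal_degree g) (gg g)"
  unfolding g_tilde_gens by (rule homog.gen) auto

lemma lift_homog: "homog gt gt.gens (idx_deg i) (lift i)"
proof -
  define hm where "hm = homog gt gt.gens"
  have h: "hm 1 (gg (GX i))" "hm (- 1) (gg (GY i))" "hm 0 (gg (GH i))" "hm 0 (gg (GD k))" for i k
    using gen_homog[of "GX i"] gen_homog[of "GY i"] gen_homog[of "GH i"] gen_homog[of "GD k"]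
    unfolding hm_def principal_degree.simps by this+
  have b: "hm d u \<Longrightarrow> hm d' v \<Longrightarrow> hm (d + d') (bracket gt u v)" for d d' u v
    unfolding hm_def by (rule homog.bracket)
  have brackets: "hm (d + d) (bracket gt u v)" "hm (d + d) (bracket gt v w)" "hm (d + (d + d)) (bracket gt w (bracket gt u v))"
    "hm (d + d + (d + d)) (bracket gt (bracket gt u v) (bracket gt v w))"
    if "hm d u" "hm d v" "hm d w" for d u v w
    using b[OF that(1,2)] b[OF that(2,3)] b[OF that(3) b[OF that(1,2)]] b[OF b[OF that(1,2)] b[OF that(2,3)]]
    by simp_all
  note x = brackets[OF h(1)[of 1] h(1)[of 2] h(1)[of 3], simplified]
  note y = brackets[OF h(2)[of 1] h(2)[of 2] h(2)[of 3], simplified]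
  have "hm (idx_deg i) (lift i)"
  proof (cases i)
    case (Pos r) then show ?thesis by (cases r) (simp_all add: root_vector_def Let_def h x)
  next
    case (Neg r) then show ?thesis by (cases r) (simp_all add: root_vector_def Let_def h y)
  next
    case (Tor t) then show ?thesis by (cases t) (simp_all add: h)
  qed
  then show ?thesis unfolding hm_def .
qed

lemma lift_in [simp]: "lift i \<in> vcarrier gt"
  using lift_homog gt.homog_in by blast

lemma \<phi>1_lift: "\<phi>1 (lift i) = unit_vec i"
proof -
  note b = coord_homD(3)[OF \<phi>1_hom]
  have x: "\<phi>1 (gg (GX 1)) = unit_vec (Pos R1)" "\<phi>1 (gg (GX 2)) = unit_vec (Pos R2)" "\<phi>1 (gg (GX 3)) = unit_vec (Pos R3)"
    "\<phi>1 (gg (GY 1)) = unit_vec (Neg R1)" "\<phi>1 (gg (GY 2)) = unit_vec (Neg R2)" "\<phi>1 (gg (GY 3)) = unit_vec (Neg R3)"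
    "\<phi>1 (gg (GH 1)) = unit_vec (Tor T1)" "\<phi>1 (gg (GH 2)) = unit_vec (Tor T2)" "\<phi>1 (gg (GH 3)) = unit_vec (Tor T3)"
    "\<phi>1 (gg (GD k)) = unit_vec (Tor T4)" for k
    by (simp_all add: \<phi>1_gen root_of_def tor_of_def)
  have u: "sc_bracket Sw (unit_vec (Pos r)) (unit_vec (Pos s)) = unit_vec (Pos t)"
    "sc_bracket Sw (unit_vec (Neg r)) (unit_vec (Neg s)) = unit_vec (Neg t)" if "root_add r s = Some t" for r s t
    using that by (auto intro: unit_bracket)
  show ?thesis
  proof (cases i)
    case (Pos r) then show ?thesis by (cases r) (simp_all add: root_vector_def Let_def b x u)
  next
    case (Neg r) then show ?thesis by (cases r) (simp_all add: root_vector_def Let_def b x u)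
  next
    case (Tor t) then show ?thesis by (cases t) (simp_all add: x)
  qed
qed

lemma torus_span:
  assumes u: "u \<in> vspan gt (gg ` (range GH \<union> range GD))" and 0: "\<phi>1 u = (\<lambda>k. 0)"
  shows "u = vzero gt"
proof -
  let ?c = "\<lambda>a b c d. vadd gt (vadd gt (vscale gt a (lift (Tor T1))) (vscale gt b (lift (Tor T2))))
    (vadd gt (vscale gt c (lift (Tor T3))) (vscale gt d (lift (Tor T4))))"
  have "vspan gt (gg ` (range GH \<union> range GD)) \<subseteq> {u. \<exists>a b c d. u = ?c a b c d}"
  proof (rule vspan_least)
    have g: "gg (GH 1) = ?c 1 0 0 0" "gg (GH 2) = ?c 0 1 0 0" "gg (GH 3) = ?c 0 0 1 0" "gg (GD 1) = ?c 0 0 0 1"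
      by simp_all
    have "gg (GH i) \<in> {u. \<exists>a b c d. u = ?c a b c d}" for i
      using index_cases[of i] g by blast
    moreover have "gg (GD k) \<in> {u. \<exists>a b c d. u = ?c a b c d}" for k
      using g(4) num1_eq1[of k] by blast
    ultimately show "gg ` (range GH \<union> range GD) \<subseteq> {u. \<exists>a b c d. u = ?c a b c d}" by blast
    have add: "vadd gt (?c a b c d) (?c a' b' c' d') = ?c (a + a') (b + b') (c + c') (d + d')" for a b c d a' b' c' d'
      by (simp add: gt.add_scale gt.add_assoc gt.add_left_commute del: lift.simps)
    have scale: "vscale gt x (?c a b c d) = ?c (x * a) (x * b) (x * c) (x * d)" for x a b c d
      by (simp add: gt.scale_add gt.scale_scale del: lift.simps)
    show "vsubspace gt {u. \<exists>a b c d. u = ?c a b c d}"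
      unfolding vsubspace_def
    proof (intro conjI ballI allI)
      show "{u. \<exists>a b c d. u = ?c a b c d} \<subseteq> vcarrier gt" by (auto simp del: lift.simps)
      have "vzero gt = ?c 0 0 0 0" by (simp del: lift.simps)
      then show "vzero gt \<in> {u. \<exists>a b c d. u = ?c a b c d}" by blast
    next
      fix u v assume "u \<in> {u. \<exists>a b c d. u = ?c a b c d}" "v \<in> {u. \<exists>a b c d. u = ?c a b c d}"
      then show "vadd gt u v \<in> {u. \<exists>a b c d. u = ?c a b c d}" using add by blast
    next
      fix x u assume "u \<in> {u. \<exists>a b c d. u = ?c a b c d}"
      then show "vscale gt x u \<in> {u. \<exists>a b c d. u = ?c a b c d}" using scale by blast
    qed
  qed
  then obtain a b c d where u': "u = ?c a b c d" using u by blast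
  have "\<phi>1 u k = a * unit_vec (Tor T1) k + b * unit_vec (Tor T2) k + (c * unit_vec (Tor T3) k + d * unit_vec (Tor T4) k)" for k
    unfolding u' by (simp add: coord_homD[OF \<phi>1_hom] \<phi>1_lift del: lift.simps add_eq_0)
  then have e: "a * unit_vec (Tor T1) k + b * unit_vec (Tor T2) k + (c * unit_vec (Tor T3) k + d * unit_vec (Tor T4) k) = 0" for k
    using 0 by (simp add: fun_eq_iff del: add_eq_0)
  have "a = 0" "b = 0" "c = 0" "d = 0"
    using e[of "Tor T1"] e[of "Tor T2"] e[of "Tor T3"] e[of "Tor T4"] by (simp_all add: unit_vec_def)
  then show ?thesis unfolding u' by (simp del: lift.simps)
qed

lemma UNIV_idx: "(UNIV :: idx set) = set idx_wk"
  using all_idx by auto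

lemma unit_vec_eq_0: "unit_vec i k = (0 :: 'k) \<longleftrightarrow> k \<noteq> i"
  by (simp add: unit_vec_def)

lemma root_height_pos: "root_height r > 0"
  by (cases r) auto

lemma idx_deg_sign: "0 < idx_deg k \<Longrightarrow> \<exists>r. k = Pos r" "idx_deg k < 0 \<Longrightarrow> \<exists>r. k = Neg r"
proof -
  show "\<exists>r. k = Pos r" if "0 < idx_deg k"
  proof (cases k)
    case (Neg r) then show ?thesis using that root_height_pos[of r] by simp
  qed (use that in auto)
  show "\<exists>r. k = Neg r" if "idx_deg k < 0"
  proof (cases k)
    case (Pos r) then show ?thesis using that root_height_pos[of r] by simp
  qed (use that in auto)
qed

text \<open>Some generator detects every nonzero element of positive or of negative degree.\<close>

lemma detect:
  fixes f :: "idx \<Rightarrow> 'k"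
  shows "sc_bracket Sw (unit_vec (Neg R1)) f (Tor T1) = f (Pos R1)"
    "sc_bracket Sw (unit_vec (Neg R2)) f (Tor T2) = f (Pos R2)"
    "sc_bracket Sw (unit_vec (Neg R3)) f (Tor T3) = f (Pos R3)"
    "sc_bracket Sw (unit_vec (Neg R1)) f (Pos R2) = \<alpha> * f (Pos R4)"
    "sc_bracket Sw (unit_vec (Neg R3)) f (Pos R2) = f (Pos R5)"
    "sc_bracket Sw (unit_vec (Neg R1)) f (Pos R5) = \<alpha> * f (Pos R6)"
    "sc_bracket Sw (unit_vec (Neg R2)) f (Pos R6) = (1 + \<alpha>) * f (Pos R7)"
    "sc_bracket Sw (unit_vec (Pos R1)) f (Tor T1) = f (Neg R1)"
    "sc_bracket Sw (unit_vec (Pos R2)) f (Tor T2) = f (Neg R2)"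
    "sc_bracket Sw (unit_vec (Pos R3)) f (Tor T3) = f (Neg R3)"
    "sc_bracket Sw (unit_vec (Pos R1)) f (Neg R2) = \<alpha> * f (Neg R4)"
    "sc_bracket Sw (unit_vec (Pos R3)) f (Neg R2) = f (Neg R5)"
    "sc_bracket Sw (unit_vec (Pos R1)) f (Neg R5) = \<alpha> * f (Neg R6)"
    "sc_bracket Sw (unit_vec (Pos R2)) f (Neg R6) = (1 + \<alpha>) * f (Neg R7)"
  by (simp_all add: sc_bracket_unit_left UNIV_idx idx_wk_def sc_def pos_neg_def val_Cons mult.commute)

lemma max_ideal_kernel: "max_ideal (wk_matrix \<alpha>) (wk_grading :: 'k^3^1) = kernel gt \<phi>1"
proof -
  have a1: "1 + \<alpha> \<noteq> 0" using \<alpha>_1 by auto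
  have "(GREATEST I. graded_ideal gt gt.gens I \<and> I \<inter> vspan gt (gg ` (range GH \<union> range GD)) = {vzero gt}) = kernel gt \<phi>1"
  proof (rule gt.kernel_greatest[where deg = idx_deg and l = lift and S = Sw, OF \<phi>1_hom])
    show "Sw i j k \<noteq> 0 \<Longrightarrow> idx_deg k = idx_deg i + idx_deg j" for i j k by (rule Sw_deg)
    show "\<phi>1 (gg (GX i)) k \<noteq> 0 \<Longrightarrow> idx_deg k = 1" for i k
      using index_cases[of i] by (auto simp: \<phi>1_gen unit_vec_eq_0 root_of_def split: if_splits)
    show "\<phi>1 (gg (GY i)) k \<noteq> 0 \<Longrightarrow> idx_deg k = - 1" for i k
      using index_cases[of i] by (auto simp: \<phi>1_gen unit_vec_eq_0 root_of_def split: if_splits)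
    show "t \<in> gg ` (range GH \<union> range GD) \<Longrightarrow> \<phi>1 t k \<noteq> 0 \<Longrightarrow> idx_deg k = 0" for t k
      by (auto simp: \<phi>1_gen unit_vec_eq_0 split: if_splits)
    show "vspan gt {u. \<exists>d. homog gt gt.gens d u} = vcarrier gt" by (rule g_tilde_generated)
    show "homog gt gt.gens (idx_deg i) (lift i)" "\<phi>1 (lift i) = unit_vec i" for i
      by (rule lift_homog) (rule \<phi>1_lift)
    show "u \<in> vspan gt (gg ` (range GH \<union> range GD)) \<Longrightarrow> \<phi>1 u = (\<lambda>k. 0) \<Longrightarrow> u = vzero gt" for u
      by (rule torus_span)
  next
    fix d :: int and f :: "idx \<Rightarrow> 'k"
    assume d: "d > 0" and f: "\<And>k. f k \<noteq> 0 \<Longrightarrow> idx_deg k = d" and y: "\<And>i. sc_bracket Sw (\<phi>1 (gg (GY i))) f = (\<lambda>k. 0)"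
    have "sc_bracket Sw (unit_vec (Neg R1)) f = (\<lambda>k. 0)" "sc_bracket Sw (unit_vec (Neg R2)) f = (\<lambda>k. 0)"
      "sc_bracket Sw (unit_vec (Neg R3)) f = (\<lambda>k. 0)"
      using y[of 1] y[of 2] y[of 3] by (simp_all add: \<phi>1_gen root_of_def)
    then have z: "f (Pos r) = 0" for r
      using detect(1-7)[of f] \<alpha>_0 a1 by (cases r) simp_all
    have "f k = 0" for k
      using f[of k] d z idx_deg_sign(1)[of k] by metis
    then show "f = (\<lambda>k. 0)" by blast
  next
    fix d :: int and f :: "idx \<Rightarrow> 'k"
    assume d: "d < 0" and f: "\<And>k. f k \<noteq> 0 \<Longrightarrow> idx_deg k = d" and x: "\<And>i. sc_bracket Sw (\<phi>1 (gg (GX i))) f = (\<lambda>k. 0)"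
    have "sc_bracket Sw (unit_vec (Pos R1)) f = (\<lambda>k. 0)" "sc_bracket Sw (unit_vec (Pos R2)) f = (\<lambda>k. 0)"
      "sc_bracket Sw (unit_vec (Pos R3)) f = (\<lambda>k. 0)"
      using x[of 1] x[of 2] x[of 3] by (simp_all add: \<phi>1_gen root_of_def)
    then have z: "f (Neg r) = 0" for r
      using detect(8-14)[of f] \<alpha>_0 a1 by (cases r) simp_all
    have "f k = 0" for k
      using f[of k] d z idx_deg_sign(2)[of k] by metis
    then show "f = (\<lambda>k. 0)" by blast
  qed
  then show ?thesis unfolding max_ideal_def g_tilde_gens .
qed

abbreviation "\<phi> \<equiv> quot_map \<phi>1"

lemma wk_eq: "wk \<alpha> = lie_quot gt (kernel gt \<phi>1)"
  by (simp add: wk_def g_cartan_def max_ideal_kernel)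

lemma gens_eq: "g_cartan_gen (wk_matrix \<alpha>) (wk_grading :: 'k^3^1) g = vcoset gt (kernel gt \<phi>1) (gg g)"
  by (simp add: g_cartan_gen_def max_ideal_kernel)

lemma kernel_is_ideal: "lie_ideal gt (kernel gt \<phi>1)"
  by (rule kernel_ideal[OF gt.algebra_axioms \<phi>1_hom])

lemma lie_algebra_wk: "lie_algebra (wk \<alpha>)"
  unfolding wk_eq by (rule lie_algebra_quot[OF gt.lie_algebra_axioms kernel_is_ideal])

lemma \<phi>_hom: "coord_hom (wk \<alpha>) Sw \<phi>"
  unfolding wk_eq by (rule coord_hom_quot[OF gt.algebra_axioms \<phi>1_hom kernel_is_ideal order.refl])

lemma \<phi>_inj: "inj_on \<phi> (vcarrier (wk \<alpha>))"
  unfolding wk_eq by (rule quot_map_inj[OF gt.algebra_axioms \<phi>1_hom])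

lemma wk_vec_lift: "wk_vec \<alpha> (idx_label i) = vcoset gt (kernel gt \<phi>1) (lift i)"
proof -
  note b = gt.lie_quot_bracket[OF kernel_is_ideal]
  show ?thesis
  proof (cases i)
    case (Pos r)
    then show ?thesis
      by (cases r) (simp_all add: idx_label.simps Let_def root_vector_def gens_eq wk_eq b)
  next
    case (Neg r)
    then show ?thesis
      by (cases r) (simp_all add: idx_label.simps Let_def root_vector_def gens_eq wk_eq b)
  next
    case (Tor t) then show ?thesis by (cases t) (simp_all add: idx_label.simps Let_def gens_eq)
  qed
qed

lemma wk_vec_facts:
  "wk_vec \<alpha> (idx_label i) \<in> vcarrier (wk \<alpha>)" "\<phi> (wk_vec \<alpha> (idx_label i)) = unit_vec i"
proof -
  have U: "vsubspace gt (kernel gt \<phi>1)" using kernel_is_ideal by (simp add: lie_ideal_def)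
  show "wk_vec \<alpha> (idx_label i) \<in> vcarrier (wk \<alpha>)"
    unfolding wk_vec_lift unfolding wk_eq by (simp add: gt.vquot_carrier del: lift.simps)
  show "\<phi> (wk_vec \<alpha> (idx_label i)) = unit_vec i"
    unfolding wk_vec_lift quot_map_coset[OF gt.algebra_axioms \<phi>1_hom U order.refl lift_in] by (rule \<phi>1_lift)
qed

lemma labels_idx:
  "labels {1..4} = idx_label ` set idx_wk" "labels {1..3} = idx_label ` set idx_derived" "labels {2, 3} = idx_label ` set idx_quot"
proof -
  have 7: "{1..7::nat} = {1, 2, 3, 4, 5, 6, 7}" and 4: "{1..4::nat} = {1, 2, 3, 4}" and 3: "{1..3::nat} = {1, 2, 3}" by auto
  show "labels {1..4} = idx_label ` set idx_wk"
    unfolding labels_def 7 4 by (auto simp: idx_wk_def idx_label.simps)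
  show "labels {1..3} = idx_label ` set idx_derived"
    unfolding labels_def 7 3 by (auto simp: idx_derived_def idx_wk_def idx_label.simps)
  show "labels {2, 3} = idx_label ` set idx_quot"
    unfolding labels_def 7 by (auto simp: idx_quot_def idx_derived_def idx_wk_def idx_label.simps)
qed

sublocale wk: wk_like \<alpha> "wk \<alpha>" idx_wk br_wk "wk_vec \<alpha>" \<phi> "{1..4}"
proof -
  interpret lie_algebra "wk \<alpha>" by (rule lie_algebra_wk)
  show "wk_like \<alpha> (wk \<alpha>) idx_wk br_wk (wk_vec \<alpha>) \<phi> {1..4}"
    by unfold_locales (use \<phi>_hom \<phi>_inj wk_vec_facts all_idx table_ok_wk labels_idx in auto)
qed

end

lemma derived_alg_simps [simp]:
  "vzero (derived_alg L) = vzero L" "vadd (derived_alg L) = vadd L" "vscale (derived_alg L) = vscale L"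
  "bracket (derived_alg L) = bracket L"
  "vcarrier (derived_alg L) = vspan L {bracket L x y | x y. x \<in> vcarrier L \<and> y \<in> vcarrier L}"
  by (simp_all add: derived_alg_def)

context params
begin

section \<open>The derived algebra\<close>

lemma unit_vec_apply: "unit_vec i k = (if k = i then 1 else 0)"
  by (simp add: unit_vec_def)

lemma Sw_T4: "Sw i j (Tor T4) = 0"
proof -
  have "list_all (\<lambda>i. list_all (\<lambda>j. Tor T4 \<notin> snd ` set (br_wk i j)) idx_wk) idx_wk" by code_simp
  then have "Tor T4 \<notin> snd ` set (br_wk i j)" using all_idx by (auto simp: list_all_iff)
  then show ?thesis by (simp add: sc_def val_def coef_not_in)
qed

lemma bracket_source:
  assumes "i \<in> set idx_derived" shows "\<exists>j k. Sw j k = unit_vec i"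
proof -
  have s: "Sw (Tor T4) (Pos R1) = unit_vec (Pos R1)" "Sw (Tor T3) (Pos R2) = unit_vec (Pos R2)" "Sw (Tor T2) (Pos R3) = unit_vec (Pos R3)"
    "Sw (Tor T4) (Neg R1) = unit_vec (Neg R1)" "Sw (Tor T3) (Neg R2) = unit_vec (Neg R2)" "Sw (Tor T2) (Neg R3) = unit_vec (Neg R3)"
    "Sw (Pos R1) (Pos R2) = unit_vec (Pos R4)" "Sw (Pos R2) (Pos R3) = unit_vec (Pos R5)"
    "Sw (Pos R3) (Pos R4) = unit_vec (Pos R6)" "Sw (Pos R4) (Pos R5) = unit_vec (Pos R7)"
    "Sw (Neg R1) (Neg R2) = unit_vec (Neg R4)" "Sw (Neg R2) (Neg R3) = unit_vec (Neg R5)"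
    "Sw (Neg R3) (Neg R4) = unit_vec (Neg R6)" "Sw (Neg R4) (Neg R5) = unit_vec (Neg R7)"
    "Sw (Pos R1) (Neg R1) = unit_vec (Tor T1)" "Sw (Pos R2) (Neg R2) = unit_vec (Tor T2)" "Sw (Pos R3) (Neg R3) = unit_vec (Tor T3)"
    by (auto simp: fun_eq_iff sc_def pos_neg_def val_Cons unit_vec_apply)
  have "i \<in> {Pos R1, Pos R2, Pos R3, Pos R4, Pos R5, Pos R6, Pos R7, Neg R1, Neg R2, Neg R3, Neg R4, Neg R5, Neg R6, Neg R7,
      Tor T1, Tor T2, Tor T3}" using assms by (auto simp: idx_derived_def idx_wk_def)
  then show ?thesis by (elim insertE emptyE; hypsubst; blast intro: s)
qed

lemma wk1_simps [simp]:
  "vzero (wk1 \<alpha>) = vzero (wk \<alpha>)" "vadd (wk1 \<alpha>) = vadd (wk \<alpha>)" "vscale (wk1 \<alpha>) = vscale (wk \<alpha>)"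
  "bracket (wk1 \<alpha>) = bracket (wk \<alpha>)"
  by (simp_all add: wk1_def)

lemma \<phi>_T4: "x \<in> vcarrier (wk \<alpha>) \<Longrightarrow> y \<in> vcarrier (wk \<alpha>) \<Longrightarrow> \<phi> (bracket (wk \<alpha>) x y) (Tor T4) = 0"
  by (simp add: wk.\<phi>_bracket sc_bracket_def Sw_T4)

lemma wk1_carrier: "vcarrier (wk1 \<alpha>) = {v \<in> vcarrier (wk \<alpha>). \<phi> v (Tor T4) = 0}"
proof -
  let ?B = "{bracket (wk \<alpha>) x y | x y. x \<in> vcarrier (wk \<alpha>) \<and> y \<in> vcarrier (wk \<alpha>)}"
  have B: "?B \<subseteq> vcarrier (wk \<alpha>)" by auto
  have U: "vsubspace (wk \<alpha>) (vspan (wk \<alpha>) ?B)" by (rule wk.vspan_subspace[OF B])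
  have "vspan (wk \<alpha>) ?B \<subseteq> {v \<in> vcarrier (wk \<alpha>). \<phi> v (Tor T4) = 0}"
    by (rule vspan_least) (auto simp: vsubspace_def \<phi>_T4)
  moreover have "v \<in> vspan (wk \<alpha>) ?B" if v: "v \<in> vcarrier (wk \<alpha>)" "\<phi> v (Tor T4) = 0" for v
  proof (rule wk.span_support[where A = "set idx_derived"])
    fix i assume "i \<in> set idx_derived"
    then obtain j k where jk: "Sw j k = unit_vec i" using bracket_source by blast
    have "wk_vec \<alpha> (idx_label i) = bracket (wk \<alpha>) (wk_vec \<alpha> (idx_label j)) (wk_vec \<alpha> (idx_label k))"
      by (rule wk.eqI) (simp_all add: wk_vec_facts wk.\<phi>_bracket sc_bracket_unit jk)
    then have "wk_vec \<alpha> (idx_label i) \<in> ?B" using wk_vec_facts by blast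
    then show "wk_vec \<alpha> (idx_label i) \<in> vspan (wk \<alpha>) ?B" using vspan_superset[of ?B "wk \<alpha>"] by blast
  next
    fix i assume "\<phi> v i \<noteq> 0"
    then have "i \<noteq> Tor T4" using v by auto
    then show "i \<in> set idx_derived" using all_idx[of i] by (simp add: idx_derived_def)
  qed (use U v in auto)
  ultimately show ?thesis by (auto simp: wk1_def)
qed

lemma lie_algebra_wk1: "lie_algebra (wk1 \<alpha>)"
proof -
  have m: "x \<in> vcarrier (wk \<alpha>)" if "x \<in> vcarrier (wk1 \<alpha>)" for x using that by (simp add: wk1_carrier)
  have c: "vzero (wk \<alpha>) \<in> vcarrier (wk1 \<alpha>)"
    "\<And>u v. u \<in> vcarrier (wk1 \<alpha>) \<Longrightarrow> v \<in> vcarrier (wk1 \<alpha>) \<Longrightarrow> vadd (wk \<alpha>) u v \<in> vcarrier (wk1 \<alpha>)"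
    "\<And>a u. u \<in> vcarrier (wk1 \<alpha>) \<Longrightarrow> vscale (wk \<alpha>) a u \<in> vcarrier (wk1 \<alpha>)"
    "\<And>u v. u \<in> vcarrier (wk1 \<alpha>) \<Longrightarrow> v \<in> vcarrier (wk1 \<alpha>) \<Longrightarrow> bracket (wk \<alpha>) u v \<in> vcarrier (wk1 \<alpha>)"
    by (simp_all add: wk1_carrier \<phi>_T4)
  note laws = wk.add_assoc wk.add_zero wk.scale_add wk.add_scale wk.scale_scale wk.scale_one wk.scale_zero
    wk.bracket_add_left wk.bracket_add_right wk.bracket_scale_left wk.bracket_scale_right wk.alternating wk.jacobi wk.add_commute
  show ?thesis
    by (unfold_locales; unfold wk1_simps; rule c laws; (assumption | (rule m, assumption)))
qed

lemma \<phi>_hom1: "coord_hom (wk1 \<alpha>) Sw \<phi>"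
  using \<phi>_hom by (auto simp: coord_hom_def wk1_carrier)

lemma idx_derived_iff: "i \<in> set idx_derived \<longleftrightarrow> i \<noteq> Tor T4"
  using all_idx[of i] by (auto simp: idx_derived_def)

sublocale der: wk_like \<alpha> "wk1 \<alpha>" idx_derived br_wk "wk_vec \<alpha>" \<phi> "{1..3}"
proof -
  interpret lie_algebra "wk1 \<alpha>" by (rule lie_algebra_wk1)
  have "inj_on \<phi> (vcarrier (wk1 \<alpha>))" by (rule inj_on_subset[OF \<phi>_inj]) (auto simp: wk1_carrier)
  moreover have "wk_vec \<alpha> (idx_label i) \<in> vcarrier (wk1 \<alpha>)" if "i \<in> set idx_derived" for i
    using that by (auto simp: wk1_carrier wk_vec_facts unit_vec_apply idx_derived_iff)
  ultimately show "wk_like \<alpha> (wk1 \<alpha>) idx_derived br_wk (wk_vec \<alpha>) \<phi> {1..3}"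
    by unfold_locales (use \<phi>_hom1 wk_vec_facts table_ok_derived labels_idx in \<open>auto simp: idx_derived_iff wk1_carrier\<close>)
qed

section \<open>The center and the quotient by it\<close>

abbreviation "Sq \<equiv> sc \<alpha> br_quot"

definition proj :: "(idx \<Rightarrow> 'k) \<Rightarrow> idx \<Rightarrow> 'k" where
  "proj f = (\<lambda>k. if k = Tor T1 then 0 else if k = Tor T3 then f (Tor T3) + \<alpha> * f (Tor T1) else f k)"

lemma proj_apply: "proj f k = (if k = Tor T1 then 0 else if k = Tor T3 then f (Tor T3) + \<alpha> * f (Tor T1) else f k)"
  by (simp add: proj_def)

lemma proj_linear: "proj (\<lambda>u. f u + g u) = (\<lambda>u. proj f u + proj g u)" "proj (\<lambda>u. a * f u) = (\<lambda>u. a * proj f u)"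
  by (auto simp: proj_apply fun_eq_iff algebra_simps)

lemma proj_unit: "i \<noteq> Tor T1 \<Longrightarrow> proj (unit_vec i) = unit_vec i" "proj (unit_vec (Tor T1)) = (\<lambda>u. \<alpha> * unit_vec (Tor T3) u)"
  by (auto simp: proj_apply fun_eq_iff unit_vec_apply)

lemma val_quot: "val \<alpha> (map (\<lambda>(a, k). if k = Tor T1 then (pmul c\<alpha> a, Tor T3) else (a, k)) vs) u = proj (val \<alpha> vs) u"
proof (induction vs)
  case (Cons p vs)
  then show ?case by (cases p) (auto simp: val_Cons ev_pmul proj_apply algebra_simps simp del: pmul.simps)
qed (simp add: proj_apply)

lemma Sw_T1: "Sw (Tor T1) j u = \<alpha> * Sw (Tor T3) j u"
proof (cases j)
  case (Pos r) then show ?thesis by (cases "root_weight r") (auto simp: sc_def val_Cons)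
next
  case (Neg r) then show ?thesis by (cases "root_weight r") (auto simp: sc_def val_Cons)
qed (simp add: sc_def)

lemma proj_bracket: "proj (sc_bracket Sw f g) = sc_bracket Sq (proj f) (proj g)"
proof
  fix u
  let ?F = "\<lambda>f g. proj (sc_bracket Sw f g) u + sc_bracket Sq (proj f) (proj g) u"
  have lin: "sc_bracket S (\<lambda>u. f u + g u) h = (\<lambda>u. sc_bracket S f h u + sc_bracket S g h u)"
    "sc_bracket S h (\<lambda>u. f u + g u) = (\<lambda>u. sc_bracket S h f u + sc_bracket S h g u)"
    "sc_bracket S (\<lambda>u. a * f u) h = (\<lambda>u. a * sc_bracket S f h u)"
    "sc_bracket S h (\<lambda>u. a * f u) = (\<lambda>u. a * sc_bracket S h f u)" for S :: "idx \<Rightarrow> idx \<Rightarrow> idx \<Rightarrow> 'k" and f g h a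
    by (simp_all add: fun_eq_iff sc_bracket_add_left sc_bracket_add_right sc_bracket_scale_left sc_bracket_scale_right)
  have unit: "sc_bracket S (unit_vec i) (unit_vec j) = S i j" for S :: "idx \<Rightarrow> idx \<Rightarrow> idx \<Rightarrow> 'k" and i j
    by (rule ext) (rule sc_bracket_unit)
  have Sq: "Sq i j = proj (Sw i j)" for i j
    by (rule ext) (simp add: sc_def br_quot_def val_quot[unfolded sc_def] , simp add: sc_def[abs_def])
  have T1: "proj (Sw (Tor T1) j) = (\<lambda>u. \<alpha> * proj (Sw (Tor T3) j) u)" "proj (Sw j (Tor T1)) = (\<lambda>u. \<alpha> * proj (Sw j (Tor T3)) u)" for j
  proof -
    have "Sw (Tor T1) j = (\<lambda>u. \<alpha> * Sw (Tor T3) j u)" by (rule ext) (rule Sw_T1)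
    then show "proj (Sw (Tor T1) j) = (\<lambda>u. \<alpha> * proj (Sw (Tor T3) j) u)" by (simp add: proj_linear)
    have "Sw j (Tor T1) = (\<lambda>u. \<alpha> * Sw j (Tor T3) u)" by (rule ext) (metis Sw_T1 Sw_sym)
    then show "proj (Sw j (Tor T1)) = (\<lambda>u. \<alpha> * proj (Sw j (Tor T3)) u)" by (simp add: proj_linear)
  qed
  have uu: "?F (unit_vec i) (unit_vec j) = 0" for i j
    by (cases "i = Tor T1"; cases "j = Tor T1") (simp_all add: proj_unit lin unit Sq T1)
  have 1: "?F f (unit_vec j) = 0" for f j
    by (rule linear_functional_zero[of "\<lambda>f. ?F f (unit_vec j)"]) (simp_all only: lin proj_linear uu, simp_all add: algebra_simps)
  have "?F f g = 0"
    by (rule linear_functional_zero[of "\<lambda>g. ?F f g"]) (simp_all only: lin proj_linear 1, simp_all add: algebra_simps)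
  then show "proj (sc_bracket Sw f g) u = sc_bracket Sq (proj f) (proj g) u" by simp
qed

abbreviation "\<phi>c \<equiv> \<lambda>v. proj (\<phi> v)"

lemma \<phi>c_hom: "coord_hom (wk1 \<alpha>) Sq \<phi>c"
  using coord_homD[OF \<phi>_hom1] by (auto simp: coord_hom_def proj_linear proj_bracket)

abbreviation "cen \<equiv> vadd (wk1 \<alpha>) (wk_vec \<alpha> (H 1)) (vscale (wk1 \<alpha>) \<alpha> (wk_vec \<alpha> (H 3)))"

lemma cen: "cen \<in> vcarrier (wk1 \<alpha>)" "\<phi> cen k = unit_vec (Tor T1) k + \<alpha> * unit_vec (Tor T3) k"
proof -
  have h: "wk_vec \<alpha> (H 1) = wk_vec \<alpha> (idx_label (Tor T1))" "wk_vec \<alpha> (H 3) = wk_vec \<alpha> (idx_label (Tor T3))"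
    by (simp_all add: idx_label.simps)
  show "\<phi> cen k = unit_vec (Tor T1) k + \<alpha> * unit_vec (Tor T3) k"
    unfolding h wk1_simps using wk_vec_facts by simp
  show "cen \<in> vcarrier (wk1 \<alpha>)"
    unfolding h by (intro der.add_in der.scale_in der.e_in) (simp_all add: idx_derived_iff)
qed

lemma kernel_\<phi>c: "v \<in> kernel (wk1 \<alpha>) \<phi>c \<longleftrightarrow> v \<in> vcarrier (wk1 \<alpha>) \<and>
    (\<forall>k. \<phi> v k = \<phi> v (Tor T1) * (unit_vec (Tor T1) k + \<alpha> * unit_vec (Tor T3) k))"
proof -
  have "proj f = (\<lambda>k. 0) \<longleftrightarrow> (\<forall>k. f k = f (Tor T1) * (unit_vec (Tor T1) k + \<alpha> * unit_vec (Tor T3) k))" (is "_ \<longleftrightarrow> ?R") for f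
  proof
    assume p: "proj f = (\<lambda>k. 0)"
    show ?R
    proof
      fix k show "f k = f (Tor T1) * (unit_vec (Tor T1) k + \<alpha> * unit_vec (Tor T3) k)"
        using fun_cong[OF p, of k] by (auto simp: proj_apply unit_vec_apply split: if_splits)
    qed
  next
    assume R: ?R
    show "proj f = (\<lambda>k. 0)"
    proof
      fix k show "proj f k = 0"
        using R[rule_format, of k] R[rule_format, of "Tor T3"] by (auto simp: proj_apply unit_vec_apply)
    qed
  qed
  then show ?thesis by (auto simp: kernel_def)
qed

lemma wk_c_kernel: "wk_c \<alpha> = kernel (wk1 \<alpha>) \<phi>c"
proof (rule equalityI)
  have K: "vsubspace (wk1 \<alpha>) (kernel (wk1 \<alpha>) \<phi>c)"
    using kernel_ideal[OF der.algebra_axioms \<phi>c_hom] by (simp add: lie_ideal_def)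
  have "cen \<in> kernel (wk1 \<alpha>) \<phi>c"
    unfolding kernel_\<phi>c using cen(1) by (simp only: cen(2)) (auto simp: unit_vec_apply)
  then show "wk_c \<alpha> \<subseteq> kernel (wk1 \<alpha>) \<phi>c"
    unfolding wk_c_def by (intro vspan_least[OF K]) simp
  have c: "{cen} \<subseteq> vcarrier (wk1 \<alpha>)" using cen(1) by simp
  show "kernel (wk1 \<alpha>) \<phi>c \<subseteq> wk_c \<alpha>"
  proof
    fix v assume v: "v \<in> kernel (wk1 \<alpha>) \<phi>c"
    have eq: "v = vscale (wk1 \<alpha>) (\<phi> v (Tor T1)) cen"
    proof (rule der.eqI)
      fix k
      have "\<phi> v k = \<phi> v (Tor T1) * (unit_vec (Tor T1) k + \<alpha> * unit_vec (Tor T3) k)" using v unfolding kernel_\<phi>c by blast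
      then show "\<phi> v k = \<phi> (vscale (wk1 \<alpha>) (\<phi> v (Tor T1)) cen) k"
        using der.\<phi>_simps(3)[OF cen(1)] by (simp only: cen(2))
    qed (use v cen(1) in \<open>auto simp: kernel_def simp del: wk1_simps\<close>)
    have "cen \<in> vspan (wk1 \<alpha>) {cen}" by (rule subsetD[OF vspan_superset]) (rule singletonI)
    then have "vscale (wk1 \<alpha>) (\<phi> v (Tor T1)) cen \<in> vspan (wk1 \<alpha>) {cen}"
      by (rule vsubspaceD(4)[OF der.vspan_subspace[OF c]])
    then show "v \<in> wk_c \<alpha>" unfolding wk_c_def by (subst eq)
  qed
qed

lemma detect_torus:
  "sc_bracket Sw (unit_vec (Pos R2)) f (Pos R2) = f (Tor T3) + \<alpha> * f (Tor T1)"
  "sc_bracket Sw (unit_vec (Pos R3)) f (Pos R3) = f (Tor T2)"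
  by (simp_all add: sc_bracket_unit_left UNIV_idx idx_wk_def sc_def pos_neg_def val_Cons mult.commute add.commute)

lemma wk_c_center: "wk_c \<alpha> = lie_center (wk1 \<alpha>)"
proof (rule equalityI)
  show "wk_c \<alpha> \<subseteq> lie_center (wk1 \<alpha>)"
  proof
    fix v assume "v \<in> wk_c \<alpha>"
    then have v: "v \<in> vcarrier (wk1 \<alpha>)" "\<phi> v = (\<lambda>k. \<phi> v (Tor T1) * (unit_vec (Tor T1) k + \<alpha> * unit_vec (Tor T3) k))"
      unfolding wk_c_kernel kernel_\<phi>c by blast+
    have "bracket (wk1 \<alpha>) v y = vzero (wk1 \<alpha>)" if y: "y \<in> vcarrier (wk1 \<alpha>)" for y
    proof (rule der.eqI)
      fix k
      have "\<phi> (bracket (wk1 \<alpha>) v y) k = sc_bracket Sw (\<phi> v) (\<phi> y) k" by (rule der.\<phi>_bracket[OF v(1) y])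
      also have "\<dots> = \<phi> v (Tor T1) * (sc_bracket Sw (unit_vec (Tor T1)) (\<phi> y) k + \<alpha> * sc_bracket Sw (unit_vec (Tor T3)) (\<phi> y) k)"
        by (subst v(2)) (simp only: sc_bracket_scale_left sc_bracket_add_left)
      also have "\<dots> = 0"
        by (simp add: sc_bracket_unit_left Sw_T1 sum_distrib_left mult.left_commute)
      finally show "\<phi> (bracket (wk1 \<alpha>) v y) k = \<phi> (vzero (wk1 \<alpha>)) k" by (simp only: der.\<phi>_simps(1))
    qed (use v y in \<open>simp_all only: der.bracket_in der.zero_in\<close>)
    then show "v \<in> lie_center (wk1 \<alpha>)" using v(1) by (simp add: lie_center_def del: wk1_simps)
  qed
  show "lie_center (wk1 \<alpha>) \<subseteq> wk_c \<alpha>"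
  proof
    fix v assume v: "v \<in> lie_center (wk1 \<alpha>)"
    let ?f = "\<phi> v"
    have vc: "v \<in> vcarrier (wk1 \<alpha>)" using v by (simp add: lie_center_def)
    have z: "sc_bracket Sw (unit_vec i) ?f k = 0" if i: "i \<in> set idx_derived" for i k
    proof -
      have "bracket (wk1 \<alpha>) v (wk_vec \<alpha> (idx_label i)) = vzero (wk1 \<alpha>)"
        using v der.e_in[OF i] by (simp add: lie_center_def del: wk1_simps)
      then have "bracket (wk1 \<alpha>) (wk_vec \<alpha> (idx_label i)) v = vscale (wk1 \<alpha>) (- 1) (vzero (wk1 \<alpha>))"
        using der.bracket_skew[OF vc der.e_in[OF i]] by simp
      then show ?thesis
        using der.\<phi>_bracket[OF der.e_in[OF i] vc, of k] der.\<phi>_e[OF i] der.\<phi>_simps(1)[of k] der.scale_vzero[of "- 1"] by simp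
    qed
    have a1: "1 + \<alpha> \<noteq> 0" using \<alpha>_1 by auto
    have zz: "sc_bracket Sw (unit_vec (Pos r)) ?f k = 0" "sc_bracket Sw (unit_vec (Neg r)) ?f k = 0" for r k
      by (rule z, simp add: idx_derived_iff)+
    have r: "?f (Pos r) = 0" "?f (Neg r) = 0" for r
      using detect[of ?f] \<alpha>_0 a1 unfolding zz by (cases r; simp)+
    have t: "?f (Tor T3) = \<alpha> * ?f (Tor T1)" "?f (Tor T2) = 0" "?f (Tor T4) = 0"
      using detect_torus[of ?f] vc unfolding zz by (simp_all add: wk1_carrier)
    have "?f k = ?f (Tor T1) * (unit_vec (Tor T1) k + \<alpha> * unit_vec (Tor T3) k)" for k
    proof (cases k)
      case (Tor s) then show ?thesis using t by (cases s) (simp_all add: unit_vec_apply)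
    qed (simp_all add: r unit_vec_apply)
    then show "v \<in> wk_c \<alpha>" unfolding wk_c_kernel kernel_\<phi>c using vc by blast
  qed
qed

lemma wk_c_ideal: "lie_ideal (wk1 \<alpha>) (wk_c \<alpha>)" "vsubspace (wk1 \<alpha>) (wk_c \<alpha>)"
  unfolding wk_c_kernel using kernel_ideal[OF der.algebra_axioms \<phi>c_hom] by (simp_all add: lie_ideal_def)

lemma idx_quot_iff: "i \<in> set idx_quot \<longleftrightarrow> i \<noteq> Tor T4 \<and> i \<noteq> Tor T1"
  using idx_derived_iff[of i] by (auto simp: idx_quot_def)

lemma quot_map_\<phi>c: "v \<in> vcarrier (wk1 \<alpha>) \<Longrightarrow> quot_map \<phi>c (vcoset (wk1 \<alpha>) (wk_c \<alpha>) v) = \<phi>c v"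
  by (rule quot_map_coset[OF der.algebra_axioms \<phi>c_hom wk_c_ideal(2)]) (simp add: wk_c_kernel)

lemma wkq_carrier: "vcarrier (wkq \<alpha>) = vcoset (wk1 \<alpha>) (wk_c \<alpha>) ` vcarrier (wk1 \<alpha>)"
  unfolding wkq_def lie_quot_simps by (rule der.vquot_carrier)

sublocale quo: wk_like \<alpha> "wkq \<alpha>" idx_quot br_quot "wkq_vec \<alpha>" "quot_map \<phi>c" "{2, 3}"
proof -
  interpret lie_algebra "wkq \<alpha>" unfolding wkq_def by (rule lie_algebra_quot[OF der.lie_algebra_axioms wk_c_ideal(1)])
  show "wk_like \<alpha> (wkq \<alpha>) idx_quot br_quot (wkq_vec \<alpha>) (quot_map \<phi>c) {2, 3}"
  proof unfold_locales
    show "coord_hom (wkq \<alpha>) Sq (quot_map \<phi>c)"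
      unfolding wkq_def by (rule coord_hom_quot[OF der.algebra_axioms \<phi>c_hom wk_c_ideal(1)]) (simp add: wk_c_kernel)
    show "inj_on (quot_map \<phi>c) (vcarrier (wkq \<alpha>))"
      unfolding wkq_def wk_c_kernel by (rule quot_map_inj[OF der.algebra_axioms \<phi>c_hom])
    show "table_ok br_quot idx_quot" by (rule table_ok_quot)
    show "labels {2, 3} = idx_label ` set idx_quot" by (rule labels_idx)
    show "br_quot = br_wk \<or> br_quot = br_quot" by simp
    fix u i assume "u \<in> vcarrier (wkq \<alpha>)" "i \<notin> set idx_quot"
    then show "quot_map \<phi>c u i = 0"
      by (auto simp: wkq_carrier quot_map_\<phi>c idx_quot_iff proj_apply wk1_carrier simp del: wk1_simps)
  next
    fix i assume i: "i \<in> set idx_quot"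
    then have e: "wk_vec \<alpha> (idx_label i) \<in> vcarrier (wk1 \<alpha>)" by (intro der.e_in) (simp add: idx_quot_iff idx_derived_iff)
    show "wkq_vec \<alpha> (idx_label i) \<in> vcarrier (wkq \<alpha>)" using e by (auto simp: wkq_vec_def wkq_carrier)
    show "quot_map \<phi>c (wkq_vec \<alpha> (idx_label i)) = unit_vec i"
      using i unfolding wkq_vec_def quot_map_\<phi>c[OF e] by (simp add: wk_vec_facts proj_unit idx_quot_iff)
  qed
qed

section \<open>The automorphism \<open>\<omega>\<close>\<close>

lemma \<phi>_surj: "\<phi> ` vcarrier (wk \<alpha>) = UNIV"
proof (rule coord_hom_surj[OF wk.algebra_axioms \<phi>_hom])
  fix i show "unit_vec i \<in> \<phi> ` vcarrier (wk \<alpha>)" using wk_vec_facts[of i] by (metis image_eqI)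
qed

definition om :: "'k wk_elem \<Rightarrow> 'k wk_elem" where
  "om = (\<lambda>v\<in>vcarrier (wk \<alpha>). inv_into (vcarrier (wk \<alpha>)) \<phi> (\<lambda>k. \<phi> v (swap_idx k)))"

lemma om: assumes "v \<in> vcarrier (wk \<alpha>)" shows "om v \<in> vcarrier (wk \<alpha>)" "\<phi> (om v) k = \<phi> v (swap_idx k)"
proof -
  have s: "(\<lambda>k. \<phi> v (swap_idx k)) \<in> \<phi> ` vcarrier (wk \<alpha>)" using \<phi>_surj by simp
  show "om v \<in> vcarrier (wk \<alpha>)" using inv_into_into[OF s] assms by (simp add: om_def)
  show "\<phi> (om v) k = \<phi> v (swap_idx k)" using f_inv_into_f[OF s] assms by (simp add: om_def)
qed

lemma om_om: "v \<in> vcarrier (wk \<alpha>) \<Longrightarrow> om (om v) = v"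
  by (rule wk.eqI) (simp_all add: om)

lemma om_bij: "bij_betw om (vcarrier (wk \<alpha>)) (vcarrier (wk \<alpha>))"
  by (rule bij_betw_byWitness[where f' = om]) (use om(1) om_om in blast)+

lemma swap_bracket: "sc_bracket Sw (\<lambda>i. f (swap_idx i)) (\<lambda>i. g (swap_idx i)) k = sc_bracket Sw f g (swap_idx k)"
proof -
  have "sc_bracket Sw (\<lambda>i. f (swap_idx i)) (\<lambda>i. g (swap_idx i)) k =
      (\<Sum>i\<in>UNIV. \<Sum>j\<in>UNIV. f (swap_idx i) * g (swap_idx j) * Sw (swap_idx i) (swap_idx j) (swap_idx k))"
    unfolding sc_bracket_def using sc_swap[of br_wk] by simp
  also have "\<dots> = (\<Sum>i\<in>UNIV. \<Sum>j\<in>UNIV. f (swap_idx i) * g j * Sw (swap_idx i) j (swap_idx k))"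
    by (rule sum.cong[OF refl], rule sym, rule sum_swap[symmetric])
  also have "\<dots> = sc_bracket Sw f g (swap_idx k)"
    unfolding sc_bracket_def by (rule sum_swap[of "\<lambda>i. \<Sum>j\<in>UNIV. f i * g j * Sw i j (swap_idx k)"])
  finally show ?thesis .
qed

lemma gen_labels:
  "i \<in> {1..3} \<Longrightarrow> \<exists>r\<in>{R1, R2, R3}. X i = idx_label (Pos r) \<and> Y i = idx_label (Neg r)"
  "k \<in> {1..4} \<Longrightarrow> \<exists>t. H k = idx_label (Tor t)"
proof -
  assume "i \<in> {1..3}"
  then have "i = 1 \<or> i = 2 \<or> i = 3" by auto
  then show "\<exists>r\<in>{R1, R2, R3}. X i = idx_label (Pos r) \<and> Y i = idx_label (Neg r)" by (auto simp: idx_label.simps)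
next
  assume "k \<in> {1..4}"
  then have "k = 1 \<or> k = 2 \<or> k = 3 \<or> k = 4" by auto
  then show "\<exists>t. H k = idx_label (Tor t)"
    by (elim disjE) (rule exI[of _ T1] exI[of _ T2] exI[of _ T3] exI[of _ T4], simp add: idx_label.simps)+
qed

lemma om_vec: "om (wk_vec \<alpha> (idx_label i)) = wk_vec \<alpha> (idx_label (swap_idx i))"
  by (rule wk.eqI) (simp_all add: om wk_vec_facts unit_vec_apply swap_eq)

lemma om_is_omega: "is_wk_omega \<alpha> om"
proof -
  note om_bij
  moreover have "vlinear (wk \<alpha>) (wk \<alpha>) om"
    by (rule wk.vlinearI) (auto simp: om wk.linear_form_def)
  moreover have "om (bracket (wk \<alpha>) x y) = bracket (wk \<alpha>) (om x) (om y)" if "x \<in> vcarrier (wk \<alpha>)" "y \<in> vcarrier (wk \<alpha>)" for x y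
  proof (rule wk.eqI)
    fix k
    have "\<phi> (om x) = (\<lambda>k. \<phi> x (swap_idx k))" "\<phi> (om y) = (\<lambda>k. \<phi> y (swap_idx k))" using that by (auto simp: om)
    then show "\<phi> (om (bracket (wk \<alpha>) x y)) k = \<phi> (bracket (wk \<alpha>) (om x) (om y)) k"
      using that by (simp add: om wk.\<phi>_bracket swap_bracket)
  qed (use that in \<open>auto simp: om\<close>)
  ultimately have "lie_aut (wk \<alpha>) om" by (simp add: lie_aut_def)
  moreover have "om \<in> extensional (vcarrier (wk \<alpha>))" by (simp add: om_def)
  moreover have "om (wk_vec \<alpha> (X i)) = wk_vec \<alpha> (Y i) \<and> om (wk_vec \<alpha> (Y i)) = wk_vec \<alpha> (X i)" if "i \<in> {1..3}" for i
    using gen_labels(1)[OF that] om_vec by force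
  moreover have "om (wk_vec \<alpha> (H k)) = wk_vec \<alpha> (H k)" if "k \<in> {1..4}" for k
    using gen_labels(2)[OF that] om_vec by force
  ultimately show ?thesis by (simp add: is_wk_omega_def)
qed

lemma omega_unique:
  assumes "is_wk_omega \<alpha> \<omega>" shows "\<omega> = om"
proof (rule extensionalityI[of _ "vcarrier (wk \<alpha>)"])
  show "\<omega> \<in> extensional (vcarrier (wk \<alpha>))" "om \<in> extensional (vcarrier (wk \<alpha>))"
    using assms by (simp_all add: is_wk_omega_def om_def)
  have aut: "vlinear (wk \<alpha>) (wk \<alpha>) \<omega>"
    "\<And>x y. x \<in> vcarrier (wk \<alpha>) \<Longrightarrow> y \<in> vcarrier (wk \<alpha>) \<Longrightarrow> \<omega> (bracket (wk \<alpha>) x y) = bracket (wk \<alpha>) (\<omega> x) (\<omega> y)"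
    using assms by (simp_all add: is_wk_omega_def lie_aut_def)
  let ?P = "\<lambda>i. \<omega> (wk_vec \<alpha> (idx_label i)) = wk_vec \<alpha> (idx_label (swap_idx i))"
  have g: "?P (Pos r) \<and> ?P (Neg r)" if "r \<in> {R1, R2, R3}" for r
  proof -
    have "\<forall>i\<in>{1..3}. \<omega> (wk_vec \<alpha> (X i)) = wk_vec \<alpha> (Y i) \<and> \<omega> (wk_vec \<alpha> (Y i)) = wk_vec \<alpha> (X i)"
      using assms by (simp add: is_wk_omega_def)
    from bspec[OF this, of 1] bspec[OF this, of 2] bspec[OF this, of 3] show ?thesis
      using that by (auto simp: idx_label.simps simp del: wk_vec.simps)
  qed
  have p: "?P (Pos t) \<and> ?P (Neg t)" if "root_add r s = Some t" "?P (Pos r) \<and> ?P (Neg r)" "?P (Pos s) \<and> ?P (Neg s)" for r s t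
  proof -
    note b = wk.S_root_add[OF that(1)]
    have "\<omega> (wk_vec \<alpha> (idx_label (Pos t))) = wk_vec \<alpha> (idx_label (Neg t))"
      unfolding b(1)[symmetric] using aut(2) that(2,3) wk_vec_facts(1) b(2) by simp
    moreover have "\<omega> (wk_vec \<alpha> (idx_label (Neg t))) = wk_vec \<alpha> (idx_label (Pos t))"
      unfolding b(2)[symmetric] using aut(2) that(2,3) wk_vec_facts(1) b(1) by simp
    ultimately show ?thesis by simp
  qed
  have r4: "?P (Pos R4) \<and> ?P (Neg R4)" by (rule p[of R1 R2, OF _ g g]) auto
  have r5: "?P (Pos R5) \<and> ?P (Neg R5)" by (rule p[of R2 R3, OF _ g g]) auto
  have r6: "?P (Pos R6) \<and> ?P (Neg R6)" by (rule p[of R3 R4, OF _ g r4]) auto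
  have r7: "?P (Pos R7) \<and> ?P (Neg R7)" by (rule p[of R4 R5, OF _ r4 r5]) auto
  have r: "?P (Pos r) \<and> ?P (Neg r)" for r
    using g[of r] r4 r5 r6 r7 by (cases r) blast+
  have h: "\<forall>k\<in>{1..4}. \<omega> (wk_vec \<alpha> (H k)) = wk_vec \<alpha> (H k)" using assms by (simp add: is_wk_omega_def)
  have t: "?P (Tor t)" for t
    using bspec[OF h, of 1] bspec[OF h, of 2] bspec[OF h, of 3] bspec[OF h, of 4]
    by (cases t) (simp_all add: idx_label.simps del: wk_vec.simps)
  have P: "?P i" for i using r t by (cases i) auto
  fix v assume v: "v \<in> vcarrier (wk \<alpha>)"
  have "\<phi> (\<omega> v) k + \<phi> (om v) k = 0" for k
  proof (rule wk.linear_form_zero[OF _ _ v, of "\<lambda>v. \<phi> (\<omega> v) k + \<phi> (om v) k"])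
    have "vlinear (wk \<alpha>) (wk \<alpha>) om" using om_is_omega by (simp add: is_wk_omega_def lie_aut_def)
    then show "wk.linear_form (\<lambda>v. \<phi> (\<omega> v) k + \<phi> (om v) k)"
      using wk.linear_form_coord[OF aut(1), of k] wk.linear_form_coord[of om k] by (auto simp: wk.linear_form_def algebra_simps)
  qed (simp add: P om_vec)
  then show "\<omega> v = om v"
    using v om wk.vlinear_in[OF aut(1)] by (intro wk.eqI) auto
qed

lemma ex1_omega: "\<exists>!\<omega>. is_wk_omega \<alpha> \<omega>"
  using om_is_omega omega_unique by blast

lemma wk_omega_om: "wk_omega \<alpha> = om"
  unfolding wk_omega_def using om_is_omega omega_unique by (rule the_equality)

lemma om_wk1: "v \<in> vcarrier (wk1 \<alpha>) \<Longrightarrow> om v \<in> vcarrier (wk1 \<alpha>)"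
  by (simp add: wk1_carrier om)

lemma om_bij1: "bij_betw om (vcarrier (wk1 \<alpha>)) (vcarrier (wk1 \<alpha>))"
  by (rule bij_betw_byWitness[where f' = om]) (use om_wk1 om_om in \<open>auto simp: wk1_carrier\<close>)

lemma proj_swap: "proj (\<lambda>k. f (swap_idx k)) k = proj f (swap_idx k)"
  by (cases k) (simp_all add: proj_apply)

lemma \<phi>c_om: "v \<in> vcarrier (wk1 \<alpha>) \<Longrightarrow> \<phi>c (om v) k = \<phi>c v (swap_idx k)"
proof -
  assume "v \<in> vcarrier (wk1 \<alpha>)"
  then have "\<phi> (om v) = (\<lambda>k. \<phi> v (swap_idx k))" by (intro ext om(2)) (simp add: wk1_carrier)
  then show "\<phi>c (om v) k = \<phi>c v (swap_idx k)" by (simp only: proj_swap)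
qed

lemma om_wk_c: assumes "v \<in> wk_c \<alpha>" shows "om v \<in> wk_c \<alpha>"
proof -
  have v: "v \<in> vcarrier (wk1 \<alpha>)" "\<phi>c v = (\<lambda>k. 0)" using assms unfolding wk_c_kernel kernel_def by blast+
  have "\<phi>c (om v) = (\<lambda>k. 0)"
    by (rule ext) (simp only: \<phi>c_om[OF v(1)] v(2))
  then show ?thesis unfolding wk_c_kernel kernel_def using om_wk1[OF v(1)] by blast
qed

lemma om_coset:
  assumes v: "v \<in> vcarrier (wk1 \<alpha>)"
  shows "om ` vcoset (wk1 \<alpha>) (wk_c \<alpha>) v = vcoset (wk1 \<alpha>) (wk_c \<alpha>) (om v)"
proof -
  have lin: "vlinear (wk \<alpha>) (wk \<alpha>) om" using om_is_omega by (simp add: is_wk_omega_def lie_aut_def)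
  have sub: "wk_c \<alpha> \<subseteq> vcarrier (wk1 \<alpha>)" using vsubspaceD(1)[OF wk_c_ideal(2)] .
  have in_wk: "u \<in> vcarrier (wk \<alpha>)" if "u \<in> vcarrier (wk1 \<alpha>)" for u using that by (simp add: wk1_carrier)
  have add: "om (vadd (wk1 \<alpha>) v u) = vadd (wk1 \<alpha>) (om v) (om u)" if "u \<in> wk_c \<alpha>" for u
    unfolding wk1_simps by (rule wk.vlinear_ops(1)[OF lin in_wk[OF v] in_wk[OF subsetD[OF sub that]]])
  have inv: "om (om u) = u" if "u \<in> wk_c \<alpha>" for u by (rule om_om[OF in_wk[OF subsetD[OF sub that]]])
  have img: "om ` wk_c \<alpha> = wk_c \<alpha>"
  proof
    show "wk_c \<alpha> \<subseteq> om ` wk_c \<alpha>" using inv om_wk_c by (metis image_eqI subsetI)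
  qed (use om_wk_c in blast)
  have "om ` vcoset (wk1 \<alpha>) (wk_c \<alpha>) v = vadd (wk1 \<alpha>) (om v) ` om ` wk_c \<alpha>"
    unfolding vcoset_def image_image by (intro image_cong refl add)
  then show ?thesis unfolding img vcoset_def .
qed

lemma om_bij_quot: "bij_betw (image om) (vcarrier (wkq \<alpha>)) (vcarrier (wkq \<alpha>))"
proof -
  have "om ` u \<in> vcarrier (wkq \<alpha>) \<and> om ` om ` u = u" if u: "u \<in> vcarrier (wkq \<alpha>)" for u
  proof -
    obtain v where v: "v \<in> vcarrier (wk1 \<alpha>)" "u = vcoset (wk1 \<alpha>) (wk_c \<alpha>) v" using u unfolding wkq_carrier by blast
    have "om (om v) = v" using v(1) by (intro om_om) (simp add: wk1_carrier)
    then show ?thesis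
      unfolding v(2) om_coset[OF v(1)] om_coset[OF om_wk1[OF v(1)]] wkq_carrier using om_wk1[OF v(1)] by simp
  qed
  then show ?thesis by (intro bij_betw_byWitness[where f' = "image om"]) blast+
qed

lemma om_quot_coord: "u \<in> vcarrier (wkq \<alpha>) \<Longrightarrow> quot_map \<phi>c (om ` u) k = quot_map \<phi>c u (swap_idx k)"
proof -
  assume "u \<in> vcarrier (wkq \<alpha>)"
  then obtain v where v: "v \<in> vcarrier (wk1 \<alpha>)" "u = vcoset (wk1 \<alpha>) (wk_c \<alpha>) v" unfolding wkq_carrier by blast
  show ?thesis
    unfolding v(2) om_coset[OF v(1)] quot_map_\<phi>c[OF v(1)] quot_map_\<phi>c[OF om_wk1[OF v(1)]] by (rule \<phi>c_om[OF v(1)])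
qed

end

section \<open>The tables evaluated\<close>

lemma cocycle_table_em6: "cocycle_table br_wk idx_wk em6"
  by code_simp

lemma cocycle_table_em4_1: "cocycle_table br_wk idx_wk em4_1"
  by code_simp

lemma cocycle_table_em4_2: "cocycle_table br_wk idx_wk em4_2"
  by code_simp

lemma cocycle_table_em2: "cocycle_table br_wk idx_wk em2"
  by code_simp

lemma cocycle_table_e0: "cocycle_table br_wk idx_wk e0"
  by code_simp

lemma cocycle_table_e0_derived: "cocycle_table br_wk idx_derived e0_derived"
  by code_simp

lemma cocycle_table_em6_quotient: "cocycle_table br_quot idx_quot em6"
  by code_simp

lemma cocycle_table_em4_1_quotient: "cocycle_table br_quot idx_quot em4_1"
  by code_simp

lemma cocycle_table_em4_2_quotient: "cocycle_table br_quot idx_quot em4_2"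
  by code_simp

lemma cocycle_table_em2_quotient: "cocycle_table br_quot idx_quot em2"
  by code_simp

lemma cocycle_table_e0_quotient: "cocycle_table br_quot idx_quot e0_quotient"
  by code_simp

lemma rigid_wk: "rigid br_wk idx_wk (exprs e0) wk_pivots"
  by code_simp

lemma rigid_derived: "rigid br_wk idx_derived (exprs e0_derived) derived_pivots"
  by code_simp

lemma rigid_quotient: "rigid br_quot idx_quot (exprs e0_quotient) quotient_pivots"
  by code_simp

lemma expr_ok_neg:
  "expr_ok idx_wk (- 6) em6" "expr_ok idx_wk (- 4) em4_1" "expr_ok idx_wk (- 4) em4_2" "expr_ok idx_wk (- 2) em2"
  "expr_ok idx_derived (- 6) em6" "expr_ok idx_derived (- 4) em4_1" "expr_ok idx_derived (- 4) em4_2" "expr_ok idx_derived (- 2) em2"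
  "expr_ok idx_quot (- 6) em6" "expr_ok idx_quot (- 4) em4_1" "expr_ok idx_quot (- 4) em4_2" "expr_ok idx_quot (- 2) em2"
  by code_simp+

lemma expr_ok_zero: "expr_ok idx_wk 0 e0" "expr_ok idx_derived 0 e0_derived" "expr_ok idx_quot 0 e0_quotient"
  by code_simp+

section \<open>The theorem\<close>

context params
begin

lemma c_0_exprs:
  "c_0 \<alpha> = map (term_of_entry \<alpha>) e0" "c_0_derived \<alpha> = map (term_of_entry \<alpha>) e0_derived"
  "c_0_quotient \<alpha> = map (term_of_entry \<alpha>) e0_quotient"
  by (simp_all add: c_0_def c_0_derived_def c_0_quotient_def e0_def e0_derived_def e0_quotient_def
      term_of_entry_def idx_label.simps power2_eq_square algebra_simps)

lemma wk_cohomology: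
  defines "C \<equiv> all_cocycles (wk \<alpha>) (labels {1..4}) (wk_vec \<alpha>) (wk_omega \<alpha>) \<alpha> (c_0 \<alpha>)"
  shows "H2_spanned_by (wk \<alpha>) (fst ` C) \<and> (\<forall>(c, d)\<in>C. has_degree (wk \<alpha>) (label_degrees {1..4} (wk_vec \<alpha>)) c d)"
  unfolding C_def wk_omega_om
proof (rule wk.all_cocycles_spanning[OF rigid_wk expr_ok_neg(1-4) expr_ok_zero(1) _ om_bij om(2) c_0_exprs(1)])
  fix ts i j k u assume "ts \<in> {em6, em4_1, em4_2, em2, e0}" and ijk: "i \<in> set idx_wk" "j \<in> set idx_wk" "k \<in> set idx_wk"
  then have "cocycle_table br_wk idx_wk ts"
    using cocycle_table_em6 cocycle_table_em4_1 cocycle_table_em4_2 cocycle_table_em2 cocycle_table_e0 by blast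
  then show "cocycle_sum br_wk (expr_array ts) i j k u = 0"
    by (rule cocycle_table[OF _ wk.S_sym wk.S_alt ijk])
qed

lemma wk1_cohomology:
  defines "C \<equiv> all_cocycles (wk1 \<alpha>) (labels {1..3}) (wk_vec \<alpha>) (wk_omega \<alpha>) \<alpha> (c_0_derived \<alpha>)"
  shows "H2_spanned_by (wk1 \<alpha>) (fst ` C) \<and> (\<forall>(c, d)\<in>C. has_degree (wk1 \<alpha>) (label_degrees {1..3} (wk_vec \<alpha>)) c d)"
  unfolding C_def wk_omega_om
proof (rule der.all_cocycles_spanning[OF rigid_derived expr_ok_neg(5-8) expr_ok_zero(2) _ om_bij1 _ c_0_exprs(2)])
  show "\<phi> (om v) k = \<phi> v (swap_idx k)" if "v \<in> vcarrier (wk1 \<alpha>)" for v k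
    using that by (intro om(2)) (simp add: wk1_carrier)
next
  fix ts i j k u assume ts: "ts \<in> {em6, em4_1, em4_2, em2, e0_derived}"
    and ijk: "i \<in> set idx_derived" "j \<in> set idx_derived" "k \<in> set idx_derived"
  show "cocycle_sum br_wk (expr_array ts) i j k u = 0"
  proof (cases "ts = e0_derived")
    case True
    then show ?thesis using cocycle_table[OF cocycle_table_e0_derived der.S_sym der.S_alt ijk] by simp
  next
    case False
    then have "cocycle_table br_wk idx_wk ts"
      using ts cocycle_table_em6 cocycle_table_em4_1 cocycle_table_em4_2 cocycle_table_em2 by blast
    then show ?thesis by (rule cocycle_table[OF _ wk.S_sym wk.S_alt all_idx all_idx all_idx])
  qed
qed

lemma wkq_cohomology:
  defines "C \<equiv> all_cocycles (wkq \<alpha>) (labels {2, 3}) (wkq_vec \<alpha>) (image (wk_omega \<alpha>)) \<alpha> (c_0_quotient \<alpha>)"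
  shows "H2_spanned_by (wkq \<alpha>) (fst ` C) \<and> (\<forall>(c, d)\<in>C. has_degree (wkq \<alpha>) (label_degrees {2, 3} (wkq_vec \<alpha>)) c d)"
  unfolding C_def wk_omega_om
proof (rule quo.all_cocycles_spanning[OF rigid_quotient expr_ok_neg(9-12) expr_ok_zero(3) _ om_bij_quot om_quot_coord c_0_exprs(3)])
  fix ts i j k u assume "ts \<in> {em6, em4_1, em4_2, em2, e0_quotient}"
    and ijk: "i \<in> set idx_quot" "j \<in> set idx_quot" "k \<in> set idx_quot"
  then have "cocycle_table br_quot idx_quot ts"
    using cocycle_table_em6_quotient cocycle_table_em4_1_quotient cocycle_table_em4_2_quotient cocycle_table_em2_quotient
      cocycle_table_e0_quotient by blast
  then show "cocycle_sum br_quot (expr_array ts) i j k u = 0"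
    by (rule cocycle_table[OF _ quo.S_sym quo.S_alt ijk])
qed

end

theorem lemma9p9:
  fixes \<alpha> :: "'k::alg_closed_field"
  assumes "CHAR('k) = 2" and "\<alpha> \<noteq> 0" and "\<alpha> \<noteq> 1"
  defines "G \<equiv> label_degrees {1..4} (wk_vec \<alpha>)"
    and "G1 \<equiv> label_degrees {1..3} (wk_vec \<alpha>)"
    and "Gq \<equiv> label_degrees {2, 3} (wkq_vec \<alpha>)"
    and "C \<equiv> all_cocycles (wk \<alpha>) (labels {1..4}) (wk_vec \<alpha>) (wk_omega \<alpha>) \<alpha> (c_0 \<alpha>)"
    and "C1 \<equiv> all_cocycles (wk1 \<alpha>) (labels {1..3}) (wk_vec \<alpha>) (wk_omega \<alpha>) \<alpha> (c_0_derived \<alpha>)"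
    and "Cq \<equiv> all_cocycles (wkq \<alpha>) (labels {2, 3}) (wkq_vec \<alpha>) (image (wk_omega \<alpha>)) \<alpha> (c_0_quotient \<alpha>)"
  shows "(\<exists>!\<omega>. is_wk_omega \<alpha> \<omega>) \<and>
    (vbasis (wk \<alpha>) (labels {1..4}) (wk_vec \<alpha>) \<and>
     H2_spanned_by (wk \<alpha>) (fst ` C) \<and> (\<forall>(c, d)\<in>C. has_degree (wk \<alpha>) G c d)) \<and>
    (vbasis (wk1 \<alpha>) (labels {1..3}) (wk_vec \<alpha>) \<and>
     H2_spanned_by (wk1 \<alpha>) (fst ` C1) \<and> (\<forall>(c, d)\<in>C1. has_degree (wk1 \<alpha>) G1 c d)) \<and>
    (wk_c \<alpha> = lie_center (wk1 \<alpha>) \<and> vbasis (wkq \<alpha>) (labels {2, 3}) (wkq_vec \<alpha>) \<and>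
     H2_spanned_by (wkq \<alpha>) (fst ` Cq) \<and> (\<forall>(c, d)\<in>Cq. has_degree (wkq \<alpha>) Gq c d))"
proof -
  have "(1::'k) + 1 = of_nat (CHAR('k))" using assms(1) by simp
  then have "(1::'k) + 1 = 0" by (simp only: of_nat_CHAR)
  then interpret params \<alpha> using assms(2,3) by unfold_locales
  have "vbasis (wk \<alpha>) (labels {1..4}) (wk_vec \<alpha>)" "vbasis (wk1 \<alpha>) (labels {1..3}) (wk_vec \<alpha>)"
    "vbasis (wkq \<alpha>) (labels {2, 3}) (wkq_vec \<alpha>)"
    using wk.vbasis_e der.vbasis_e quo.vbasis_e unfolding labels_idx .
  then show ?thesis
    unfolding G_def G1_def Gq_def C_def C1_def Cq_def
    using ex1_omega wk_cohomology wk1_cohomology wkq_cohomology wk_c_center by blast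
qed

end
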